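(* Let $\mathcal H$ be a partial building set in a geometric lattice $L$, and let $\mathcal L=\mathcal L(L,\mathcal H)$. There is a decomposition as $\mathrm{DP}(L,\mathcal H)$-modules: for all $i,j\ge0$, $$\hat B^{i,j}(L,\mathcal H)\cong\bigoplus_{y\in\mathcal L_j}\mathrm{OS}^j(\mathcal L_{\le y})\otimes_{\mathbb Q}\mathrm{DP}^i_y(L,\mathcal H).$$ Similarly, if $\hat 1\in\mathcal H$, $$B^{i,j}(L,\mathcal H)\cong\bigoplus_{y\in\mathcal L_j,\ y\not\ge(\hat 1,\hat 0)}\mathrm{OS}^j(\mathcal L_{\le y})\otimes_{\mathbb Q}\mathrm{DP}^i_y(L,\mathcal H),$$ where $(\hat 1,\hat 0)$ denotes the atom of $\mathcal L$ corresponding to $\hat 1$ and $\mathcal L_j$ is the set of elements of rank $j$.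
   Context: All posets are finite. For a meet-semilattice $P$ with least element $\hat 0$, write $P_+=P\setminus\{\hat 0\}$, $\mathrm{a}(P)$ for its set of atoms. $P$ is locally geometric if every interval $[\hat 0,x]$ is a geometric lattice; $M(P_{\le x})$ is the simple matroid on the atoms below $x$ whose lattice of flats is $[\hat 0,x]$. Blowups. For $p\in P_+$, let $P_{(p)}=\{x\in P: x\not\ge p,\ p\vee x \text{ exists}\}$ and $\mathrm{Bl}_p(P)=\{x\in P:x\not\ge p\}\cup\{(p,x):x\in P_{(p)}\}$, ordered by: $y>x$ if $y>x$ in $P$; $(p,y)>(p,x)$ if $y>x$ in $P$; $(p,y)>x$ if $y\ge x$ in $P$. Building sets. $\mathcal G\subseteq L_+$ is a building set if for every $x\in L_+$ with $\max \mathcal G_{\le x}=\{x_1,\dots,x_k\}$ there is a poset isomorphism $\prod_j[\hat 0,x_j]\to[\hat 0,x]$ sending $(\hat 0,\dots,x_j,\dots,\hat 0)$ to $x_j$; always $\hat 1\in\mathcal G$. A partial building set is $\mathcal H\subseteq\mathcal G$ (for some building set $\mathcal G$) with $\mathrm{a}(L)\subseteq\mathcal H$ and $\mathcal H^\circ:=\mathcal H\setminus \mathrm{a}(L)$ upward closed in $\mathcal G$. Fix a linear order $\prec$ on $\mathcal H$ with $p\ge q\Rightarrow p\prec q$. Writing $\mathcal H^\circ=\{p_1\prec\dots\prec p_m\}$, set $\mathcal L(L,\mathcal H)=\mathrm{Bl}_{p_m}\circ\cdots\circ\mathrm{Bl}_{p_1}(L)$, a locally geometric semilattice whose atoms are identified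 with $\mathcal H$. $S\subseteq\mathcal H$ is $\mathcal H$-nested if the join in $L$ of any two or more pairwise incomparable elements of $S$ is not in $\mathcal H$; $N(L,\mathcal H)$ is the complex of nested sets (equivalently, sets of atoms of $\mathcal L(L,\mathcal H)$ with an upper bound). $S\in N(L,\mathcal H)$ is a circuit if it is a circuit of $M(\mathcal L(L,\mathcal H)_{\le\bigvee S})$. Algebras. $R(\mathcal H)=\mathbb Q[e_g,x_g:g\in\mathcal H]$ is the free graded-commutative algebra with $e_g$ in bidegree $(0,1)$, $x_g$ in bidegree $(2,0)$. Put $e_S=e_{g_1}\cdots e_{g_k}$ for $S=\{g_1\prec\dots\prec g_k\}$, $x_T=\prod_{g\in T}x_g$, $\partial e_S=\sum_j(-1)^{j-1}e_{g_1}\cdots\widehat{e_{g_j}}\cdots e_{g_k}$, $c_g=\sum_{h\in\mathcal H,\,h\ge g}x_h$. $\hat B(L,\mathcal H)$ is the quotient of $R(\mathcal H)$ by the ideal generated by (i) $e_Sx_T$ whenever $S\cup T\notin N(L,\mathcal H)$; (ii) $\partial e_S$ whenever $S\in N(L,\mathcal H)$ is a circuit; (iii) $c_g$ for $g\in\mathrm{a}(L)$. If $\hat 1\in\mathcal H$, $B(L,\mathcal H)=\hat B(L,\mathcal H)/(e_{\hat 1})$. They are bigraded. $\mathrm{DP}(L,\mathcal H)=\mathbb Q[x_g:g\in\mathcal H]/(x_T: T\notin N(L,\mathcal H);\ c_g: g\in\mathrm{a}(L))$, with $\deg x_g=2$; it acts on $\hat B$ and $B$ by multiplication. For $y\in\mathcal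 L$ with $y=\bigvee S$, $S\in N(L,\mathcal H)$ (join in $\mathcal L$), $\mathrm{DP}_y(L,\mathcal H)=\mathbb Q[x_g:g\in\mathcal H]/(x_T: S\cup T\notin N(L,\mathcal H);\ c_g: g\in\mathrm{a}(L))$, independent of the choice of $S$; it is a quotient of $\mathrm{DP}(L,\mathcal H)$. For a geometric lattice $K$, $\mathrm{OS}(K)$ is the exterior algebra over $\mathbb Q$ on $\{e_g:g\in\mathrm{a}(K)\}$ modulo the ideal generated by $\partial e_C$ for circuits $C$ of $M(K)$; $\mathrm{OS}^j$ is its degree $j$ part. *)

theory Defs
  imports
    Complex_Main
    "HOL-Algebra.Lattice"
    "HOL-Algebra.QuotRing"
    "HOL-Algebra.Module"
    "HOL-Library.Poly_Mapping"
begin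

section \<open>Posets and geometric lattices\<close>

definition below :: "'a gorder \<Rightarrow> 'a \<Rightarrow> 'a gorder" where
  "below P x = P\<lparr>carrier := {z \<in> carrier P. z \<sqsubseteq>\<^bsub>P\<^esub> x}\<rparr>"

definition covered_by :: "'a gorder \<Rightarrow> 'a \<Rightarrow> 'a \<Rightarrow> bool" where
  "covered_by P x y \<longleftrightarrow> x \<sqsubset>\<^bsub>P\<^esub> y \<and> \<not> (\<exists>z\<in>carrier P. x \<sqsubset>\<^bsub>P\<^esub> z \<and> z \<sqsubset>\<^bsub>P\<^esub> y)"

definition atoms :: "'a gorder \<Rightarrow> 'a set" where
  "atoms P = {a \<in> carrier P. covered_by P \<bottom>\<^bsub>P\<^esub> a}"

text \<open>The rank of \<open>y\<close> is the maximal length of a chain in the interval from the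
  bottom element to \<open>y\<close>, a chain with \<open>n + 1\<close> elements having length \<open>n\<close>.\<close>

definition poset_rank :: "'a gorder \<Rightarrow> 'a \<Rightarrow> nat" where
  "poset_rank P y = Max {card C - 1 | C. C \<subseteq> carrier (below P y)
     \<and> (\<forall>a\<in>C. \<forall>b\<in>C. a \<sqsubseteq>\<^bsub>P\<^esub> b \<or> b \<sqsubseteq>\<^bsub>P\<^esub> a)}"

definition geometric_lattice :: "'a gorder \<Rightarrow> bool" where
  "geometric_lattice L \<longleftrightarrow>
     lattice L \<and> finite (carrier L) \<and> carrier L \<noteq> {}
     \<and> (\<forall>x\<in>carrier L. x = \<Squnion>\<^bsub>L\<^esub> {a \<in> atoms L. a \<sqsubseteq>\<^bsub>L\<^esub> x})
     \<and> (\<forall>x\<in>carrier L. \<forall>y\<in>carrier L.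
          covered_by L (x \<sqinter>\<^bsub>L\<^esub> y) x \<longrightarrow> covered_by L y (x \<squnion>\<^bsub>L\<^esub> y))"

text \<open>For a geometric lattice \<open>K\<close>, the matroid \<open>M(K)\<close> on the atoms of \<open>K\<close> has as flats the
  sets of all atoms below a given element. Hence its closure operator sends \<open>S\<close> to the set of
  atoms below the join of \<open>S\<close>, and \<open>S\<close> is independent iff no \<open>s \<in> S\<close> lies in the closure
  of \<open>S - {s}\<close>.\<close>

definition lattice_indep :: "'a gorder \<Rightarrow> 'a set \<Rightarrow> bool" where
  "lattice_indep K S \<longleftrightarrow> S \<subseteq> atoms K \<and> (\<forall>s\<in>S. \<not> s \<sqsubseteq>\<^bsub>K\<^esub> \<Squnion>\<^bsub>K\<^esub> (S - {s}))"

definition lattice_circuit :: "'a gorder \<Rightarrow> 'a set \<Rightarrow> bool" where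
  "lattice_circuit K C \<longleftrightarrow>
     C \<subseteq> atoms K \<and> \<not> lattice_indep K C \<and> (\<forall>D. D \<subset> C \<longrightarrow> lattice_indep K D)"

section \<open>Blowups\<close>

text \<open>\<open>Exc p x\<close> stands for the new element \<open>(p, x)\<close> of a blowup at \<open>p\<close>. Blowing up twice
  at the same \<open>p\<close> would identify new elements with old ones; this does not arise below, since \<open>p\<close>
  no longer belongs to the poset once it has been blown up.\<close>

datatype 'a blow = Old 'a | Exc "'a blow" "'a blow"

definition old_part :: "'a blow \<Rightarrow> 'a blow gorder \<Rightarrow> 'a blow set" where
  "old_part p P = {x \<in> carrier P. \<not> p \<sqsubseteq>\<^bsub>P\<^esub> x}"

definition link_part :: "'a blow \<Rightarrow> 'a blow gorder \<Rightarrow> 'a blow set" where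
  "link_part p P = {x \<in> old_part p P. \<exists>s. least P s (Upper P {p, x})}"

definition blowup :: "'a blow \<Rightarrow> 'a blow gorder \<Rightarrow> 'a blow gorder" where
  "blowup p P =
     \<lparr>carrier = old_part p P \<union> Exc p ` link_part p P,
      eq = (=),
      le = (\<lambda>u v.
        (u \<in> old_part p P \<and> v \<in> old_part p P \<and> u \<sqsubseteq>\<^bsub>P\<^esub> v)
        \<or> (\<exists>x\<in>link_part p P. \<exists>y\<in>link_part p P. u = Exc p x \<and> v = Exc p y \<and> x \<sqsubseteq>\<^bsub>P\<^esub> y)
        \<or> (u \<in> old_part p P \<and> (\<exists>y\<in>link_part p P. v = Exc p y \<and> u \<sqsubseteq>\<^bsub>P\<^esub> y)))\<rparr>"

definition embed_order :: "'a gorder \<Rightarrow> 'a blow gorder" where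
  "embed_order L =
     \<lparr>carrier = Old ` carrier L, eq = (=),
      le = (\<lambda>u v. \<exists>x\<in>carrier L. \<exists>y\<in>carrier L. u = Old x \<and> v = Old y \<and> x \<sqsubseteq>\<^bsub>L\<^esub> y)\<rparr>"

section \<open>Building sets and nested sets\<close>

definition max_below :: "'a gorder \<Rightarrow> 'a set \<Rightarrow> 'a \<Rightarrow> 'a set" where
  "max_below L G x = {g \<in> G. g \<sqsubseteq>\<^bsub>L\<^esub> x \<and> (\<forall>h\<in>G. h \<sqsubseteq>\<^bsub>L\<^esub> x \<longrightarrow> g \<sqsubseteq>\<^bsub>L\<^esub> h \<longrightarrow> h = g)}"

definition building_set :: "'a gorder \<Rightarrow> 'a set \<Rightarrow> bool" where
  "building_set L G \<longleftrightarrow>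
     G \<subseteq> carrier L - {\<bottom>\<^bsub>L\<^esub>} \<and> \<top>\<^bsub>L\<^esub> \<in> G
     \<and> (\<forall>x\<in>carrier L - {\<bottom>\<^bsub>L\<^esub>}.
          let X = max_below L G x; D = (\<Pi>\<^sub>E g\<in>X. carrier (below L g)) in
          \<exists>\<phi>. bij_betw \<phi> D (carrier (below L x))
             \<and> (\<forall>u\<in>D. \<forall>v\<in>D. \<phi> u \<sqsubseteq>\<^bsub>L\<^esub> \<phi> v \<longleftrightarrow> (\<forall>g\<in>X. u g \<sqsubseteq>\<^bsub>L\<^esub> v g))
             \<and> (\<forall>g\<in>X. \<phi> (\<lambda>h\<in>X. if h = g then g else \<bottom>\<^bsub>L\<^esub>) = g))"

definition partial_building_set :: "'a gorder \<Rightarrow> 'a set \<Rightarrow> bool" where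
  "partial_building_set L H \<longleftrightarrow>
     (\<exists>G. building_set L G \<and> H \<subseteq> G \<and> atoms L \<subseteq> H
        \<and> (\<forall>h\<in>H - atoms L. \<forall>g\<in>G. h \<sqsubseteq>\<^bsub>L\<^esub> g \<longrightarrow> g \<in> H - atoms L))"

text \<open>A linear order \<open>\<prec>\<close> on \<open>H\<close> is given as a strict relation \<open>r\<close>: \<open>(p, q) \<in> r\<close> means
  \<open>p \<prec> q\<close>. The list below is the increasing enumeration of the non-atoms of \<open>H\<close>;
  \<open>fold\<close> blows up its head first.\<close>

definition blowup_centres :: "'a gorder \<Rightarrow> 'a set \<Rightarrow> ('a \<times> 'a) set \<Rightarrow> 'a list" where
  "blowup_centres L H r =
     (THE ps. set ps = H - atoms L \<and> sorted_wrt (\<lambda>p q. (p, q) \<in> r) ps)"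

definition iter_blowup :: "'a gorder \<Rightarrow> 'a set \<Rightarrow> ('a \<times> 'a) set \<Rightarrow> 'a blow gorder" where
  "iter_blowup L H r = fold blowup (map Old (blowup_centres L H r)) (embed_order L)"

text \<open>The atom of the iterated blowup corresponding to \<open>g \<in> H\<close>.\<close>

definition vertex :: "'a gorder \<Rightarrow> 'a \<Rightarrow> 'a blow" where
  "vertex L g = (if g \<in> atoms L then Old g else Exc (Old g) (Old \<bottom>\<^bsub>L\<^esub>))"

definition vertex_order :: "'a gorder \<Rightarrow> ('a \<times> 'a) set \<Rightarrow> ('a blow \<times> 'a blow) set" where
  "vertex_order L r = map_prod (vertex L) (vertex L) ` r"

definition nested :: "'a gorder \<Rightarrow> 'a set \<Rightarrow> 'a set \<Rightarrow> bool" where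
  "nested L H S \<longleftrightarrow> S \<subseteq> H
     \<and> (\<forall>A. A \<subseteq> S \<and> card A \<ge> 2 \<and> (\<forall>a\<in>A. \<forall>b\<in>A. a \<noteq> b \<longrightarrow> \<not> a \<sqsubseteq>\<^bsub>L\<^esub> b)
          \<longrightarrow> \<Squnion>\<^bsub>L\<^esub> A \<notin> H)"

definition nested_join :: "'a gorder \<Rightarrow> 'a set \<Rightarrow> ('a \<times> 'a) set \<Rightarrow> 'a set \<Rightarrow> 'a blow" where
  "nested_join L H r S = \<Squnion>\<^bsub>iter_blowup L H r\<^esub> (vertex L ` S)"

definition nested_circuit :: "'a gorder \<Rightarrow> 'a set \<Rightarrow> ('a \<times> 'a) set \<Rightarrow> 'a set \<Rightarrow> bool" where
  "nested_circuit L H r S \<longleftrightarrow> nested L H S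
     \<and> lattice_circuit (below (iter_blowup L H r) (nested_join L H r S)) (vertex L ` S)"

section \<open>Polynomial and exterior algebras\<close>

type_synonym 'a qpoly = "('a \<Rightarrow>\<^sub>0 nat) \<Rightarrow>\<^sub>0 rat"

definition polys :: "'a set \<Rightarrow> 'a qpoly set" where
  "polys H = {p. \<forall>m\<in>Poly_Mapping.keys p. Poly_Mapping.keys m \<subseteq> H}"

definition poly_ring :: "'a set \<Rightarrow> 'a qpoly ring" where
  "poly_ring H = \<lparr>carrier = polys H, mult = (*), one = 1, zero = 0, add = (+)\<rparr>"

definition pvar :: "'a \<Rightarrow> 'a qpoly" where
  "pvar g = Poly_Mapping.single (Poly_Mapping.single g 1) 1"

definition pconst :: "rat \<Rightarrow> 'a qpoly" where
  "pconst c = Poly_Mapping.single 0 c"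

text \<open>The variables have degree 2.\<close>

definition poly_homog :: "nat \<Rightarrow> 'a qpoly \<Rightarrow> bool" where
  "poly_homog i p \<longleftrightarrow> (\<forall>m\<in>Poly_Mapping.keys p.
     2 * (\<Sum>g\<in>Poly_Mapping.keys m. Poly_Mapping.lookup m g) = i)"

text \<open>The exterior algebra on generators \<open>e\<^sub>g\<close> (\<open>g \<in> E\<close>, with \<open>E\<close> finite and strictly ordered
  by \<open>r\<close>) over a commutative coefficient ring \<open>A\<close>, in its standard basis: the function \<open>f\<close>
  stands for the sum of all \<open>f S e\<^sub>S\<close>, where \<open>e\<^sub>S\<close> is the product of the \<open>e\<^sub>g\<close>, \<open>g \<in> S\<close>, in
  increasing order. For disjoint \<open>S\<close> and \<open>T\<close>, sorting the product of \<open>e\<^sub>S\<close> and \<open>e\<^sub>T\<close> costs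
  one transposition for each pair \<open>(s, t) \<in> S \<times> T\<close> with \<open>t \<prec> s\<close>.\<close>

definition shuffle_sign :: "('e \<times> 'e) set \<Rightarrow> 'e set \<Rightarrow> 'e set \<Rightarrow> 'c::comm_ring_1" where
  "shuffle_sign r S T = (- 1) ^ card {(s, t). s \<in> S \<and> t \<in> T \<and> (t, s) \<in> r}"

definition ext_alg ::
  "('e \<times> 'e) set \<Rightarrow> 'e set \<Rightarrow> 'c::comm_ring_1 set \<Rightarrow> ('e set \<Rightarrow> 'c) ring" where
  "ext_alg r E A =
     \<lparr>carrier = {f. (\<forall>S. f S \<in> A) \<and> (\<forall>S. f S \<noteq> 0 \<longrightarrow> S \<subseteq> E)},
      mult = (\<lambda>f g U. \<Sum>S\<in>Pow U. shuffle_sign r S (U - S) * f S * g (U - S)),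
      one = (\<lambda>S. if S = {} then 1 else 0),
      zero = (\<lambda>S. 0),
      add = (\<lambda>f g S. f S + g S)\<rparr>"

text \<open>The element \<open>a e\<^sub>S\<close>; in particular \<open>ext_single {} a\<close> is the scalar \<open>a\<close>.\<close>

definition ext_single :: "'e set \<Rightarrow> 'c \<Rightarrow> 'e set \<Rightarrow> 'c::comm_ring_1" where
  "ext_single S a = (\<lambda>U. if U = S then a else 0)"

text \<open>If \<open>g\<close> is the \<open>j\<close>-th element of \<open>S\<close>, then \<open>j - 1\<close> is the number of elements of \<open>S\<close>
  preceding \<open>g\<close>.\<close>

definition ext_boundary :: "('e \<times> 'e) set \<Rightarrow> 'e set \<Rightarrow> 'e set \<Rightarrow> 'c::comm_ring_1" where
  "ext_boundary r S = (\<lambda>U. \<Sum>g\<in>S. ext_single (S - {g}) ((- 1) ^ card {h \<in> S. (h, g) \<in> r}) U)"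

definition ext_homog :: "nat \<Rightarrow> ('e set \<Rightarrow> 'c::comm_ring_1) \<Rightarrow> bool" where
  "ext_homog j f \<longleftrightarrow> (\<forall>S. f S \<noteq> 0 \<longrightarrow> card S = j)"

section \<open>Modules\<close>

text \<open>The submodule \<open>C\<close> of the ring \<open>A\<close>, on which scalars act by multiplication through \<open>\<phi>\<close>.\<close>

definition alg_module :: "'m ring \<Rightarrow> 'm set \<Rightarrow> ('c \<Rightarrow> 'm) \<Rightarrow> ('c, 'm) module" where
  "alg_module A C \<phi> =
     \<lparr>carrier = C, mult = mult A, one = one A, zero = zero A, add = add A,
      smult = (\<lambda>c x. \<phi> c \<otimes>\<^bsub>A\<^esub> x)\<rparr>"

text \<open>The map of quotients induced by a map \<open>h\<close>: all cosets in the union coincide when \<open>F\<close> is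
  a coset of an ideal which \<open>h\<close> sends into \<open>I\<close>.\<close>

definition coset_map :: "'m ring \<Rightarrow> 'm set \<Rightarrow> ('n \<Rightarrow> 'm) \<Rightarrow> 'n set \<Rightarrow> 'm set" where
  "coset_map R I h F = (\<Union>f\<in>F. I +>\<^bsub>R\<^esub> h f)"

text \<open>Here and below, the ring components of a module which play no role are unspecified.\<close>

definition quot_module :: "('c, 'm) module \<Rightarrow> 'm set \<Rightarrow> ('c, 'm set) module" where
  "quot_module M W =
     \<lparr>carrier = a_rcosets\<^bsub>M\<^esub> W, mult = undefined, one = undefined, zero = W, add = set_add M,
      smult = (\<lambda>c X. \<Union>x\<in>X. W +>\<^bsub>M\<^esub> (c \<odot>\<^bsub>M\<^esub> x))\<rparr>"

text \<open>The direct sum of a finite family of modules.\<close>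

definition direct_sum :: "'i set \<Rightarrow> ('i \<Rightarrow> ('c, 'm) module) \<Rightarrow> ('c, 'i \<Rightarrow> 'm) module" where
  "direct_sum I M =
     \<lparr>carrier = (\<Pi>\<^sub>E y\<in>I. carrier (M y)), mult = undefined, one = undefined,
      zero = (\<lambda>y\<in>I. \<zero>\<^bsub>M y\<^esub>),
      add = (\<lambda>f g. \<lambda>y\<in>I. f y \<oplus>\<^bsub>M y\<^esub> g y),
      smult = (\<lambda>c f. \<lambda>y\<in>I. c \<odot>\<^bsub>M y\<^esub> f y)\<rparr>"

text \<open>The tensor product over \<open>\<rat>\<close> of two rational vector spaces \<open>M\<close> and \<open>N\<close>: the free vector
  space on \<open>M \<times> N\<close> modulo the bilinearity relations. A further action \<open>act\<close> of a ring on \<open>N\<close>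
  makes it a module over that ring, via the second factor.\<close>

definition free_module ::
  "'m set \<Rightarrow> 'n set \<Rightarrow> ('c \<Rightarrow> 'n \<Rightarrow> 'n) \<Rightarrow> ('c, ('m \<times> 'n) \<Rightarrow>\<^sub>0 rat) module" where
  "free_module A B act =
     \<lparr>carrier = {t. Poly_Mapping.keys t \<subseteq> A \<times> B}, mult = undefined, one = undefined,
      zero = 0, add = (+),
      smult = (\<lambda>c t. \<Sum>(a, b)\<in>Poly_Mapping.keys t.
                 Poly_Mapping.single (a, act c b) (Poly_Mapping.lookup t (a, b)))\<rparr>"

definition tensor_rels ::
  "(rat, 'm) module \<Rightarrow> (rat, 'n) module \<Rightarrow> (('m \<times> 'n) \<Rightarrow>\<^sub>0 rat) set" where
  "tensor_rels M N =
     (let s = (\<lambda>a b. Poly_Mapping.single (a, b) (1::rat)) in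
       {s (a \<oplus>\<^bsub>M\<^esub> a') b - s a b - s a' b | a a' b.
          a \<in> carrier M \<and> a' \<in> carrier M \<and> b \<in> carrier N}
     \<union> {s a (b \<oplus>\<^bsub>N\<^esub> b') - s a b - s a b' | a b b'.
          a \<in> carrier M \<and> b \<in> carrier N \<and> b' \<in> carrier N}
     \<union> {s (c \<odot>\<^bsub>M\<^esub> a) b - Poly_Mapping.single (a, b) c | c a b.
          a \<in> carrier M \<and> b \<in> carrier N}
     \<union> {s a (c \<odot>\<^bsub>N\<^esub> b) - Poly_Mapping.single (a, b) c | c a b.
          a \<in> carrier M \<and> b \<in> carrier N})"

definition tensor_kernel ::
  "(rat, 'm) module \<Rightarrow> (rat, 'n) module \<Rightarrow> (('m \<times> 'n) \<Rightarrow>\<^sub>0 rat) set" where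
  "tensor_kernel M N = Modules.module.span (\<lambda>c. Poly_Mapping.map ((*) c)) (tensor_rels M N)"

definition tensor ::
  "(rat, 'm) module \<Rightarrow> (rat, 'n) module \<Rightarrow> ('c \<Rightarrow> 'n \<Rightarrow> 'n)
     \<Rightarrow> ('c, (('m \<times> 'n) \<Rightarrow>\<^sub>0 rat) set) module" where
  "tensor M N act = quot_module (free_module (carrier M) (carrier N) act) (tensor_kernel M N)"

text \<open>The subspace \<open>M \<otimes> V\<close> of \<open>M \<otimes> N\<close>, for a subspace \<open>V\<close> of \<open>N\<close>.\<close>

definition tensor_part ::
  "(rat, 'm) module \<Rightarrow> (rat, 'n) module \<Rightarrow> ('c \<Rightarrow> 'n \<Rightarrow> 'n) \<Rightarrow> 'n set
     \<Rightarrow> (('m \<times> 'n) \<Rightarrow>\<^sub>0 rat) set set" where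
  "tensor_part M N act V =
     (\<lambda>t. tensor_kernel M N +>\<^bsub>free_module (carrier M) (carrier N) act\<^esub> t)
       ` {t. Poly_Mapping.keys t \<subseteq> carrier M \<times> V}"

text \<open>\<open>Md i\<close> and \<open>Nd i\<close> are the parts of degree \<open>i\<close>.\<close>

definition graded_module_iso ::
  "'c ring \<Rightarrow> ('c, 'm) module \<Rightarrow> (nat \<Rightarrow> 'm set) \<Rightarrow> ('c, 'n) module \<Rightarrow> (nat \<Rightarrow> 'n set) \<Rightarrow> bool"
where
  "graded_module_iso R M Md N Nd \<longleftrightarrow>
     (\<exists>\<Phi>. \<Phi> \<in> iso (add_monoid M) (add_monoid N)
        \<and> (\<forall>c\<in>carrier R. \<forall>x\<in>carrier M. \<Phi> (c \<odot>\<^bsub>M\<^esub> x) = c \<odot>\<^bsub>N\<^esub> \<Phi> x)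
        \<and> (\<forall>i. \<Phi> ` Md i = Nd i))"

section \<open>The algebras \<open>DP\<close> and \<open>OS\<close>\<close>

definition x_mono :: "'a set \<Rightarrow> 'a qpoly" where
  "x_mono T = (\<Prod>g\<in>T. pvar g)"

definition c_elem :: "'a gorder \<Rightarrow> 'a set \<Rightarrow> 'a \<Rightarrow> 'a qpoly" where
  "c_elem L H g = (\<Sum>h\<in>{h \<in> H. g \<sqsubseteq>\<^bsub>L\<^esub> h}. pvar h)"

definition DP_ideal :: "'a gorder \<Rightarrow> 'a set \<Rightarrow> 'a set \<Rightarrow> 'a qpoly set" where
  "DP_ideal L H S = Idl\<^bsub>poly_ring H\<^esub>
     ({x_mono T | T. T \<subseteq> H \<and> \<not> nested L H (S \<union> T)} \<union> c_elem L H ` atoms L)"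

definition DP :: "'a gorder \<Rightarrow> 'a set \<Rightarrow> 'a qpoly set ring" where
  "DP L H = poly_ring H Quot DP_ideal L H {}"

definition nested_rep :: "'a gorder \<Rightarrow> 'a set \<Rightarrow> ('a \<times> 'a) set \<Rightarrow> 'a blow \<Rightarrow> 'a set" where
  "nested_rep L H r y = (SOME S. nested L H S \<and> nested_join L H r S = y)"

definition DPy_ideal :: "'a gorder \<Rightarrow> 'a set \<Rightarrow> ('a \<times> 'a) set \<Rightarrow> 'a blow \<Rightarrow> 'a qpoly set" where
  "DPy_ideal L H r y = DP_ideal L H (nested_rep L H r y)"

definition DPy :: "'a gorder \<Rightarrow> 'a set \<Rightarrow> ('a \<times> 'a) set \<Rightarrow> 'a blow \<Rightarrow> 'a qpoly set ring" where
  "DPy L H r y = poly_ring H Quot DPy_ideal L H r y"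

definition DPy_space ::
  "'a gorder \<Rightarrow> 'a set \<Rightarrow> ('a \<times> 'a) set \<Rightarrow> 'a blow \<Rightarrow> (rat, 'a qpoly set) module" where
  "DPy_space L H r y = alg_module (DPy L H r y) (carrier (DPy L H r y))
     (\<lambda>c. DPy_ideal L H r y +>\<^bsub>poly_ring H\<^esub> pconst c)"

definition DPy_act ::
  "'a gorder \<Rightarrow> 'a set \<Rightarrow> ('a \<times> 'a) set \<Rightarrow> 'a blow \<Rightarrow> 'a qpoly set \<Rightarrow> 'a qpoly set \<Rightarrow> 'a qpoly set"
where
  "DPy_act L H r y F X =
     coset_map (poly_ring H) (DPy_ideal L H r y) (\<lambda>f. f) F \<otimes>\<^bsub>DPy L H r y\<^esub> X"

definition DPy_part ::
  "'a gorder \<Rightarrow> 'a set \<Rightarrow> ('a \<times> 'a) set \<Rightarrow> 'a blow \<Rightarrow> nat \<Rightarrow> 'a qpoly set set" where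
  "DPy_part L H r y i =
     (\<lambda>p. DPy_ideal L H r y +>\<^bsub>poly_ring H\<^esub> p) ` {p \<in> polys H. poly_homog i p}"

definition exterior :: "('e \<times> 'e) set \<Rightarrow> 'e gorder \<Rightarrow> ('e set \<Rightarrow> rat) ring" where
  "exterior r K = ext_alg r (atoms K) UNIV"

definition OS_ideal :: "('e \<times> 'e) set \<Rightarrow> 'e gorder \<Rightarrow> ('e set \<Rightarrow> rat) set" where
  "OS_ideal r K = Idl\<^bsub>exterior r K\<^esub> {ext_boundary r C | C. lattice_circuit K C}"

definition OS :: "('e \<times> 'e) set \<Rightarrow> 'e gorder \<Rightarrow> ('e set \<Rightarrow> rat) set ring" where
  "OS r K = exterior r K Quot OS_ideal r K"

definition OS_part ::
  "('e \<times> 'e) set \<Rightarrow> 'e gorder \<Rightarrow> nat \<Rightarrow> (rat, ('e set \<Rightarrow> rat) set) module" where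
  "OS_part r K j = alg_module (OS r K)
     ((\<lambda>f. OS_ideal r K +>\<^bsub>exterior r K\<^esub> f) ` {f \<in> carrier (exterior r K). ext_homog j f})
     (\<lambda>c. OS_ideal r K +>\<^bsub>exterior r K\<^esub> ext_single {} c)"

text \<open>The \<open>DP\<close>-module \<open>OS\<^sup>j(\<L>\<^bsub>\<le>y\<^esub>) \<otimes> DP\<^sub>y\<close>, and its part \<open>OS\<^sup>j(\<L>\<^bsub>\<le>y\<^esub>) \<otimes> DP\<^sub>y\<^sup>i\<close>.\<close>

definition OS_DPy ::
  "'a gorder \<Rightarrow> 'a set \<Rightarrow> ('a \<times> 'a) set \<Rightarrow> nat \<Rightarrow> 'a blow
     \<Rightarrow> ('a qpoly set, ((('a blow set \<Rightarrow> rat) set \<times> 'a qpoly set) \<Rightarrow>\<^sub>0 rat) set) module" where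
  "OS_DPy L H r j y =
     tensor (OS_part (vertex_order L r) (below (iter_blowup L H r) y) j)
       (DPy_space L H r y) (DPy_act L H r y)"

definition OS_DPy_part ::
  "'a gorder \<Rightarrow> 'a set \<Rightarrow> ('a \<times> 'a) set \<Rightarrow> nat \<Rightarrow> nat \<Rightarrow> 'a blow
     \<Rightarrow> ((('a blow set \<Rightarrow> rat) set \<times> 'a qpoly set) \<Rightarrow>\<^sub>0 rat) set set" where
  "OS_DPy_part L H r i j y =
     tensor_part (OS_part (vertex_order L r) (below (iter_blowup L H r) y) j)
       (DPy_space L H r y) (DPy_act L H r y) (DPy_part L H r y i)"

section \<open>The bigraded algebras\<close>

text \<open>The free graded-commutative algebra on odd generators \<open>e\<^sub>g\<close> and even generators \<open>x\<^sub>g\<close> is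
  the exterior algebra on the \<open>e\<^sub>g\<close> over the polynomial ring in the \<open>x\<^sub>g\<close>.\<close>

definition free_gc :: "'a set \<Rightarrow> ('a \<times> 'a) set \<Rightarrow> ('a set \<Rightarrow> 'a qpoly) ring" where
  "free_gc H r = ext_alg r H (polys H)"

definition Bhat_ideal :: "'a gorder \<Rightarrow> 'a set \<Rightarrow> ('a \<times> 'a) set \<Rightarrow> ('a set \<Rightarrow> 'a qpoly) set" where
  "Bhat_ideal L H r = Idl\<^bsub>free_gc H r\<^esub>
     ({ext_single S (x_mono T) | S T. S \<subseteq> H \<and> T \<subseteq> H \<and> \<not> nested L H (S \<union> T)}
      \<union> {ext_boundary r S | S. nested_circuit L H r S}
      \<union> {ext_single {} (c_elem L H g) | g. g \<in> atoms L})"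

definition Bhat :: "'a gorder \<Rightarrow> 'a set \<Rightarrow> ('a \<times> 'a) set \<Rightarrow> ('a set \<Rightarrow> 'a qpoly) set ring" where
  "Bhat L H r = free_gc H r Quot Bhat_ideal L H r"

text \<open>\<open>Bhat_part L H r i j\<close> is the part of bidegree \<open>(i, j)\<close>; \<open>Bhat_col L H r j\<close> is the sum of
  these over all \<open>i\<close>, as a module over \<open>DP L H\<close>.\<close>

definition Bhat_part ::
  "'a gorder \<Rightarrow> 'a set \<Rightarrow> ('a \<times> 'a) set \<Rightarrow> nat \<Rightarrow> nat \<Rightarrow> ('a set \<Rightarrow> 'a qpoly) set set" where
  "Bhat_part L H r i j = (\<lambda>f. Bhat_ideal L H r +>\<^bsub>free_gc H r\<^esub> f)
     ` {f \<in> carrier (free_gc H r). ext_homog j f \<and> (\<forall>S. poly_homog i (f S))}"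

definition DP_to_Bhat ::
  "'a gorder \<Rightarrow> 'a set \<Rightarrow> ('a \<times> 'a) set \<Rightarrow> 'a qpoly set \<Rightarrow> ('a set \<Rightarrow> 'a qpoly) set" where
  "DP_to_Bhat L H r = coset_map (free_gc H r) (Bhat_ideal L H r) (ext_single {})"

definition Bhat_col ::
  "'a gorder \<Rightarrow> 'a set \<Rightarrow> ('a \<times> 'a) set \<Rightarrow> nat
     \<Rightarrow> ('a qpoly set, ('a set \<Rightarrow> 'a qpoly) set) module" where
  "Bhat_col L H r j = alg_module (Bhat L H r)
     ((\<lambda>f. Bhat_ideal L H r +>\<^bsub>free_gc H r\<^esub> f) ` {f \<in> carrier (free_gc H r). ext_homog j f})
     (DP_to_Bhat L H r)"

definition B_ideal :: "'a gorder \<Rightarrow> 'a set \<Rightarrow> ('a \<times> 'a) set \<Rightarrow> ('a set \<Rightarrow> 'a qpoly) set set" where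
  "B_ideal L H r = Idl\<^bsub>Bhat L H r\<^esub>
     {Bhat_ideal L H r +>\<^bsub>free_gc H r\<^esub> ext_single {\<top>\<^bsub>L\<^esub>} 1}"

definition B_alg :: "'a gorder \<Rightarrow> 'a set \<Rightarrow> ('a \<times> 'a) set \<Rightarrow> ('a set \<Rightarrow> 'a qpoly) set set ring" where
  "B_alg L H r = Bhat L H r Quot B_ideal L H r"

definition B_part ::
  "'a gorder \<Rightarrow> 'a set \<Rightarrow> ('a \<times> 'a) set \<Rightarrow> nat \<Rightarrow> nat \<Rightarrow> ('a set \<Rightarrow> 'a qpoly) set set set" where
  "B_part L H r i j = (\<lambda>b. B_ideal L H r +>\<^bsub>Bhat L H r\<^esub> b) ` Bhat_part L H r i j"

definition B_col ::
  "'a gorder \<Rightarrow> 'a set \<Rightarrow> ('a \<times> 'a) set \<Rightarrow> nat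
     \<Rightarrow> ('a qpoly set, ('a set \<Rightarrow> 'a qpoly) set set) module" where
  "B_col L H r j = alg_module (B_alg L H r)
     ((\<lambda>b. B_ideal L H r +>\<^bsub>Bhat L H r\<^esub> b) ` carrier (Bhat_col L H r j))
     (\<lambda>F. B_ideal L H r +>\<^bsub>Bhat L H r\<^esub> DP_to_Bhat L H r F)"

end

theory Submission
  imports Defs
begin

text \<open>The iterated blowup embeds, as a down-set with the product order, into the product of the
  power set of \<open>H\<^sup>\<circ>\<close> and \<open>L\<close>: the pair \<open>(T, x)\<close> occurs iff \<open>T\<close> together with all atoms below \<open>x\<close>
  is nested. Hence every lower interval is a Boolean lattice times an interval of \<open>L\<close>, so that
  the exchange property of \<open>L\<close> makes it a matroid, and nested sets are exactly the bounded sets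
  of atoms.

  Removing one element of a circuit does not change its join. Therefore all relations of the
  algebra respect the decomposition of the monomials \<open>e\<^sub>S\<close> by the join \<open>y\<close> of \<open>S\<close>: those of the
  form \<open>\<partial>e\<^sub>C\<close> give the relations of \<open>OS\<close> below \<open>y\<close>, and those involving the \<open>x\<^sub>g\<close> give the relations
  of \<open>DP\<^sub>y\<close>. A monomial \<open>e\<^sub>S\<close> with \<open>|S| = j\<close> either vanishes, since \<open>S\<close> is dependent, or has a join of
  rank \<open>j\<close>; so mapping \<open>e\<^sub>S p\<close> to the class of \<open>e\<^sub>S \<otimes> p\<close> in every summand whose \<open>y\<close> lies above \<open>S\<close>
  is the required isomorphism. For \<open>B\<close>, the relation \<open>e\<^sub>g = 0\<close> for \<open>g = \<top>\<close> kills exactly the summands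
  with \<open>y\<close> above \<open>g\<close>, because the boundary of a circuit through \<open>g\<close> then kills the monomial
  without \<open>g\<close>.\<close>

section \<open>Geometric lattices\<close>

text \<open>This is Brieskorn's decomposition of an Orlik-Solomon algebra by flats, with
  coefficients that depend on the flat. No basis of \<open>OS\<close> or \<open>DP\<close> is
  chosen: a map to the summand of y and a map back are given on generators, and each is checked
  against the relations. The map back is computed from representatives of cosets, so it is
  compatible with the tensor relations only modulo the relations of the algebra; hence most
  identities are congruences. The combinatorial obstacle is that the blowup is recursive, while
  nested sets are described by joins in L. Coordinates remove the recursion, and the product
  isomorphism in the definition of a building set serves only to show that an element of
  \<open>H - atoms L\<close> below the join of a nested set is below one of its members.
  Coefficients of e_S may be reduced modulo the ideal of DP_y because an independent S below y with
  as many elements as the rank of y has join exactly y. Both statements are instances of one: the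
  relations are enlarged by e_z for all z in a set Z, which is empty for the hat version and
  {\<top>} for B.\<close>

lemma sup_eqI:
  assumes "s \<in> carrier P" "A \<subseteq> carrier P"
    and "\<And>z. z \<in> carrier P \<Longrightarrow> s \<sqsubseteq>\<^bsub>P\<^esub> z \<longleftrightarrow> (\<forall>a\<in>A. a \<sqsubseteq>\<^bsub>P\<^esub> z)"
    and "s \<sqsubseteq>\<^bsub>P\<^esub> s"
    and "\<And>u w. u \<in> carrier P \<Longrightarrow> w \<in> carrier P \<Longrightarrow> u \<sqsubseteq>\<^bsub>P\<^esub> w \<Longrightarrow> w \<sqsubseteq>\<^bsub>P\<^esub> u \<Longrightarrow> u = w"
  shows "\<Squnion>\<^bsub>P\<^esub> A = s"
proof -
  have l: "least P s (Upper P A)"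
    using assms(1-4) unfolding least_def Upper_def by auto
  have "x = s" if "least P x (Upper P A)" for x
    using l that assms(1,5) unfolding least_def Upper_def by blast
  then show ?thesis
    unfolding sup_def using l by blast
qed

locale geom =
  fixes L :: "'a gorder" (structure)
  assumes geom: "geometric_lattice L"

sublocale geom \<subseteq> lattice L
  using geom unfolding geometric_lattice_def by blast

context geom
begin

text \<open>As introduction rules these diverge on goals \<open>x \<sqsubseteq> y\<close>: they invent an intermediate element.\<close>

declare le_cong_l [rule del] le_cong_r [rule del] weak_le_antisym [rule del] weak_refl [rule del]
  le_antisym [rule del]

lemma finite_carrier: "finite (carrier L)" and carrier_nonempty: "carrier L \<noteq> {}"
  using geom unfolding geometric_lattice_def by auto

lemma lless_iff: "x \<sqsubset> y \<longleftrightarrow> x \<sqsubseteq> y \<and> x \<noteq> y"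
  unfolding lless_def eq_is_equal by simp

lemma bottom_least: "least L \<bottom> (carrier L)"
proof -
  have "greatest L (\<Sqinter>(carrier L)) (Lower L (carrier L))"
    using finite_inf_greatest finite_carrier carrier_nonempty by blast
  then have "least L (\<Sqinter>(carrier L)) (carrier L)"
    unfolding greatest_def least_def Lower_def by auto
  then show ?thesis
    unfolding bottom_def by (rule someI)
qed

lemma bottom_in [simp]: "\<bottom> \<in> carrier L" and bottom_le [simp]: "x \<in> carrier L \<Longrightarrow> \<bottom> \<sqsubseteq> x"
  using bottom_least unfolding least_def by auto

lemma le_bottom_iff: "x \<in> carrier L \<Longrightarrow> x \<sqsubseteq> \<bottom> \<longleftrightarrow> x = \<bottom>"
  using le_antisym by auto

text \<open>A finite lattice is complete; only the empty join, which is the bottom element, needs a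
  separate argument.\<close>

lemma Sup_least: "A \<subseteq> carrier L \<Longrightarrow> least L (\<Squnion>A) (Upper L A)"
proof (cases "A = {}")
  case True
  then show ?thesis
    unfolding sup_def using bottom_least by (auto intro: someI)
next
  case False
  then show "A \<subseteq> carrier L \<Longrightarrow> ?thesis"
    using finite_sup_least finite_carrier finite_subset by blast
qed

lemma Sup_in [simp]: "A \<subseteq> carrier L \<Longrightarrow> \<Squnion>A \<in> carrier L"
  using Sup_least by blast

lemma Sup_le_iff: "A \<subseteq> carrier L \<Longrightarrow> z \<in> carrier L \<Longrightarrow> \<Squnion>A \<sqsubseteq> z \<longleftrightarrow> (\<forall>a\<in>A. a \<sqsubseteq> z)"
proof -
  assume A: "A \<subseteq> carrier L" and z: "z \<in> carrier L"
  have "least L (\<Squnion>A) (Upper L A)"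
    using A by (rule Sup_least)
  then show ?thesis
    using A z unfolding least_def Upper_def
    by (smt (verit, best) Int_iff le_trans mem_Collect_eq subsetD)
qed

lemma le_Sup: "A \<subseteq> carrier L \<Longrightarrow> a \<in> A \<Longrightarrow> a \<sqsubseteq> \<Squnion>A"
  using Sup_le_iff[of A "\<Squnion>A"] by auto

lemma Sup_eqI:
  assumes "A \<subseteq> carrier L" "s \<in> carrier L"
    and "\<And>z. z \<in> carrier L \<Longrightarrow> s \<sqsubseteq> z \<longleftrightarrow> (\<forall>a\<in>A. a \<sqsubseteq> z)"
  shows "\<Squnion>A = s"
  using sup_eqI[of s L A] assms le_antisym by auto

lemma Sup_mono:
  assumes "A \<subseteq> carrier L" "B \<subseteq> carrier L" "\<And>a. a \<in> A \<Longrightarrow> \<exists>b\<in>B. a \<sqsubseteq> b"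
  shows "\<Squnion>A \<sqsubseteq> \<Squnion>B"
  using assms Sup_le_iff[of A "\<Squnion>B"] le_Sup[of B] le_trans
  by (meson Sup_in subsetD)

lemma atom_in: "a \<in> atoms L \<Longrightarrow> a \<in> carrier L"
  and atom_not_bottom: "a \<in> atoms L \<Longrightarrow> a \<noteq> \<bottom>"
  and below_atom: "a \<in> atoms L \<Longrightarrow> z \<in> carrier L \<Longrightarrow> z \<sqsubseteq> a \<Longrightarrow> z = \<bottom> \<or> z = a"
  unfolding atoms_def covered_by_def lless_iff by auto

definition ats :: "'a \<Rightarrow> 'a set" where
  "ats x = {a \<in> atoms L. a \<sqsubseteq> x}"

lemma ats_sub: "ats x \<subseteq> carrier L"
  unfolding ats_def using atom_in by auto

lemma Sup_ats: "x \<in> carrier L \<Longrightarrow> \<Squnion>(ats x) = x"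
  using geom unfolding geometric_lattice_def ats_def by auto

text \<open>Since every element is the join of the atoms below it, \<open>ats\<close> embeds L into
  a power set. The cardinality of \<open>ats\<close> thereby becomes a strictly increasing height
  function.\<close>

lemma le_iff_ats: "x \<in> carrier L \<Longrightarrow> y \<in> carrier L \<Longrightarrow> x \<sqsubseteq> y \<longleftrightarrow> ats x \<subseteq> ats y"
proof
  assume xy: "x \<in> carrier L" "y \<in> carrier L"
  show "ats x \<subseteq> ats y" if "x \<sqsubseteq> y"
    unfolding ats_def using that xy atom_in le_trans[of _ x y] by auto
  show "x \<sqsubseteq> y" if "ats x \<subseteq> ats y"
  proof -
    have "\<Squnion>(ats x) \<sqsubseteq> y"
      using that xy Sup_le_iff[OF ats_sub xy(2), of x] unfolding ats_def by auto
    then show ?thesis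
      using Sup_ats[OF xy(1)] by simp
  qed
qed

lemma ats_atom: "a \<in> atoms L \<Longrightarrow> ats a = {a}"
  unfolding ats_def using below_atom[of a] atom_in[of a] atom_in atom_not_bottom by blast

lemma building_sub: "building_set L G \<Longrightarrow> G \<subseteq> carrier L - {\<bottom>}"
  unfolding building_set_def by (rule conjunct1)

text \<open>Semimodularity makes \<open>\<Squnion>{d, t}\<close> a cover of d. As
  \<open>\<Squnion>{d, s}\<close> lies strictly above d and below this cover, the two joins
  coincide.\<close>

lemma exchange_atoms:
  assumes d: "d \<in> carrier L" and s: "s \<in> atoms L" and t: "t \<in> atoms L"
    and le: "s \<sqsubseteq> \<Squnion>{d, t}" and nle: "\<not> s \<sqsubseteq> d"
  shows "t \<sqsubseteq> \<Squnion>{d, s}"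
proof -
  note [simp] = atom_in[OF s] atom_in[OF t] d
  have ntd: "\<not> t \<sqsubseteq> d"
    using le nle Sup_le_iff[of "{d, t}" d] le_trans[of s "\<Squnion>{d, t}" d] by auto
  have "t \<sqinter> d \<sqsubseteq> t" "t \<sqinter> d \<sqsubseteq> d" "t \<sqinter> d \<in> carrier L"
    by (auto intro: meet_left meet_right)
  then have "t \<sqinter> d = \<bottom>"
    using below_atom[OF t] ntd by metis
  then have "covered_by L (t \<sqinter> d) t"
    using t unfolding atoms_def by auto
  then have "covered_by L d (t \<squnion> d)"
    using geom d atom_in[OF t] unfolding geometric_lattice_def by blast
  then have cov: "covered_by L d (\<Squnion>{d, t})"
    unfolding join_def by (simp add: insert_commute)
  have "d \<sqsubset> \<Squnion>{d, s}"
    using nle le_Sup[of "{d, s}"] unfolding lless_iff by auto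
  moreover have "\<Squnion>{d, s} \<sqsubseteq> \<Squnion>{d, t}"
    using le le_Sup[of "{d, t}" d] Sup_le_iff[of "{d, s}" "\<Squnion>{d, t}"] by auto
  ultimately have "\<Squnion>{d, s} = \<Squnion>{d, t}"
    using cov unfolding covered_by_def lless_iff by auto
  then show ?thesis
    using le_Sup[of "{d, t}" t] by simp
qed

end

section \<open>The iterated blowup\<close>

locale nested_blowup = geom L for L :: "'a gorder" (structure) +
  fixes H :: "'a set" and r :: "('a \<times> 'a) set"
  assumes pbs: "partial_building_set L H"
    and lin: "strict_linear_order_on H r"
    and anti: "\<forall>p\<in>H. \<forall>q\<in>H. q \<sqsubset> p \<longrightarrow> (p, q) \<in> r"
begin

abbreviation "N \<equiv> H - atoms L"

lemma H_sub: "H \<subseteq> carrier L" and bottom_notin_H: "\<bottom> \<notin> H" and atoms_H: "atoms L \<subseteq> H"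
proof -
  obtain G where G: "building_set L G" "H \<subseteq> G" "atoms L \<subseteq> H"
    using pbs unfolding partial_building_set_def by blast
  then show "H \<subseteq> carrier L" "\<bottom> \<notin> H" "atoms L \<subseteq> H"
    using building_sub[OF G(1)] G by auto
qed

lemma finite_H: "finite H"
  using H_sub finite_carrier finite_subset by blast

section \<open>The linear order and the list of centres\<close>

lemma r_trans: "(a, b) \<in> r \<Longrightarrow> (b, c) \<in> r \<Longrightarrow> (a, c) \<in> r"
  and r_irrefl: "(a, a) \<notin> r"
  and r_total: "a \<in> H \<Longrightarrow> b \<in> H \<Longrightarrow> a \<noteq> b \<Longrightarrow> (a, b) \<in> r \<or> (b, a) \<in> r"
proof -
  have t: "trans r" "irrefl r" "total_on H r"
    using lin unfolding strict_linear_order_on_def by auto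
  show "(a, b) \<in> r \<Longrightarrow> (b, c) \<in> r \<Longrightarrow> (a, c) \<in> r"
    using t(1) by (rule transD)
  show "(a, a) \<notin> r"
    using t(2) unfolding irrefl_def by simp
  show "a \<in> H \<Longrightarrow> b \<in> H \<Longrightarrow> a \<noteq> b \<Longrightarrow> (a, b) \<in> r \<or> (b, a) \<in> r"
    using t(3) unfolding total_on_def by simp
qed

lemma r_asym: "(a, b) \<in> r \<Longrightarrow> (b, a) \<notin> r"
  using r_trans r_irrefl by blast

lemma less_imp_r: "p \<in> H \<Longrightarrow> q \<in> H \<Longrightarrow> q \<sqsubseteq> p \<Longrightarrow> q \<noteq> p \<Longrightarrow> (p, q) \<in> r"
  using anti unfolding lless_iff by blast

lemma r_minimum:
  assumes "A \<subseteq> H" "A \<noteq> {}"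
  shows "\<exists>m\<in>A. \<forall>a\<in>A - {m}. (m, a) \<in> r"
proof -
  have "finite A"
    using assms finite_H finite_subset by blast
  from this assms(2,1) show ?thesis
  proof (induction rule: finite_ne_induct)
    case (insert x F)
    then obtain m where m: "m \<in> F" "\<forall>a\<in>F - {m}. (m, a) \<in> r"
      by auto
    then have "(m, x) \<in> r \<or> (x, m) \<in> r"
      using insert r_total[of m x] by auto
    then show ?case
    proof
      assume "(m, x) \<in> r"
      then show ?thesis
        using m by (intro bexI[of _ m]) auto
    next
      assume "(x, m) \<in> r"
      then show ?thesis
        using m r_trans[of x m] by (intro bexI[of _ x]) auto
    qed
  qed auto
qed

lemma sorted_enum_exists: "A \<subseteq> H \<Longrightarrow> \<exists>ps. set ps = A \<and> sorted_wrt (\<lambda>p q. (p, q) \<in> r) ps"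
proof (induction "card A" arbitrary: A)
  case 0
  then show ?case
    using finite_H finite_subset by (intro exI[of _ "[]"]) fastforce
next
  case (Suc n)
  then have fin: "finite A" "A \<noteq> {}"
    by (auto intro: card_ge_0_finite)
  then obtain m where m: "m \<in> A" "\<forall>a\<in>A - {m}. (m, a) \<in> r"
    using r_minimum Suc by blast
  have "n = card (A - {m})" "A - {m} \<subseteq> H"
    using Suc m fin by auto
  then obtain ps where "set ps = A - {m}" "sorted_wrt (\<lambda>p q. (p, q) \<in> r) ps"
    using Suc(1)[of "A - {m}"] by blast
  then show ?case
    using m by (intro exI[of _ "m # ps"]) auto
qed

lemma sorted_enum_unique:
  "sorted_wrt (\<lambda>p q. (p, q) \<in> r) ps \<Longrightarrow> sorted_wrt (\<lambda>p q. (p, q) \<in> r) qs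
    \<Longrightarrow> set ps = set qs \<Longrightarrow> ps = qs"
proof (induction ps arbitrary: qs)
  case (Cons p ps)
  then obtain q qs' where q: "qs = q # qs'"
    by (cases qs) auto
  have "p = q"
    using Cons.prems q r_asym by auto (metis insertE insertI1)
  moreover have "p \<notin> set ps" "q \<notin> set qs'"
    using Cons.prems q r_irrefl by auto
  ultimately have "set ps = set qs'"
    using Cons.prems q by auto
  then show ?case
    using Cons q \<open>p = q\<close> by auto
qed auto

definition ps :: "'a list" where "ps = blowup_centres L H r"

text \<open>\<open>blowup_centres\<close> is a definite description, so nothing is known of it
  before existence and uniqueness of the sorted enumeration are established.\<close>

lemma ps: "set ps = N" "sorted_wrt (\<lambda>p q. (p, q) \<in> r) ps"
proof -
  have "\<exists>!ps. set ps = N \<and> sorted_wrt (\<lambda>p q. (p, q) \<in> r) ps"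
    using sorted_enum_exists[of N] sorted_enum_unique by (metis Diff_subset)
  then have "set ps = N \<and> sorted_wrt (\<lambda>p q. (p, q) \<in> r) ps"
    unfolding ps_def blowup_centres_def by (rule theI')
  then show "set ps = N" "sorted_wrt (\<lambda>p q. (p, q) \<in> r) ps" by auto
qed

text \<open>The pair \<open>(T, x)\<close> stands for the element obtained from \<open>x\<close> by attaching the centres in \<open>T\<close>;
  \<open>adm qs T x\<close> says that it exists after blowing up \<open>qs\<close>. The condition for \<open>t \<in> T\<close> unwinds the
  existence of the joins required when \<open>t\<close> was attached.\<close>

definition later :: "'a set \<Rightarrow> 'a \<Rightarrow> 'a set" where
  "later T t = {t' \<in> T. t' = t \<or> (t, t') \<in> r}"

definition adm :: "'a list \<Rightarrow> 'a set \<Rightarrow> 'a \<Rightarrow> bool" where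
  "adm qs T x \<longleftrightarrow> x \<in> carrier L \<and> T \<subseteq> set qs \<and> (\<forall>h\<in>set qs. \<not> h \<sqsubseteq> x)
     \<and> (\<forall>t\<in>T. \<forall>h\<in>set qs. (h, t) \<in> r \<longrightarrow> \<not> h \<sqsubseteq> \<Squnion>(insert x (later T t)))"

primrec base :: "'a blow \<Rightarrow> 'a" where
  "base (Old x) = x"
| "base (Exc p z) = base z"

text \<open>Every centre that occurs has the form \<open>Old p\<close>, so its base p loses no
  information.\<close>

primrec exc :: "'a blow \<Rightarrow> 'a set" where
  "exc (Old x) = {}"
| "exc (Exc p z) = insert (base p) (exc z)"

text \<open>The wrapper of the last centre is outermost, in accordance with
  \<open>iter_blowup\<close>, where the head of the list is blown up first.\<close>

definition enc :: "'a list \<Rightarrow> 'a set \<Rightarrow> 'a \<Rightarrow> 'a blow" where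
  "enc qs T x = fold (\<lambda>p z. if p \<in> T then Exc (Old p) z else z) qs (Old x)"

lemma base_enc [simp]: "base (enc qs T x) = x"
  by (induction qs rule: rev_induct) (auto simp: enc_def)

lemma exc_enc: "exc (enc qs T x) = T \<inter> set qs"
  by (induction qs rule: rev_induct) (auto simp: enc_def)

text \<open>Every clause of \<open>adm\<close> says that some h is not below a certain join, and
  these joins only shrink when T and x do. So the admissible pairs form a down-set.\<close>

lemma adm_mono:
  assumes "adm qs T x" "T' \<subseteq> T" "x' \<in> carrier L" "x' \<sqsubseteq> x" "set qs \<subseteq> carrier L"
  shows "adm qs T' x'"
proof -
  have x: "x \<in> carrier L" "T \<subseteq> carrier L"
    using assms unfolding adm_def by auto
  have "\<not> h \<sqsubseteq> x'" if "h \<in> set qs" for h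
    using assms that x le_trans[of h x' x] unfolding adm_def by blast
  moreover have "\<not> h \<sqsubseteq> \<Squnion>(insert x' (later T' t))" if "h \<in> set qs" "t \<in> T'" "(h, t) \<in> r" for h t
  proof
    assume h: "h \<sqsubseteq> \<Squnion>(insert x' (later T' t))"
    have sub: "insert x' (later T' t) \<subseteq> carrier L" "insert x (later T t) \<subseteq> carrier L"
      using x assms unfolding later_def by auto
    have "\<Squnion>(insert x' (later T' t)) \<sqsubseteq> \<Squnion>(insert x (later T t))"
    proof (rule Sup_mono[OF sub])
      fix a assume a: "a \<in> insert x' (later T' t)"
      then have "a \<sqsubseteq> a"
        using sub by auto
      then show "\<exists>b\<in>insert x (later T t). a \<sqsubseteq> b"
        using a assms(2,4) unfolding later_def by blast
    qed
    then have "h \<sqsubseteq> \<Squnion>(insert x (later T t))"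
      using h sub that assms le_trans by (meson Sup_in subsetD)
    then show False
      using assms(1,2) that unfolding adm_def by blast
  qed
  ultimately show ?thesis
    using assms unfolding adm_def by blast
qed

lemma Sup_insert_Sup:
  assumes "A \<subseteq> carrier L" "B \<subseteq> carrier L"
  shows "\<Squnion>(insert (\<Squnion>A) B) = \<Squnion>(A \<union> B)"
  using assms by (intro Sup_eqI) (auto simp: Sup_le_iff)

text \<open>The new centre p comes after every t in T, so it never occurs as the h of the second
  clause of \<open>adm\<close>; only the clause about x changes.\<close>

lemma adm_snoc_old:
  assumes "p \<notin> T" "\<forall>q\<in>set qs. (q, p) \<in> r"
  shows "adm (qs @ [p]) T x \<longleftrightarrow> adm qs T x \<and> \<not> p \<sqsubseteq> x"
  using assms r_asym unfolding adm_def by auto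

text \<open>To attach p, the join of p with the element \<open>(T - {p}, x)\<close> must exist one
  stage earlier, and this join is \<open>(T - {p}, \<Squnion>{x, p})\<close>. The conditions agree
  because p is last and hence belongs to \<open>later T t\<close> for every t in T, while
  \<open>later T p\<close> is just {p}.\<close>

lemma adm_snoc_exc:
  assumes p: "p \<in> T" "\<forall>q\<in>set qs. (q, p) \<in> r" "p \<in> carrier L" "set qs \<subseteq> carrier L"
    and x: "x \<in> carrier L"
  shows "adm (qs @ [p]) T x \<longleftrightarrow> adm qs (T - {p}) (\<Squnion>{x, p}) \<and> \<not> p \<sqsubseteq> x" (is "?l \<longleftrightarrow> ?r")
proof (cases "T \<subseteq> insert p (set qs)")
  case True
  have pn: "p \<notin> set qs"
    using p(2) r_irrefl by auto
  have T: "T \<subseteq> carrier L"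
    using True p by auto
  have lp: "later T p = {p}"
    using True p r_asym unfolding later_def by auto
  have j: "\<Squnion>(insert (\<Squnion>{x, p}) (later (T - {p}) t)) = \<Squnion>(insert x (later T t))"
    if "t \<in> T - {p}" for t
  proof -
    have "\<Squnion>(insert (\<Squnion>{x, p}) (later (T - {p}) t)) = \<Squnion>({x, p} \<union> later (T - {p}) t)"
      using x p T by (intro Sup_insert_Sup) (auto simp: later_def)
    also have "{x, p} \<union> later (T - {p}) t = insert x (later T t)"
      using that True p unfolding later_def by auto
    finally show ?thesis .
  qed
  have xp: "\<Squnion>{x, p} \<in> carrier L" "x \<sqsubseteq> \<Squnion>{x, p}"
    using x p by (auto intro: le_Sup)
  then have hx: "\<not> h \<sqsubseteq> x" if "\<not> h \<sqsubseteq> \<Squnion>{x, p}" "h \<in> set qs" for h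
    using that le_trans[of h x "\<Squnion>{x, p}"] x p by auto
  have "?l \<longleftrightarrow> (\<forall>h\<in>set qs. \<not> h \<sqsubseteq> x) \<and> \<not> p \<sqsubseteq> x
     \<and> (\<forall>h\<in>set qs. \<not> h \<sqsubseteq> \<Squnion>{x, p})
     \<and> (\<forall>t\<in>T - {p}. \<forall>h\<in>set qs. (h, t) \<in> r \<longrightarrow> \<not> h \<sqsubseteq> \<Squnion>(insert x (later T t)))"
    using True x p lp r_asym r_irrefl unfolding adm_def by (auto simp: insert_commute)
  also have "\<dots> \<longleftrightarrow> ?r"
    unfolding adm_def using True j xp hx by auto
  finally show ?thesis .
next
  case False
  then have "\<not> T - {p} \<subseteq> set qs" "\<not> T \<subseteq> set (qs @ [p])"
    by auto
  then show ?thesis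
    unfolding adm_def by blast
qed

text \<open>The invariant carried through the blowups. The order is described on the carrier only,
  where terms are determined by their two coordinates.\<close>

definition chart :: "'a blow gorder \<Rightarrow> 'a list \<Rightarrow> bool" where
  "chart P qs \<longleftrightarrow> eq P = (=) \<and> carrier P = {enc qs T x | T x. adm qs T x}
     \<and> (\<forall>u\<in>carrier P. \<forall>w\<in>carrier P. u \<sqsubseteq>\<^bsub>P\<^esub> w \<longleftrightarrow> exc u \<subseteq> exc w \<and> base u \<sqsubseteq> base w)"

lemma chart_embed: "chart (embed_order L) []"
  unfolding chart_def embed_order_def adm_def enc_def by auto

lemma exc_enc_adm: "adm qs T x \<Longrightarrow> exc (enc qs T x) = T"
  unfolding adm_def exc_enc by auto

lemma enc_snoc: "enc (qs @ [p]) T x = (if p \<in> T then Exc (Old p) (enc qs T x) else enc qs T x)"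
  unfolding enc_def by simp

lemma enc_cong: "T \<inter> set qs = T' \<inter> set qs \<Longrightarrow> enc qs T x = enc qs T' x"
  unfolding enc_def by (intro fold_cong) (auto simp: fun_eq_iff)

text \<open>The surviving elements become the pairs whose first component omits p; a new element (p,
  u) becomes the pair that adds p to the centres of u and keeps its base. The three clauses of the
  order of a blowup then amount to the product order, since a new element is never below an old
  one.\<close>

lemma chart_blowup:
  assumes ch: "chart P qs" and p: "p \<in> N" "\<forall>q\<in>set qs. (q, p) \<in> r" and qs: "set qs \<subseteq> N"
  shows "chart (blowup (Old p) P) (qs @ [p])"
proof -
  have qsL: "set qs \<subseteq> carrier L" and pL: "p \<in> carrier L"
    using qs p H_sub by auto
  have pn: "p \<notin> set qs"
    using p r_irrefl by auto
  have car: "carrier P = {enc qs T x | T x. adm qs T x}"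
    and le: "\<And>u w. u \<in> carrier P \<Longrightarrow> w \<in> carrier P \<Longrightarrow>
        u \<sqsubseteq>\<^bsub>P\<^esub> w \<longleftrightarrow> exc u \<subseteq> exc w \<and> base u \<sqsubseteq> base w"
    using ch unfolding chart_def by auto
  have enc_in: "enc qs T x \<in> carrier P \<longleftrightarrow> adm qs T x" if "T \<subseteq> set qs" for T x
  proof
    assume "enc qs T x \<in> carrier P"
    then obtain T' x' where T': "enc qs T x = enc qs T' x'" "adm qs T' x'"
      using car by auto
    then have "x = x'" "exc (enc qs T x) = T'"
      using exc_enc_adm by (metis base_enc, simp)
    then show "adm qs T x"
      using T'(2) that unfolding exc_enc by (metis inf.absorb1)
  qed (use car in auto)
  have p_old: "Old p = enc qs {} p"
    unfolding enc_def by (induction qs) auto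
  have p_in: "Old p \<in> carrier P"
    unfolding p_old using enc_in[of "{}" p]
  proof -
    \<comment> \<open>Larger elements are blown up first, so no earlier centre lies below p, and
      \<open>Old p\<close> has survived until now.\<close>
    have "\<not> h \<sqsubseteq> p" if "h \<in> set qs" for h
    proof
      assume "h \<sqsubseteq> p"
      moreover have "(h, p) \<in> r" "h \<noteq> p"
        using p that pn by auto
      ultimately have "(p, h) \<in> r"
        using that qs p less_imp_r by auto
      then show False
        using \<open>(h, p) \<in> r\<close> r_asym by auto
    qed
    then show "enc qs {} p \<in> carrier P"
      using enc_in[of "{}" p] pL unfolding adm_def by auto
  qed
  have carL: "base u \<in> carrier L" "exc u \<subseteq> set qs" "adm qs (exc u) (base u)"
      "u = enc qs (exc u) (base u)" if "u \<in> carrier P" for u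
    using that car by (auto simp: exc_enc_adm) (auto simp: adm_def)
  have old: "old_part (Old p) P = {u \<in> carrier P. \<not> p \<sqsubseteq> base u}"
    unfolding old_part_def using le[OF p_in] by auto
  have link: "link_part (Old p) P
      = {u \<in> carrier P. \<not> p \<sqsubseteq> base u \<and> adm qs (exc u) (\<Squnion>{base u, p})}"
  proof -
    \<comment> \<open>In the product order, z is a common upper bound of \<open>Old p\<close> and u
      iff it is above the pair \<open>(exc u, \<Squnion>{base u, p})\<close>. If any upper bound
      exists, this pair is itself admissible by \<open>adm_mono\<close>, and is then the least
      one.\<close>
    have "(\<exists>s. least P s (Upper P {Old p, u})) \<longleftrightarrow> adm qs (exc u) (\<Squnion>{base u, p})"
      if u: "u \<in> carrier P" for u
    proof
      have up: "z \<in> Upper P {Old p, u} \<longleftrightarrow> z \<in> carrier P \<and> exc u \<subseteq> exc z \<and> \<Squnion>{base u, p} \<sqsubseteq> base z" for z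
        using u p_in le carL(1)[OF u] carL(1)[of z] pL
        by (auto simp: Upper_def Sup_le_iff)
      show "adm qs (exc u) (\<Squnion>{base u, p})" if ex: "\<exists>s. least P s (Upper P {Old p, u})"
      proof -
        obtain s where "s \<in> Upper P {Old p, u}"
          using ex by (auto simp: least_def)
        then show ?thesis
          using up carL(3) adm_mono qsL carL(1)[OF u] pL
          by (meson Sup_in empty_subsetI insert_subset)
      qed
      assume a: "adm qs (exc u) (\<Squnion>{base u, p})"
      let ?s = "enc qs (exc u) (\<Squnion>{base u, p})"
      have s: "?s \<in> carrier P" "exc ?s = exc u"
        using a car by (auto simp: exc_enc_adm)
      have "\<Squnion>{base u, p} \<in> carrier L"
        using carL(1)[OF u] pL by auto
      then have "least P ?s (Upper P {Old p, u})"
        unfolding least_def using s le up by auto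
      then show "\<exists>s. least P s (Upper P {Old p, u})"
        by blast
    qed
    then show ?thesis
      unfolding link_part_def old by auto
  qed
  have old': "old_part (Old p) P = {enc (qs @ [p]) T x | T x. adm (qs @ [p]) T x \<and> p \<notin> T}" (is "_ = ?B")
  proof -
    have "u \<in> old_part (Old p) P \<longleftrightarrow> u \<in> ?B" for u
    proof
      assume u: "u \<in> old_part (Old p) P"
      then have "adm (qs @ [p]) (exc u) (base u)" "p \<notin> exc u"
        using carL[of u] pn adm_snoc_old[OF _ p(2)] unfolding old by auto
      moreover have "u = enc (qs @ [p]) (exc u) (base u)"
        using u carL(4)[of u] \<open>p \<notin> exc u\<close> unfolding enc_snoc old by auto
      ultimately show "u \<in> ?B" by auto
    next
      assume "u \<in> ?B"
      then obtain T x where T: "u = enc (qs @ [p]) T x" "adm (qs @ [p]) T x" "p \<notin> T"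
        by auto
      then show "u \<in> old_part (Old p) P"
        using adm_snoc_old[OF _ p(2), of T x] car unfolding old enc_snoc by auto
    qed
    then show ?thesis by blast
  qed
  have link': "Exc (Old p) ` link_part (Old p) P
      = {enc (qs @ [p]) T x | T x. adm (qs @ [p]) T x \<and> p \<in> T}" (is "_ = ?B")
  proof -
    have "u \<in> Exc (Old p) ` link_part (Old p) P \<longleftrightarrow> u \<in> ?B" for u
    proof
      assume "u \<in> Exc (Old p) ` link_part (Old p) P"
      then obtain w where w: "u = Exc (Old p) w" "w \<in> link_part (Old p) P"
        by auto
      then have wc: "w \<in> carrier P" "\<not> p \<sqsubseteq> base w" "adm qs (exc w) (\<Squnion>{base w, p})"
        unfolding link by auto
      have "insert p (exc w) - {p} = exc w"
        using carL(2)[OF wc(1)] pn by auto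
      then have "adm (qs @ [p]) (insert p (exc w)) (base w)"
        using adm_snoc_exc[of p "insert p (exc w)" qs "base w"] p pL qsL carL(1)[OF wc(1)] wc by auto
      moreover have "u = enc (qs @ [p]) (insert p (exc w)) (base w)"
        unfolding enc_snoc w(1) using carL(4)[OF wc(1)] enc_cong[of "insert p (exc w)" qs "exc w"] pn
        by auto
      ultimately show "u \<in> ?B" by auto
    next
      assume "u \<in> ?B"
      then obtain T x where T: "u = enc (qs @ [p]) T x" "adm (qs @ [p]) T x" "p \<in> T"
        by auto
      then have x: "x \<in> carrier L"
        unfolding adm_def by auto
      then have a: "adm qs (T - {p}) (\<Squnion>{x, p})" "\<not> p \<sqsubseteq> x"
        using adm_snoc_exc[of p T qs x] p pL qsL T by auto
      then have "adm qs (T - {p}) x"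
        using adm_mono[OF a(1), of "T - {p}" x] x pL qsL le_Sup[of "{x, p}" x] by auto
      moreover have "enc qs T x = enc qs (T - {p}) x"
        using pn by (intro enc_cong) auto
      ultimately have "enc qs T x \<in> link_part (Old p) P"
        unfolding link using a car by (auto simp: exc_enc_adm)
      then show "u \<in> Exc (Old p) ` link_part (Old p) P"
        using T unfolding enc_snoc by auto
    qed
    then show ?thesis by blast
  qed
  let ?B = "blowup (Old p) P"
  have cB: "carrier ?B = {enc (qs @ [p]) T x | T x. adm (qs @ [p]) T x}"
  proof -
    have "carrier ?B = old_part (Old p) P \<union> Exc (Old p) ` link_part (Old p) P"
      unfolding blowup_def by simp
    then show ?thesis
      unfolding old' link' by blast
  qed
  have leB: "u \<sqsubseteq>\<^bsub>?B\<^esub> w \<longleftrightarrow> exc u \<subseteq> exc w \<and> base u \<sqsubseteq> base w"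
    if u: "u \<in> carrier ?B" and w: "w \<in> carrier ?B" for u w
  proof -
    let ?O = "old_part (Old p) P" and ?K = "link_part (Old p) P"
    have OP: "?O \<subseteq> carrier P" "?K \<subseteq> carrier P"
      unfolding old link by auto
    have noexc: "Exc (Old p) z \<notin> ?O" for z
    proof
      assume "Exc (Old p) z \<in> ?O"
      then have "exc (Exc (Old p) z) \<subseteq> set qs"
        using OP carL(2) by blast
      then show False using pn by simp
    qed
    have pe: "p \<notin> exc z" if "z \<in> carrier P" for z
      using carL(2)[OF that] pn by auto
    have cases: "z \<in> ?O \<or> (\<exists>y\<in>?K. z = Exc (Old p) y)" if "z \<in> carrier ?B" for z
      using that unfolding blowup_def by auto
    have l: "u \<sqsubseteq>\<^bsub>?B\<^esub> w \<longleftrightarrow> (u \<in> ?O \<and> w \<in> ?O \<and> u \<sqsubseteq>\<^bsub>P\<^esub> w)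
        \<or> (\<exists>x\<in>?K. \<exists>y\<in>?K. u = Exc (Old p) x \<and> w = Exc (Old p) y \<and> x \<sqsubseteq>\<^bsub>P\<^esub> y)
        \<or> (u \<in> ?O \<and> (\<exists>y\<in>?K. w = Exc (Old p) y \<and> u \<sqsubseteq>\<^bsub>P\<^esub> y))"
      unfolding blowup_def by simp
    show ?thesis
    proof (cases "u \<in> ?O")
      case uO: True
      show ?thesis
      proof (cases "w \<in> ?O")
        case True
        then have "u \<sqsubseteq>\<^bsub>?B\<^esub> w \<longleftrightarrow> u \<sqsubseteq>\<^bsub>P\<^esub> w"
          unfolding l using uO noexc by blast
        then show ?thesis
          using le[OF subsetD[OF OP(1) uO] subsetD[OF OP(1) True]] by simp
      next
        case False
        then obtain y where y: "y \<in> ?K" "w = Exc (Old p) y"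
          using cases[OF w] by auto
        then have "u \<sqsubseteq>\<^bsub>?B\<^esub> w \<longleftrightarrow> u \<sqsubseteq>\<^bsub>P\<^esub> y"
          unfolding l using uO False noexc by blast
        then show ?thesis
          using le[OF subsetD[OF OP(1) uO] subsetD[OF OP(2) y(1)]] y(2)
            pe[OF subsetD[OF OP(1) uO]] by auto
      qed
    next
      case False
      then obtain x where x: "x \<in> ?K" "u = Exc (Old p) x"
        using cases[OF u] by auto
      show ?thesis
      proof (cases "w \<in> ?O")
        case True
        then have "\<not> u \<sqsubseteq>\<^bsub>?B\<^esub> w"
          unfolding l using False noexc by blast
        then show ?thesis
          using x pe[of w] True OP by auto
      next
        case wO: False
        then obtain y where y: "y \<in> ?K" "w = Exc (Old p) y"
          using cases[OF w] by auto
        then have "u \<sqsubseteq>\<^bsub>?B\<^esub> w \<longleftrightarrow> x \<sqsubseteq>\<^bsub>P\<^esub> y"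
          unfolding l using x wO False by blast
        then show ?thesis
          using le[OF subsetD[OF OP(2) x(1)] subsetD[OF OP(2) y(1)]] x(2) y(2)
            pe[OF subsetD[OF OP(2) x(1)]] pe[OF subsetD[OF OP(2) y(1)]] by auto
      qed
    qed
  qed
  show ?thesis
    unfolding chart_def using cB leB by (auto simp: blowup_def)
qed

lemma chart_fold:
  "set qs \<subseteq> N \<Longrightarrow> sorted_wrt (\<lambda>p q. (p, q) \<in> r) qs
    \<Longrightarrow> chart (fold blowup (map Old qs) (embed_order L)) qs"
proof (induction qs rule: rev_induct)
  case Nil
  then show ?case using chart_embed by simp
next
  case (snoc p qs)
  then show ?case
    using chart_blowup[of "fold blowup (map Old qs) (embed_order L)" qs p]
    by (auto simp: sorted_wrt_append)
qed

abbreviation "P \<equiv> iter_blowup L H r"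

lemma chart_P: "chart P ps"
  using chart_fold[of ps] ps unfolding iter_blowup_def ps_def[symmetric] by auto

end


context nested_blowup
begin

section \<open>Coordinates on the iterated blowup\<close>

abbreviation "v \<equiv> vertex L"
abbreviation "J \<equiv> nested_join L H r"

lemma eq_P: "eq P = (=)"
  using chart_P unfolding chart_def by auto

lemma P_le: "u \<in> carrier P \<Longrightarrow> w \<in> carrier P \<Longrightarrow> u \<sqsubseteq>\<^bsub>P\<^esub> w \<longleftrightarrow> exc u \<subseteq> exc w \<and> base u \<sqsubseteq> base w"
  using chart_P unfolding chart_def by auto

lemma P_elem: "adm ps T x \<Longrightarrow> enc ps T x \<in> carrier P" "adm ps T x \<Longrightarrow> exc (enc ps T x) = T"
  using chart_P exc_enc_adm unfolding chart_def by auto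

lemma P_coord:
  assumes "u \<in> carrier P"
  shows "adm ps (exc u) (base u)" "u = enc ps (exc u) (base u)" "base u \<in> carrier L" "exc u \<subseteq> N"
proof -
  obtain T x where "u = enc ps T x" "adm ps T x"
    using assms chart_P unfolding chart_def by auto
  then show "adm ps (exc u) (base u)" "u = enc ps (exc u) (base u)"
    using exc_enc_adm by auto
  then show "base u \<in> carrier L" "exc u \<subseteq> N"
    unfolding adm_def ps by auto
qed

lemma P_eqI: "u \<in> carrier P \<Longrightarrow> w \<in> carrier P \<Longrightarrow> exc u = exc w \<Longrightarrow> base u = base w \<Longrightarrow> u = w"
  using P_coord(2) by metis

lemma P_refl: "u \<in> carrier P \<Longrightarrow> u \<sqsubseteq>\<^bsub>P\<^esub> u"
  using P_le P_coord by auto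

lemma P_antisym: "u \<in> carrier P \<Longrightarrow> w \<in> carrier P \<Longrightarrow> u \<sqsubseteq>\<^bsub>P\<^esub> w \<Longrightarrow> w \<sqsubseteq>\<^bsub>P\<^esub> u \<Longrightarrow> u = w"
  using P_le[of u w] P_le[of w u] le_antisym[of "base u" "base w"] P_coord(3)[of u] P_coord(3)[of w]
  by (intro P_eqI) auto

lemma P_trans:
  "u \<sqsubseteq>\<^bsub>P\<^esub> w \<Longrightarrow> w \<sqsubseteq>\<^bsub>P\<^esub> z \<Longrightarrow> u \<in> carrier P \<Longrightarrow> w \<in> carrier P \<Longrightarrow> z \<in> carrier P \<Longrightarrow> u \<sqsubseteq>\<^bsub>P\<^esub> z"
  using P_le[of u w] P_le[of w z] P_le[of u z] le_trans[of "base u" "base w" "base z"]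
    P_coord(3)[of u] P_coord(3)[of w] P_coord(3)[of z] by auto

lemma finite_P: "finite (carrier P)"
proof -
  have "carrier P \<subseteq> (\<lambda>(T, x). enc ps T x) ` (Pow N \<times> carrier L)"
  proof
    fix u assume u: "u \<in> carrier P"
    show "u \<in> (\<lambda>(T, x). enc ps T x) ` (Pow N \<times> carrier L)"
      by (rule image_eqI[of _ _ "(exc u, base u)"]) (use P_coord[OF u] in auto)
  qed
  moreover have "finite (Pow N \<times> carrier L)"
    using finite_H finite_carrier by simp
  ultimately show ?thesis
    using finite_surj by blast
qed

lemma enc_single:
  "distinct qs \<Longrightarrow> enc qs {g} x = (if g \<in> set qs then Exc (Old g) (Old x) else Old x)"
proof (induction qs rule: rev_induct)
  case (snoc p qs)
  then show ?case unfolding enc_snoc by auto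
qed (simp add: enc_def)

lemma enc_empty: "enc qs {} x = Old x"
  by (induction qs) (auto simp: enc_def)

lemma distinct_ps: "distinct ps"
proof -
  have "sorted_wrt (\<lambda>p q. (p, q) \<in> r) qs \<Longrightarrow> distinct qs" for qs
    using r_irrefl by (induction qs) auto
  then show ?thesis using ps by auto
qed

text \<open>Admissibility of the two kinds of pairs asks that no centre lie below an atom g, and
  that no centre preceding a non-atom g lie below it; the latter holds because elements of H
  strictly below g come after g.\<close>

lemma vertex_coord:
  assumes g: "g \<in> H"
  shows "v g \<in> carrier P" "exc (v g) = {g} - atoms L" "base (v g) = (if g \<in> atoms L then g else \<bottom>)"
proof -
  have *: "v g = enc ps ({g} - atoms L) (if g \<in> atoms L then g else \<bottom>) \<and>
    adm ps ({g} - atoms L) (if g \<in> atoms L then g else \<bottom>)"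
  proof (cases "g \<in> atoms L")
    case True
    have "\<not> h \<sqsubseteq> g" if "h \<in> N" for h
      using below_atom[OF True, of h] that H_sub bottom_notin_H True by auto
    then show ?thesis
      using True atom_in unfolding adm_def ps by (simp add: vertex_def enc_empty)
  next
    case False
    have "\<Squnion>(insert \<bottom> (later {g} g)) = g"
      using g H_sub by (intro Sup_eqI) (auto simp: later_def)
    moreover have "\<not> h \<sqsubseteq> g" if h: "h \<in> N" "(h, g) \<in> r" for h
    proof
      assume "h \<sqsubseteq> g"
      then have "h = g \<or> (g, h) \<in> r"
        using less_imp_r[OF g, of h] h(1) by blast
      then show False
        using h(2) r_asym[OF h(2)] r_irrefl[of g] by blast
    qed
    moreover have "\<not> h \<sqsubseteq> \<bottom>" if "h \<in> N" for h
      using le_bottom_iff[of h] subsetD[OF H_sub, of h] bottom_notin_H that by auto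
    ultimately have "adm ps {g} \<bottom>"
      unfolding adm_def ps using g False by simp
    moreover have "{g} - atoms L = {g}"
      using False by auto
    moreover have "v g = enc ps {g} \<bottom>"
      unfolding vertex_def enc_single[OF distinct_ps] ps(1) using False g by simp
    ultimately show ?thesis
      using False by simp
  qed
  note e = conjunct1[OF *] and a = conjunct2[OF *]
  show "v g \<in> carrier P" "exc (v g) = {g} - atoms L" "base (v g) = (if g \<in> atoms L then g else \<bottom>)"
    unfolding e by (rule P_elem(1)[OF a], rule P_elem(2)[OF a], rule base_enc)
qed

lemma inj_v: "inj v"
  by (rule injI) (auto simp: vertex_def split: if_splits)

text \<open>The atoms of P below u, renamed by elements of H. The matroid arguments use these
  subsets of H instead of elements of P.\<close>

definition E :: "'a blow \<Rightarrow> 'a set" where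
  "E u = {g \<in> H. v g \<sqsubseteq>\<^bsub>P\<^esub> u}"

lemma E_coord:
  assumes "u \<in> carrier P"
  shows "E u = exc u \<union> ats (base u)"
proof -
  have "v g \<sqsubseteq>\<^bsub>P\<^esub> u \<longleftrightarrow> g \<in> exc u \<union> ats (base u)" if "g \<in> H" for g
    using P_le[OF vertex_coord(1)[OF that] assms] vertex_coord[OF that] P_coord[OF assms]
    by (auto simp: ats_def)
  moreover have "exc u \<union> ats (base u) \<subseteq> H"
    using P_coord[OF assms] atoms_H by (auto simp: ats_def)
  ultimately show ?thesis
    unfolding E_def by auto
qed

lemma E_sub: "E u \<subseteq> H"
  unfolding E_def by auto

lemma E_mono: "u \<sqsubseteq>\<^bsub>P\<^esub> w \<Longrightarrow> u \<in> carrier P \<Longrightarrow> w \<in> carrier P \<Longrightarrow> E u \<subseteq> E w"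
  unfolding E_def using P_trans[of _ u w] vertex_coord(1) by auto

section \<open>Nested sets and admissible pairs\<close>

lemma nested_mono: "nested L H S \<Longrightarrow> S' \<subseteq> S \<Longrightarrow> nested L H S'"
  unfolding nested_def by blast

text \<open>A candidate with the largest number of atoms below it is maximal, because comparable
  elements with equally many atoms are equal.\<close>

lemma max_below_ex:
  assumes "A \<subseteq> carrier L" "s \<in> A" "s \<sqsubseteq> y" "y \<in> carrier L"
  shows "\<exists>m\<in>max_below L A y. s \<sqsubseteq> m"
proof -
  let ?B = "{h \<in> A. s \<sqsubseteq> h \<and> h \<sqsubseteq> y}"
  have fin: "finite ?B"
    using finite_subset[OF _ finite_carrier, of ?B] assms(1) by auto
  have sB: "s \<in> ?B"
    using assms by auto
  obtain m where m: "m \<in> ?B" "\<And>h. h \<in> ?B \<Longrightarrow> card (ats h) \<le> card (ats m)"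
  proof -
    have "Max ((card \<circ> ats) ` ?B) \<in> (card \<circ> ats) ` ?B"
      using fin sB by (intro Max_in) auto
    then obtain m where "m \<in> ?B" "card (ats m) = Max ((card \<circ> ats) ` ?B)"
      by auto
    moreover have "card (ats h) \<le> Max ((card \<circ> ats) ` ?B)" if "h \<in> ?B" for h
      using fin that by (intro Max_ge) auto
    ultimately show ?thesis
      using that by simp
  qed
  have "h = m" if h: "h \<in> A" "h \<sqsubseteq> y" "m \<sqsubseteq> h" for h
  proof -
    have c: "m \<in> carrier L" "h \<in> carrier L" "s \<in> carrier L"
      using h m assms by auto
    have "s \<sqsubseteq> h"
      using m h c le_trans[of s m h] by auto
    then have "card (ats h) \<le> card (ats m)"
      using m h by auto
    moreover have "ats m \<subseteq> ats h"
      using le_iff_ats c h by auto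
    moreover have "finite (ats h)"
      using ats_sub finite_carrier finite_subset by blast
    ultimately have "ats m = ats h"
      using card_seteq by blast
    then show ?thesis
      using Sup_ats c by metis
  qed
  then show ?thesis
    using m unfolding max_below_def by blast
qed

text \<open>In the product over \<open>max_below L G y\<close> every s in S lies in a single factor:
  it is below some maximal h, so its coordinates outside h are \<bottom>. Hence the g-coordinate of
  the join y depends only on those s that are below g.\<close>

lemma building_factor:
  assumes G: "building_set L G" and y: "y \<in> carrier L" "y \<noteq> \<bottom>" and g: "g \<in> max_below L G y"
    and S: "S \<subseteq> G" "y = \<Squnion>S"
  shows "g = \<Squnion>{s \<in> S. s \<sqsubseteq> g}"
proof -
  let ?X = "max_below L G y"
  let ?D = "\<Pi>\<^sub>E g\<in>?X. carrier (below L g)"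
  have GL: "G \<subseteq> carrier L"
    using building_sub[OF G] by auto
  have SL: "S \<subseteq> carrier L"
    using S GL by auto
  have XL: "?X \<subseteq> carrier L" "?X \<subseteq> G" "\<And>h. h \<in> ?X \<Longrightarrow> h \<sqsubseteq> y"
    using GL unfolding max_below_def by auto
  have "y \<in> carrier L - {\<bottom>}"
    using y by simp
  note iso = bspec[OF conjunct2[OF conjunct2[OF G[unfolded building_set_def]]] this, unfolded Let_def]
  obtain \<phi> where \<phi>: "bij_betw \<phi> ?D (carrier (below L y))
      \<and> (\<forall>u\<in>?D. \<forall>w\<in>?D. \<phi> u \<sqsubseteq> \<phi> w \<longleftrightarrow> (\<forall>g\<in>?X. u g \<sqsubseteq> w g))
      \<and> (\<forall>g\<in>?X. \<phi> (\<lambda>h\<in>?X. if h = g then g else \<bottom>) = g)"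
    using iso by (elim exE)
  note bij = conjunct1[OF \<phi>]
  have mono: "\<phi> u \<sqsubseteq> \<phi> w \<longleftrightarrow> (\<forall>g\<in>?X. u g \<sqsubseteq> w g)" if "u \<in> ?D" "w \<in> ?D" for u w
    using bspec[OF bspec[OF conjunct1[OF conjunct2[OF \<phi>]] that(1)] that(2)] .
  have unit: "\<phi> (\<lambda>h\<in>?X. if h = g then g else \<bottom>) = g" if "g \<in> ?X" for g
    using bspec[OF conjunct2[OF conjunct2[OF \<phi>]] that] .
  define e where "e g = (\<lambda>h\<in>?X. if h = g then g else \<bottom>)" for g
  have carb: "carrier (below L z) = {w \<in> carrier L. w \<sqsubseteq> z}" for z
    unfolding below_def by simp
  have eD: "e h \<in> ?D" if "h \<in> ?X" for h
    unfolding e_def carb using subsetD[OF XL(1)] by (auto simp: PiE_iff)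
  have surj: "\<exists>c\<in>?D. \<phi> c = s" if "s \<in> carrier L" "s \<sqsubseteq> y" for s
  proof -
    have "s \<in> \<phi> ` ?D"
      using bij that unfolding bij_betw_def carb by simp
    then show ?thesis by auto
  qed
  define z where "z = \<Squnion>{s \<in> S. s \<sqsubseteq> g}"
  have gL: "g \<in> carrier L"
    using g XL by auto
  have zsub: "{s \<in> S. s \<sqsubseteq> g} \<subseteq> carrier L"
    using SL by auto
  have zL: "z \<in> carrier L" "z \<sqsubseteq> g"
    using zsub gL Sup_le_iff[OF zsub gL] unfolding z_def by auto
  have zy: "z \<sqsubseteq> y"
    using zL gL y g XL le_trans by blast
  obtain c where c: "c \<in> ?D" "\<phi> c = z"
    using surj zL zy by blast
  \<comment> \<open>The test element: its g-coordinate is that of z and all its other coordinates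
    are maximal. It bounds all of S, hence y and g; comparing g-coordinates then bounds g by
    z.\<close>
  define w where "w = (\<lambda>h\<in>?X. if h = g then c g else h)"
  have cD: "u h \<sqsubseteq> h" "u h \<in> carrier L" if "u \<in> ?D" "h \<in> ?X" for u h
    using that by (auto simp: carb PiE_def Pi_def)
  have wD: "w \<in> ?D"
    unfolding w_def carb using cD[OF c(1)] g subsetD[OF XL(1)] by (auto simp: PiE_iff)
  have sw: "s \<sqsubseteq> \<phi> w" if s: "s \<in> S" for s
  proof -
    have sL: "s \<in> carrier L" "s \<sqsubseteq> y"
      using s SL S le_Sup by auto
    obtain h where h: "h \<in> ?X" "s \<sqsubseteq> h"
      using max_below_ex[of G s y] GL s S sL y by blast
    obtain d where d: "d \<in> ?D" "\<phi> d = s"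
      using surj sL by blast
    have "\<phi> d \<sqsubseteq> \<phi> (e h)"
      using d h unit[OF h(1)] unfolding e_def by simp
    then have de: "d k \<sqsubseteq> e h k" if "k \<in> ?X" for k
      using mono[OF d(1) eD[OF h(1)]] that by auto
    have "d k \<sqsubseteq> w k" if k: "k \<in> ?X" for k
    proof (cases "k = g")
      case True
      show ?thesis
      proof (cases "h = g")
        case True
        then have "s \<sqsubseteq> z"
          unfolding z_def using s h zsub by (intro le_Sup) auto
        then have "\<phi> d \<sqsubseteq> \<phi> c"
          using c d by simp
        then have "d g \<sqsubseteq> c g"
          using mono[OF d(1) c(1)] g by auto
        then show ?thesis
          using \<open>k = g\<close> g unfolding w_def by simp
      next
        case False
        then have "d k \<sqsubseteq> \<bottom>"
          using de[OF k] True k unfolding e_def by simp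
        then have "d k = \<bottom>"
          using cD[OF d(1) k] le_bottom_iff by auto
        then show ?thesis
          using True g cD[OF c(1) g] unfolding w_def by simp
      qed
    next
      case False
      then show ?thesis
        using cD(1)[OF d(1) k] k unfolding w_def by simp
    qed
    then show ?thesis
      using mono[OF d(1) wD] d by auto
  qed
  have \<phi>w: "\<phi> w \<in> carrier L" "\<phi> w \<sqsubseteq> y"
    using bij wD unfolding bij_betw_def carb by auto
  have "y \<sqsubseteq> \<phi> w"
    unfolding S(2) using sw Sup_le_iff[OF SL \<phi>w(1)] by auto
  then have "g \<sqsubseteq> \<phi> w"
    using le_trans[OF XL(3)[OF g]] gL y \<phi>w by auto
  then have "\<phi> (e g) \<sqsubseteq> \<phi> w"
    using unit[OF g] unfolding e_def by simp
  then have "e g g \<sqsubseteq> w g"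
    using mono[OF eD[OF g] wD] g by blast
  then have gc: "g \<sqsubseteq> c g"
    unfolding e_def w_def using g by simp
  have "e g k \<sqsubseteq> c k" if "k \<in> ?X" for k
    using that gc cD[OF c(1) that] unfolding e_def by auto
  then have "\<phi> (e g) \<sqsubseteq> \<phi> c"
    using mono[OF eD[OF g] c(1)] by auto
  then have "g \<sqsubseteq> z"
    using unit[OF g] c unfolding e_def by simp
  then show ?thesis
    using zL gL le_antisym unfolding z_def by blast
qed

text \<open>Let g be the factor of the join above h. It lies in \<open>N\<close>, because
  \<open>N\<close> is upward closed in the building set. By \<open>building_factor\<close> it is the
  join of the members of S' below it, hence of the maximal ones among them, which form an antichain.
  Two or more of these would contradict nestedness, as g is in H; so there is exactly one, and it is
  g.\<close>

lemma nested_key: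
  assumes n: "nested L H S" and S': "S' \<subseteq> S" and h: "h \<in> N" "h \<sqsubseteq> \<Squnion>S'"
  shows "\<exists>g\<in>S'. g \<in> N \<and> h \<sqsubseteq> g"
proof -
  obtain G where G: "building_set L G" "H \<subseteq> G" "\<forall>h\<in>N. \<forall>g\<in>G. h \<sqsubseteq> g \<longrightarrow> g \<in> N"
    using pbs unfolding partial_building_set_def by blast
  have SH: "S' \<subseteq> H"
    using n S' unfolding nested_def by auto
  then have SL: "S' \<subseteq> carrier L" and yL: "\<Squnion>S' \<in> carrier L"
    using H_sub by auto
  have GL: "G \<subseteq> carrier L"
    using building_sub[OF G(1)] by auto
  have hG: "h \<in> G" "h \<noteq> \<bottom>" "h \<in> carrier L"
    using h(1) subsetD[OF G(2), of h] subsetD[OF H_sub, of h] bottom_notin_H by auto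
  then have ynb: "\<Squnion>S' \<noteq> \<bottom>"
    using h le_bottom_iff by auto
  obtain g where g: "g \<in> max_below L G (\<Squnion>S')" "h \<sqsubseteq> g"
    using max_below_ex[OF GL hG(1) h(2) yL] by blast
  have gG: "g \<in> G"
    using g unfolding max_below_def by auto
  then have gN: "g \<in> N" "g \<in> carrier L"
    using G(3) h(1) g(2) subsetD[OF GL] by blast+
  define A where "A = {s \<in> S'. s \<sqsubseteq> g}"
  have AL: "A \<subseteq> carrier L" "A \<subseteq> S'"
    unfolding A_def using SL by auto
  have gA: "g = \<Squnion>A"
    unfolding A_def using building_factor[OF G(1) yL ynb g(1)] SH G(2) by auto
  define M where "M = max_below L A g"
  have MA: "M \<subseteq> A"
    unfolding M_def max_below_def by auto
  have ex: "\<exists>m\<in>M. s \<sqsubseteq> m" if "s \<in> A" for s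
    unfolding M_def using max_below_ex[OF AL(1) that] that gN(2) A_def by auto
  have "\<Squnion>A \<sqsubseteq> \<Squnion>M"
    using ex AL MA by (intro Sup_mono) auto
  moreover have "\<Squnion>M \<sqsubseteq> \<Squnion>A"
    using AL MA by (intro Sup_mono) (auto intro!: bexI le_refl)
  ultimately have gM: "g = \<Squnion>M"
    using gA le_antisym[of "\<Squnion>A" "\<Squnion>M"] AL(1) subset_trans[OF MA AL(1)] by simp
  have anti: "\<not> a \<sqsubseteq> b" if "a \<in> M" "b \<in> M" "a \<noteq> b" for a b
    using that MA unfolding M_def max_below_def A_def by auto
  have finM: "finite M"
    using finite_subset[OF _ finite_H, of M] MA AL SH by blast
  have "\<not> card M \<ge> 2"
  proof
    assume "card M \<ge> 2"
    then have "\<Squnion>M \<notin> H"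
      using n anti subset_trans[OF MA subset_trans[OF AL(2) S']] unfolding nested_def by blast
    then show False
      using gM gN by auto
  qed
  moreover have "M \<noteq> {}"
  proof
    assume "M = {}"
    then have "g \<sqsubseteq> \<bottom>"
      using gM Sup_le_iff[of "{}" \<bottom>] by auto
    then show False
      using gN bottom_notin_H le_bottom_iff by auto
  qed
  ultimately have "card M = 1"
    using card_0_eq[OF finM] by linarith
  then obtain m where m: "M = {m}"
    by (auto simp: card_1_singleton_iff)
  have "m \<in> carrier L"
    using m MA AL by auto
  then have "\<Squnion>M = m"
    unfolding m by (intro Sup_eqI) auto
  then have "g = m"
    using gM by simp
  then show ?thesis
    using m MA AL gN g by blast
qed

text \<open>By \<open>nested_key\<close>, a centre h that violates the clause for t lies below some
  g in \<open>later (S - atoms L) t\<close>. Then h is g or comes after g, and g is t or comes after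
  t, so h does not precede t.\<close>

lemma nested_imp_adm:
  assumes n: "nested L H S"
  shows "adm ps (S - atoms L) (\<Squnion>(S \<inter> atoms L))"
proof -
  have SH: "S \<subseteq> H"
    using n unfolding nested_def by auto
  have aL: "S \<inter> atoms L \<subseteq> carrier L"
    using atom_in by auto
  have "\<not> h \<sqsubseteq> \<Squnion>(S \<inter> atoms L)" if "h \<in> N" for h
    using nested_key[OF n _ that, of "S \<inter> atoms L"] by auto
  moreover have "\<not> h \<sqsubseteq> \<Squnion>(insert (\<Squnion>(S \<inter> atoms L)) (later (S - atoms L) t))"
    if t: "t \<in> S - atoms L" and h: "h \<in> N" "(h, t) \<in> r" for h t
  proof
    let ?S = "(S \<inter> atoms L) \<union> later (S - atoms L) t"
    assume "h \<sqsubseteq> \<Squnion>(insert (\<Squnion>(S \<inter> atoms L)) (later (S - atoms L) t))"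
    then have "h \<sqsubseteq> \<Squnion>?S"
      using Sup_insert_Sup[OF aL, of "later (S - atoms L) t"] subset_trans[OF SH H_sub]
      by (simp add: later_def subset_iff)
    then obtain g where g: "g \<in> ?S" "g \<in> N" "h \<sqsubseteq> g"
      using nested_key[OF n _ h(1), of ?S] by (auto simp: later_def)
    then have "g = t \<or> (t, g) \<in> r"
      by (auto simp: later_def)
    moreover have "h = g \<or> (g, h) \<in> r"
      using g h less_imp_r[of g h] by auto
    ultimately show False
      using h r_trans r_irrefl by blast
  qed
  ultimately show ?thesis
    using SH aL unfolding adm_def ps by auto
qed

text \<open>Suppose the join of an antichain A is in H. If A consists of atoms below x, the join is
  a centre below x. Otherwise let t be the r-first element of A \<inter> T: the join is strictly
  above t, so it precedes t, but it is below the join of x and \<open>later T t\<close>. Both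
  contradict admissibility.\<close>

lemma adm_imp_nested:
  assumes a: "adm ps T x"
  shows "nested L H (T \<union> ats x)"
proof -
  have x: "x \<in> carrier L" "T \<subseteq> N" and nx: "\<And>h. h \<in> N \<Longrightarrow> \<not> h \<sqsubseteq> x"
    and nt: "\<And>t h. t \<in> T \<Longrightarrow> h \<in> N \<Longrightarrow> (h, t) \<in> r \<Longrightarrow> \<not> h \<sqsubseteq> \<Squnion>(insert x (later T t))"
    using a unfolding adm_def ps by auto
  have sub: "T \<union> ats x \<subseteq> H"
    using x atoms_H unfolding ats_def by auto
  have "\<Squnion>A \<notin> H" if A: "A \<subseteq> T \<union> ats x" "card A \<ge> 2"
    and anti: "\<forall>a\<in>A. \<forall>b\<in>A. a \<noteq> b \<longrightarrow> \<not> a \<sqsubseteq> b" for A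
  proof
    assume hH: "\<Squnion>A \<in> H"
    have AL: "A \<subseteq> carrier L" "A \<subseteq> H"
      using A(1) sub H_sub by blast+
    have other: "\<exists>b\<in>A. b \<noteq> a" for a
    proof (rule ccontr)
      assume "\<not> ?thesis"
      then have "A \<subseteq> {a}" by auto
      then have "card A \<le> card {a}"
        by (intro card_mono) auto
      then show False using A by simp
    qed
    have ne: "a \<noteq> \<Squnion>A" if "a \<in> A" for a
    proof
      assume a: "a = \<Squnion>A"
      obtain b where b: "b \<in> A" "b \<noteq> a"
        using other by blast
      then show False
        using le_Sup[OF AL(1) b(1)] anti that a by blast
    qed
    \<comment> \<open>Members of A are strictly below the join, so they would all equal
      \<bottom>.\<close>
    have "\<Squnion>A \<notin> atoms L"
    proof
      assume h: "\<Squnion>A \<in> atoms L"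
      obtain b where "b \<in> A"
        using other by blast
      then show False
        using below_atom[OF h, of b] le_Sup[OF AL(1), of b] ne[of b] AL bottom_notin_H by auto
    qed
    then have hN: "\<Squnion>A \<in> N"
      using hH by auto
    show False
    proof (cases "A \<inter> T = {}")
      case True
      then have "\<Squnion>A \<sqsubseteq> x"
        using A Sup_le_iff[OF AL(1) x(1)] unfolding ats_def by auto
      then show False
        using nx hN by auto
    next
      case False
      then obtain t where t: "t \<in> A \<inter> T" "\<forall>a\<in>A \<inter> T - {t}. (t, a) \<in> r"
        using r_minimum[of "A \<inter> T"] AL by auto
      have "(\<Squnion>A, t) \<in> r"
        using less_imp_r[OF hH, of t] t AL le_Sup[OF AL(1), of t] ne[of t] by auto
      moreover have "\<Squnion>A \<sqsubseteq> \<Squnion>(insert x (later T t))"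
      proof (rule Sup_mono[OF AL(1)])
        show "insert x (later T t) \<subseteq> carrier L"
          using x H_sub unfolding later_def by auto
        fix a assume a: "a \<in> A"
        show "\<exists>b\<in>insert x (later T t). a \<sqsubseteq> b"
        proof (cases "a \<in> T")
          case True
          then show ?thesis
            using a t AL unfolding later_def by (intro bexI[of _ a]) auto
        next
          case False
          then show ?thesis
            using a A unfolding ats_def by auto
        qed
      qed
      ultimately show False
        using nt[of t "\<Squnion>A"] t hN by auto
    qed
  qed
  then show ?thesis
    using sub unfolding nested_def by blast
qed

lemma nested_E: "u \<in> carrier P \<Longrightarrow> nested L H (E u)"
  using adm_imp_nested[OF P_coord(1)] E_coord by simp

text \<open>Admissibility supplies an element with these coordinates, and the product order makes it
  the least upper bound. So for nested S the choice inside \<open>\<Squnion>\<close> yields an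
  actual join, computed coordinatewise.\<close>

lemma J_coord:
  assumes n: "nested L H S"
  shows "J S \<in> carrier P" "exc (J S) = S - atoms L" "base (J S) = \<Squnion>(S \<inter> atoms L)"
    and J_le_iff: "z \<in> carrier P \<Longrightarrow> J S \<sqsubseteq>\<^bsub>P\<^esub> z \<longleftrightarrow> S \<subseteq> E z"
proof -
  let ?s = "enc ps (S - atoms L) (\<Squnion>(S \<inter> atoms L))"
  have SH: "S \<subseteq> H"
    using n unfolding nested_def by auto
  have aL: "S \<inter> atoms L \<subseteq> carrier L"
    using atom_in by auto
  note a = nested_imp_adm[OF n]
  have s: "?s \<in> carrier P" "exc ?s = S - atoms L" "base ?s = \<Squnion>(S \<inter> atoms L)"
    using P_elem[OF a] by auto
  have le: "?s \<sqsubseteq>\<^bsub>P\<^esub> z \<longleftrightarrow> S \<subseteq> E z" if z: "z \<in> carrier P" for z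
  proof -
    have "?s \<sqsubseteq>\<^bsub>P\<^esub> z \<longleftrightarrow> S - atoms L \<subseteq> exc z \<and> (\<forall>a\<in>S \<inter> atoms L. a \<sqsubseteq> base z)"
      using P_le[OF s(1) z] s Sup_le_iff[OF aL P_coord(3)[OF z]] by auto
    also have "\<dots> \<longleftrightarrow> S \<subseteq> E z"
      unfolding E_coord[OF z] ats_def using P_coord(4)[OF z] by auto
    finally show ?thesis .
  qed
  have "J S = ?s"
    unfolding nested_join_def
  proof (rule sup_eqI)
    show "v ` S \<subseteq> carrier P"
      using vertex_coord(1) SH by auto
    show "?s \<sqsubseteq>\<^bsub>P\<^esub> z \<longleftrightarrow> (\<forall>a\<in>v ` S. a \<sqsubseteq>\<^bsub>P\<^esub> z)" if "z \<in> carrier P" for z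
      using le[OF that] SH unfolding E_def by auto
  qed (use s P_refl P_antisym in auto)
  then show "J S \<in> carrier P" "exc (J S) = S - atoms L" "base (J S) = \<Squnion>(S \<inter> atoms L)"
    "z \<in> carrier P \<Longrightarrow> J S \<sqsubseteq>\<^bsub>P\<^esub> z \<longleftrightarrow> S \<subseteq> E z"
    using s le by auto
qed

lemma J_E: "u \<in> carrier P \<Longrightarrow> J (E u) = u"
proof -
  assume u: "u \<in> carrier P"
  note n = nested_E[OF u]
  have "E u - atoms L = exc u" "E u \<inter> atoms L = ats (base u)"
    using E_coord[OF u] P_coord(4)[OF u] unfolding ats_def by auto
  then show ?thesis
    using J_coord[OF n] u P_coord(3)[OF u] Sup_ats by (intro P_eqI) auto
qed

lemma E_J_sup: "nested L H S \<Longrightarrow> S \<subseteq> E (J S)"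
  using J_coord(1) J_le_iff P_refl by blast

text \<open>Together with \<open>E_J_sup\<close> this says that \<open>E (J S)\<close> is a closure
  operator, with monotonicity and idempotence in one statement.\<close>

lemma E_J_mono: "nested L H S' \<Longrightarrow> S \<subseteq> E (J S') \<Longrightarrow> E (J S) \<subseteq> E (J S')"
proof -
  assume n: "nested L H S'" and S: "S \<subseteq> E (J S')"
  have "nested L H S"
    using nested_mono[OF nested_E[OF J_coord(1)[OF n]] S] .
  then have "J S \<sqsubseteq>\<^bsub>P\<^esub> J S'" "J S \<in> carrier P"
    using J_le_iff J_coord(1) n S by auto
  then show "E (J S) \<subseteq> E (J S')"
    using E_mono J_coord(1)[OF n] by blast
qed

lemma E_inj: "u \<in> carrier P \<Longrightarrow> w \<in> carrier P \<Longrightarrow> E u = E w \<Longrightarrow> u = w"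
proof -
  assume u: "u \<in> carrier P" and w: "w \<in> carrier P" and e: "E u = E w"
  have "J (E u) = J (E w)"
    by (simp only: e)
  then show "u = w"
    by (simp only: J_E[OF u] J_E[OF w])
qed

text \<open>In the Boolean factor every set is closed, so a non-atom s can only enter as s = t. For
  atoms the claim is \<open>exchange_atoms\<close> at the join of the atoms in D.\<close>

lemma exchange:
  assumes n: "nested L H (insert s (insert t D))"
    and s: "s \<in> E (J (insert t D))" "s \<notin> E (J D)"
  shows "t \<in> E (J (insert s D))"
proof -
  have n1: "nested L H (insert t D)" and n2: "nested L H D" and n3: "nested L H (insert s D)"
    using nested_mono[OF n] by auto
  have E1: "E (J (insert t D)) = (insert t D - atoms L) \<union> ats (\<Squnion>(insert t D \<inter> atoms L))"
    and E2: "E (J D) = (D - atoms L) \<union> ats (\<Squnion>(D \<inter> atoms L))"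
    and E3: "E (J (insert s D)) = (insert s D - atoms L) \<union> ats (\<Squnion>(insert s D \<inter> atoms L))"
    using J_coord[OF n1] J_coord[OF n2] J_coord[OF n3] E_coord by auto
  show ?thesis
  proof (cases "s \<in> atoms L")
    case False
    then have "s = t"
      using s unfolding E1 E2 ats_def by auto
    then show ?thesis
      using E_J_sup[OF n1] by auto
  next
    case sA: True
    have tA: "t \<in> atoms L"
    proof (rule ccontr)
      assume "t \<notin> atoms L"
      then show False
        using s sA unfolding E1 E2 by auto
    qed
    have aL: "D \<inter> atoms L \<subseteq> carrier L" "s \<in> carrier L" "t \<in> carrier L"
      using atom_in sA tA by auto
    let ?d = "\<Squnion>(D \<inter> atoms L)"
    have i: "\<Squnion>(insert u D \<inter> atoms L) = \<Squnion>{?d, u}" if "u \<in> atoms L" for u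
      using Sup_insert_Sup[OF aL(1), of "{u}"] that atom_in by (auto simp: Int_insert_left)
    have "s \<sqsubseteq> \<Squnion>{?d, t}" "\<not> s \<sqsubseteq> ?d"
      using s sA i[OF tA] unfolding E1 E2 ats_def by auto
    then have "t \<sqsubseteq> \<Squnion>{?d, s}"
      using exchange_atoms[OF _ sA tA] aL by auto
    then show ?thesis
      unfolding E3 i[OF sA] ats_def using tA by auto
  qed
qed


section \<open>The matroid structure\<close>

text \<open>Joins are taken in P, so this describes the matroids of all lower intervals at once.
  Nestedness is required because the closure makes sense only for bounded sets.\<close>

definition ind :: "'a set \<Rightarrow> bool" where
  "ind S \<longleftrightarrow> nested L H S \<and> (\<forall>s\<in>S. s \<notin> E (J (S - {s})))"

definition circ :: "'a set \<Rightarrow> bool" where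
  "circ C \<longleftrightarrow> nested L H C \<and> \<not> ind C \<and> (\<forall>D. D \<subset> C \<longrightarrow> ind D)"

lemma nested_finite: "nested L H S \<Longrightarrow> finite S"
  unfolding nested_def using finite_H finite_subset by blast

lemma nested_sub: "nested L H S \<Longrightarrow> S \<subseteq> H"
  unfolding nested_def by blast

lemma dep_has_circ:
  assumes "nested L H S" "\<not> ind S"
  shows "\<exists>C\<subseteq>S. circ C"
  using nested_finite[OF assms(1)] assms
proof (induction S rule: finite_psubset_induct)
  case (psubset S)
  show ?case
  proof (cases "\<forall>D. D \<subset> S \<longrightarrow> ind D")
    case True
    then have "circ S"
      using psubset.prems unfolding circ_def by simp
    then show ?thesis by blast
  next
    case False
    then obtain D where D: "D \<subset> S" "\<not> ind D" by blast
    then have "nested L H D"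
      using nested_mono psubset.prems by blast
    then obtain C where "C \<subseteq> D" "circ C"
      using psubset.IH[OF D(1)] D(2) by blast
    then show ?thesis
      using D(1) by blast
  qed
qed

text \<open>Dependence gives one s in the closure of the rest. For another c, s is not in the
  closure of \<open>C - {s, c}\<close> because \<open>C - {c}\<close> is independent, so exchange
  puts c into the closure of \<open>C - {c}\<close>.\<close>

lemma circ_closure:
  assumes C: "circ C" and c: "c \<in> C"
  shows "C \<subseteq> E (J (C - {c}))"
proof -
  have n: "nested L H C"
    using C unfolding circ_def by blast
  have n': "nested L H (C - {c})"
    using nested_mono[OF n] by blast
  obtain s where s: "s \<in> C" "s \<in> E (J (C - {s}))"
    using C unfolding circ_def ind_def by blast
  have "c \<in> E (J (C - {c}))"
  proof (cases "s = c")
    case False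
    let ?D = "C - {s, c}"
    have i: "insert s (insert c ?D) = C" "insert c ?D = C - {s}" "insert s ?D = C - {c}"
        "C - {c} - {s} = ?D"
      using s c False by auto
    have "ind (C - {c})"
      using C c unfolding circ_def by blast
    then have "s \<notin> E (J (C - {c} - {s}))"
      using s(1) False unfolding ind_def by blast
    then have "s \<notin> E (J ?D)"
      unfolding i(4) .
    then show ?thesis
      using exchange[of s c ?D] s n unfolding i by (simp add: insert_absorb)
  qed (use s in simp)
  then show ?thesis
    using E_J_sup[OF n'] by blast
qed

lemma circ_nonempty: "circ C \<Longrightarrow> C \<noteq> {}"
  unfolding circ_def ind_def by blast

lemma E_J_empty: "E (J {}) = {}"
proof -
  have n: "nested L H {}"
    unfolding nested_def by auto
  have "ats \<bottom> = {}"
    unfolding ats_def using le_bottom_iff atom_in atom_not_bottom by blast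
  moreover have "\<Squnion>{} = \<bottom>"
    by (rule Sup_eqI) auto
  ultimately show ?thesis
    using E_coord[OF J_coord(1)[OF n]] J_coord(2,3)[OF n] by simp
qed

lemma E_vertex: "g \<in> H \<Longrightarrow> E (v g) = {g}"
proof -
  assume g: "g \<in> H"
  have "ats \<bottom> = {}"
    unfolding ats_def using le_bottom_iff atom_in atom_not_bottom by blast
  then show ?thesis
    using E_coord[OF vertex_coord(1)[OF g]] vertex_coord[OF g] ats_atom by auto
qed

lemma J_single: "g \<in> H \<Longrightarrow> J {g} = v g"
  using J_E[OF vertex_coord(1)] E_vertex by simp

text \<open>Independence of a sequence, tested against predecessors only; this can be built up along
  a chain.\<close>

definition free :: "'a list \<Rightarrow> bool" where
  "free as \<longleftrightarrow> (\<forall>i<length as. as ! i \<notin> E (J (set (take i as))))"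

lemma free_snoc: "free (as @ [a]) \<longleftrightarrow> free as \<and> a \<notin> E (J (set as))"
  unfolding free_def by (auto simp: nth_append less_Suc_eq)

text \<open>Steinitz replacement: each entry of \<open>as\<close> displaces one member of S while
  the closure keeps containing S. In particular, a free list below \<open>J S\<close> has at most
  \<open>card S\<close> entries.\<close>

lemma steinitz:
  assumes S: "nested L H S"
  shows "free as \<Longrightarrow> set as \<subseteq> E (J S)
    \<Longrightarrow> \<exists>S'\<subseteq>S. card S' + length as \<le> card S \<and> S \<subseteq> E (J (set as \<union> S'))"
proof (induction as rule: rev_induct)
  case Nil
  then show ?case
    using E_J_sup[OF S] by (intro exI[of _ S]) auto
next
  case (snoc a as)
  then obtain S' where S': "S' \<subseteq> S" "card S' + length as \<le> card S" "S \<subseteq> E (J (set as \<union> S'))"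
    unfolding free_snoc by auto
  have nE: "nested L H (E (J S))"
    using nested_E[OF J_coord(1)[OF S]] .
  have SE: "S \<subseteq> E (J S)"
    using E_J_sup[OF S] .
  have n: "nested L H W" if "W \<subseteq> E (J S)" for W
    using nested_mono[OF nE that] .
  have as: "insert a (set as) \<subseteq> E (J S)"
    using snoc.prems by auto
  have "a \<in> E (J (set as \<union> S'))"
    using E_J_mono[OF n S'(3)] as S' SE by auto
  \<comment> \<open>W is a smallest part of S' that spans a together with \<open>as\<close>. By
    minimality any s in W can be exchanged for a, and W is nonempty because a is not spanned by
    \<open>as\<close> alone.\<close>
  then have "\<exists>W. W \<subseteq> S' \<and> a \<in> E (J (set as \<union> W)) \<and>
      (\<forall>V. V \<subseteq> S' \<and> a \<in> E (J (set as \<union> V)) \<longrightarrow> card W \<le> card V)"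
    using ex_has_least_nat[of "\<lambda>W. W \<subseteq> S' \<and> a \<in> E (J (set as \<union> W))" S' card] by auto
  then obtain W where W: "W \<subseteq> S'" "a \<in> E (J (set as \<union> W))"
    and min: "\<And>V. V \<subseteq> S' \<Longrightarrow> a \<in> E (J (set as \<union> V)) \<Longrightarrow> card W \<le> card V"
    by blast
  have finS': "finite S'"
    using S' nested_finite[OF S] finite_subset by blast
  have "W \<noteq> {}"
    using W(2) snoc.prems unfolding free_snoc by auto
  then obtain s where s: "s \<in> W" by blast
  have "card (W - {s}) < card W"
    using s W finS' finite_subset by (meson card_Diff1_less)
  then have na: "a \<notin> E (J (set as \<union> (W - {s})))"
    using min[of "W - {s}"] W by fastforce
  let ?D = "set as \<union> (W - {s})"
  have i: "insert s ?D = set as \<union> W"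
    using s by auto
  have sub: "insert a (insert s ?D) \<subseteq> E (J S)"
    unfolding i using as W S' SE by auto
  have "s \<in> E (J (insert a ?D))"
    using exchange[OF n[OF sub]] na W(2) unfolding i by auto
  let ?T = "set (as @ [a]) \<union> (S' - {s})"
  have T: "?T \<subseteq> E (J S)"
    using as S' SE by auto
  have "insert a ?D \<subseteq> ?T"
    using W by auto
  then have "s \<in> E (J ?T)"
    using E_J_mono[OF n[OF T], of "insert a ?D"] E_J_sup[OF n[OF T]] \<open>s \<in> E (J (insert a ?D))\<close>
    by blast
  then have "set as \<union> S' \<subseteq> E (J ?T)"
    using E_J_sup[OF n[OF T]] by auto
  then have "S \<subseteq> E (J ?T)"
    using E_J_mono[OF n[OF T]] S'(3) by blast
  moreover have "card (S' - {s}) + length (as @ [a]) \<le> card S"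
    using S'(2) card_Diff_singleton[of s S'] card_gt_0_iff[of S'] s W finS' by auto
  ultimately show ?case
    using S'(1) by (intro exI[of _ "S' - {s}"]) auto
qed

section \<open>Ranks\<close>

definition chain :: "'a blow \<Rightarrow> 'a blow set \<Rightarrow> bool" where
  "chain y C \<longleftrightarrow> C \<subseteq> carrier P \<and> (\<forall>u\<in>C. u \<sqsubseteq>\<^bsub>P\<^esub> y)
     \<and> (\<forall>a\<in>C. \<forall>b\<in>C. a \<sqsubseteq>\<^bsub>P\<^esub> b \<or> b \<sqsubseteq>\<^bsub>P\<^esub> a)"

abbreviation "rk \<equiv> poset_rank P"

lemma rank_eq: "rk y = Max {card C - 1 | C. chain y C}"
  unfolding poset_rank_def chain_def below_def
  by (rule arg_cong[where f = Max]) auto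

lemma finite_chains: "finite {card C - 1 | C. chain y C}"
proof -
  have "{card C - 1 | C. chain y C} \<subseteq> (\<lambda>C. card C - 1) ` Pow (carrier P)"
    unfolding chain_def by auto
  then show ?thesis
    by (rule finite_subset) (simp add: finite_P)
qed

lemma chain_le_rank: "chain y C \<Longrightarrow> card C - 1 \<le> rk y"
  unfolding rank_eq using finite_chains by (intro Max_ge) auto

lemma chain_rank_exists: "\<exists>C. chain y C \<and> rk y = card C - 1"
proof -
  \<comment> \<open>The empty chain counts as length 0 by truncated subtraction, so
    \<open>Max\<close> is taken over a nonempty set.\<close>
  have "chain y {}"
    unfolding chain_def by auto
  then have "rk y \<in> {card C - 1 | C. chain y C}"
    unfolding rank_eq using finite_chains by (intro Max_in) auto
  then show ?thesis by auto
qed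

text \<open>Each strict step of the chain supplies an element of H outside the closure of the
  previous ones, so n + 1 chain members give n entries.\<close>

lemma free_of_chain:
  assumes "chain y C" "card C = Suc n" "y \<in> carrier P"
  shows "\<exists>as m. m \<in> C \<and> (\<forall>c\<in>C. c \<sqsubseteq>\<^bsub>P\<^esub> m) \<and> length as = n \<and> free as \<and> set as \<subseteq> E m"
  using assms(1,2)
proof (induction n arbitrary: C)
  case 0
  then obtain m where m: "C = {m}"
    by (auto simp: card_1_singleton_iff)
  then show ?case
    using 0 P_refl unfolding chain_def free_def by (intro exI[of _ "[]"] exI[of _ m]) auto
next
  case (Suc n)
  have finC: "finite C"
    using Suc.prems(2) card.infinite by fastforce
  have "\<exists>m\<in>C. \<forall>c\<in>C. c \<sqsubseteq>\<^bsub>P\<^esub> m"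
  proof -
    have "Max ((card \<circ> E) ` C) \<in> (card \<circ> E) ` C"
      using finC Suc.prems by (intro Max_in) auto
    then obtain m where m: "m \<in> C" "Max ((card \<circ> E) ` C) = card (E m)"
      by auto
    have "c \<sqsubseteq>\<^bsub>P\<^esub> m" if c: "c \<in> C" for c
    proof (rule ccontr)
      assume nc: "\<not> c \<sqsubseteq>\<^bsub>P\<^esub> m"
      have car: "c \<in> carrier P" "m \<in> carrier P"
        using c m Suc.prems unfolding chain_def by auto
      have mc: "m \<sqsubseteq>\<^bsub>P\<^esub> c"
        using nc c m Suc.prems unfolding chain_def by blast
      have "card (E c) \<le> card (E m)"
        unfolding m(2)[symmetric] using finC c by (intro Max_ge) auto
      then have "E m = E c"
        using E_mono[OF mc] car card_seteq[of "E c" "E m"] finite_subset[OF E_sub finite_H] by blast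
      then show False
        using E_inj[OF car(2,1)] nc P_refl[OF car(1)] by simp
    qed
    then show ?thesis
      using m by blast
  qed
  then obtain m where m: "m \<in> C" "\<forall>c\<in>C. c \<sqsubseteq>\<^bsub>P\<^esub> m" by blast
  have "chain y (C - {m})" "card (C - {m}) = Suc n"
    using Suc.prems m finC unfolding chain_def by auto
  then obtain as k where k: "k \<in> C - {m}" "length as = n" "free as" "set as \<subseteq> E k"
    using Suc.IH by blast
  have car: "k \<in> carrier P" "m \<in> carrier P"
    using k m Suc.prems unfolding chain_def by auto
  have "E k \<subseteq> E m" "E k \<noteq> E m"
    using E_mono[of k m] E_inj[of k m] car k m by auto
  then obtain a where a: "a \<in> E m" "a \<notin> E k" by blast
  have "J (E k) = k"
    using J_E car by blast
  then have "E (J (set as)) \<subseteq> E k"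
    using E_J_mono[OF nested_E[OF car(1)], of "set as"] k(4) by simp
  then have "free (as @ [a])"
    unfolding free_snoc using k a by blast
  then show ?case
    using k a m \<open>E k \<subseteq> E m\<close> by (intro exI[of _ "as @ [a]"] exI[of _ m]) auto
qed

lemma rank_J_le:
  assumes S: "nested L H S"
  shows "rk (J S) \<le> card S"
proof -
  obtain C where C: "chain (J S) C" "rk (J S) = card C - 1"
    using chain_rank_exists by blast
  show ?thesis
  proof (cases "card C")
    case (Suc n)
    then obtain as m where as: "m \<in> C" "length as = n" "free as" "set as \<subseteq> E m"
      using free_of_chain[OF C(1) Suc J_coord(1)[OF S]] by blast
    have "E m \<subseteq> E (J S)"
      using E_mono as(1) C(1) J_coord(1)[OF S] unfolding chain_def by blast
    then show ?thesis
      using steinitz[OF S as(3)] as C(2) Suc by fastforce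
  qed (use C in simp)
qed

text \<open>The joins of the initial segments of an enumeration of S form a strict chain with
  \<open>card S + 1\<close> members. If its top \<open>J S\<close> were different from y, then y
  could be added to the chain, which is impossible when \<open>card S\<close> is already the
  rank.\<close>

lemma ind_le_rank:
  assumes S: "ind S" "S \<subseteq> E y" and y: "y \<in> carrier P"
  shows "card S \<le> rk y" "card S = rk y \<Longrightarrow> J S = y"
proof -
  have n: "nested L H S"
    using S unfolding ind_def by blast
  obtain xs where xs: "set xs = S" "distinct xs"
    using finite_distinct_list[OF nested_finite[OF n]] by blast
  define f where "f i = J (set (take i xs))" for i
  have sub: "set (take i xs) \<subseteq> S" for i
    using xs set_take_subset by fastforce
  have ni: "nested L H (set (take i xs))" for i
    using nested_mono[OF n sub] .
  have fP: "f i \<in> carrier P" for i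
    unfolding f_def using J_coord(1)[OF ni] .
  have mono: "f i \<sqsubseteq>\<^bsub>P\<^esub> f k" if "i \<le> k" for i k
  proof -
    have "set (take i xs) \<subseteq> set (take k xs)"
      using that by (rule set_take_subset_set_take)
    then show ?thesis
      unfolding f_def J_le_iff[OF ni J_coord(1)[OF ni]] using E_J_sup[OF ni, of k] by blast
  qed
  have fy: "f i \<sqsubseteq>\<^bsub>P\<^esub> y" for i
    unfolding f_def using J_le_iff[OF ni y] sub S(2) by blast
  have neq: "f i \<noteq> f k" if "i < k" "k \<le> length xs" for i k
  proof
    assume e: "f i = f k"
    have i: "i < length xs"
      using that by auto
    have "xs ! i \<in> set (take k xs)"
      using that i by (auto simp: in_set_conv_nth intro!: exI[of _ i])
    then have "xs ! i \<in> E (J (set (take i xs)))"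
      using E_J_sup[OF ni, of k] e unfolding f_def by auto
    moreover have "set (take i xs) \<subseteq> S - {xs ! i}"
    proof -
      have "xs ! i \<notin> set (take i xs)"
        using xs(2) i by (auto simp: in_set_conv_nth nth_eq_iff_index_eq)
      then show ?thesis using sub by auto
    qed
    moreover have n2: "nested L H (S - {xs ! i})"
      using nested_mono[OF n] by blast
    ultimately have "xs ! i \<in> E (J (S - {xs ! i}))"
      using E_J_mono[OF n2] E_J_sup[OF n2] by blast
    moreover have "xs ! i \<in> S"
      using i xs by auto
    ultimately show False
      using S(1) unfolding ind_def by blast
  qed
  let ?C = "f ` {..length xs}"
  have len: "length xs = card S"
    using xs distinct_card by fastforce
  have "inj_on f {..length xs}"
    by (rule linorder_inj_onI) (use neq in auto)
  then have cC: "card ?C = Suc (card S)"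
    using card_image[of f] len by simp
  have comp: "f i \<sqsubseteq>\<^bsub>P\<^esub> f k \<or> f k \<sqsubseteq>\<^bsub>P\<^esub> f i" for i k
    using mono[of i k] mono[of k i] by linarith
  have C: "chain y ?C"
    unfolding chain_def using fP fy comp by auto
  then show "card S \<le> rk y"
    using chain_le_rank[OF C] cC by simp
  show "J S = y" if eq: "card S = rk y"
  proof (rule ccontr)
    assume "J S \<noteq> y"
    have fl: "f (length xs) = J S"
      unfolding f_def using xs by simp
    have "y \<notin> ?C"
    proof
      assume "y \<in> ?C"
      then obtain i where i: "i \<le> length xs" "y = f i" by auto
      then have "y = f (length xs)"
        using mono[of i "length xs"] fy[of "length xs"] P_antisym fP y by auto
      then show False
        using fl \<open>J S \<noteq> y\<close> by simp
    qed
    then have "card (insert y ?C) = Suc (Suc (card S))"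
      using cC by simp
    moreover have "chain y (insert y ?C)"
      using C y P_refl[OF y] unfolding chain_def by blast
    ultimately show False
      using chain_le_rank[of y "insert y ?C"] eq by simp
  qed
qed

lemma ind_rank: "ind S \<Longrightarrow> rk (J S) = card S"
  using rank_J_le[of S] ind_le_rank(1)[of S "J S"] E_J_sup[of S] J_coord(1)[of S]
  unfolding ind_def by force

section \<open>Translation to the given notions\<close>

text \<open>The interval is an order of its own with its own choice of joins. The join of a set of
  atoms below y stays below y, so it is the same as in P.\<close>

lemma sup_below:
  assumes y: "y \<in> carrier P" and S: "S \<subseteq> E y"
  shows "\<Squnion>\<^bsub>below P y\<^esub> (v ` S) = J S"
proof (rule sup_eqI)
  have n: "nested L H S"
    using nested_mono[OF nested_E[OF y] S] .
  have SH: "S \<subseteq> H"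
    using S E_sub by blast
  have le: "le (below P y) = le P" and car: "carrier (below P y) = {u \<in> carrier P. u \<sqsubseteq>\<^bsub>P\<^esub> y}"
    unfolding below_def by auto
  show "J S \<in> carrier (below P y)"
    unfolding car using J_coord(1)[OF n] J_le_iff[OF n y] S by auto
  show "v ` S \<subseteq> carrier (below P y)"
    unfolding car using S vertex_coord(1) unfolding E_def by auto
  show "J S \<sqsubseteq>\<^bsub>below P y\<^esub> z \<longleftrightarrow> (\<forall>a\<in>v ` S. a \<sqsubseteq>\<^bsub>below P y\<^esub> z)"
    if "z \<in> carrier (below P y)" for z
    using J_le_iff[OF n, of z] that SH unfolding le car E_def by auto
  show "J S \<sqsubseteq>\<^bsub>below P y\<^esub> J S"
    unfolding le using P_refl J_coord(1)[OF n] by blast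
  show "u = w" if "u \<in> carrier (below P y)" "w \<in> carrier (below P y)"
    "u \<sqsubseteq>\<^bsub>below P y\<^esub> w" "w \<sqsubseteq>\<^bsub>below P y\<^esub> u" for u w
    using that P_antisym unfolding le car by auto
qed

lemma atoms_below:
  assumes y: "y \<in> carrier P"
  shows "atoms (below P y) = v ` E y"
proof -
  have le: "le (below P y) = le P" and car: "carrier (below P y) = {u \<in> carrier P. u \<sqsubseteq>\<^bsub>P\<^esub> y}"
    and eq: "eq (below P y) = (=)"
    using eq_P unfolding below_def by auto
  \<comment> \<open>Every element bounds the empty set, so the definition of the bottom element
    coincides with that of the empty join.\<close>
  have b: "\<bottom>\<^bsub>below P y\<^esub> = J {}"
    using sup_below[OF y, of "{}"] unfolding bottom_def sup_def by simp
  have n0: "nested L H {}"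
    unfolding nested_def by auto
  have bP: "J {} \<in> carrier P" "\<And>z. z \<in> carrier P \<Longrightarrow> J {} \<sqsubseteq>\<^bsub>P\<^esub> z"
    using J_coord(1)[OF n0] J_le_iff[OF n0] by auto
  have Ene: "E z \<noteq> {}" if "z \<in> carrier P" "z \<noteq> J {}" for z
    using that J_E[of z] by auto
  have atom_iff: "z \<in> atoms (below P y) \<longleftrightarrow> z \<in> carrier P \<and> z \<sqsubseteq>\<^bsub>P\<^esub> y \<and> z \<noteq> J {}
      \<and> (\<forall>w\<in>carrier P. w \<sqsubseteq>\<^bsub>P\<^esub> y \<longrightarrow> w \<sqsubseteq>\<^bsub>P\<^esub> z \<longrightarrow> w = J {} \<or> w = z)" for z
    unfolding atoms_def covered_by_def lless_def b using bP by (auto simp: le car eq)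
  show ?thesis
  proof (intro equalityI subsetI)
    fix z assume z: "z \<in> atoms (below P y)"
    then have zP: "z \<in> carrier P" "z \<sqsubseteq>\<^bsub>P\<^esub> y" "z \<noteq> J {}"
      unfolding atom_iff by auto
    obtain g where g: "g \<in> E z"
      using Ene[OF zP(1,3)] by blast
    then have gH: "g \<in> H" "v g \<sqsubseteq>\<^bsub>P\<^esub> z"
      unfolding E_def by auto
    have "g \<in> E y"
      using g E_mono[OF zP(2)] zP y by blast
    moreover have "v g \<noteq> J {}"
      using E_vertex[OF gH(1)] E_J_empty by auto
    ultimately have "v g = z"
      using z gH vertex_coord(1)[OF gH(1)] unfolding atom_iff E_def by auto
    then show "z \<in> v ` E y"
      using \<open>g \<in> E y\<close> by blast
  next
    fix z assume "z \<in> v ` E y"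
    then obtain g where g: "g \<in> E y" "z = v g" by blast
    then have gH: "g \<in> H" "v g \<sqsubseteq>\<^bsub>P\<^esub> y"
      unfolding E_def by auto
    have "w = J {} \<or> w = z" if w: "w \<in> carrier P" "w \<sqsubseteq>\<^bsub>P\<^esub> z" for w
    proof -
      have "E w \<subseteq> {g}"
        using E_mono[OF w(2) w(1)] vertex_coord(1)[OF gH(1)] E_vertex[OF gH(1)] g(2) by simp
      then have "E w = {} \<or> E w = {g}" by blast
      then show ?thesis
        using J_E[OF w(1)] J_single[OF gH(1)] g(2) by auto
    qed
    moreover have "z \<noteq> J {}"
      using E_vertex[OF gH(1)] E_J_empty g(2) by auto
    ultimately show "z \<in> atoms (below P y)"
      unfolding atom_iff using vertex_coord(1)[OF gH(1)] gH g(2) by auto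
  qed
qed

lemma lattice_indep_iff:
  assumes y: "y \<in> carrier P" and S: "S \<subseteq> E y"
  shows "lattice_indep (below P y) (v ` S) \<longleftrightarrow> ind S"
proof -
  have n: "nested L H S"
    using nested_mono[OF nested_E[OF y] S] .
  have SH: "S \<subseteq> H"
    using S E_sub by blast
  have le: "le (below P y) = le P"
    unfolding below_def by auto
  have s: "v ` S - {v s} = v ` (S - {s})" for s
    using inj_v by (auto simp: inj_def)
  have "\<Squnion>\<^bsub>below P y\<^esub> (v ` S - {v s}) = J (S - {s})" for s
    unfolding s using sup_below[OF y, of "S - {s}"] S by blast
  then show ?thesis
    unfolding lattice_indep_def ind_def atoms_below[OF y] using S n SH
    by (auto simp: le E_def image_subset_iff subset_iff)
qed

text \<open>The right-hand side does not mention y, so a set is a circuit in one lower interval iff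
  it is one in every interval that contains it. This is why the relations of type \<partial>e
  restrict to the relations of every \<open>OS\<close> below y.\<close>

lemma lattice_circuit_iff:
  assumes y: "y \<in> carrier P" and C: "C \<subseteq> E y"
  shows "lattice_circuit (below P y) (v ` C) \<longleftrightarrow> circ C"
proof -
  have n: "nested L H C"
    using nested_mono[OF nested_E[OF y] C] .
  have "(\<forall>D. D \<subset> v ` C \<longrightarrow> lattice_indep (below P y) D) \<longleftrightarrow> (\<forall>D. D \<subset> C \<longrightarrow> ind D)"
  proof
    assume l: "\<forall>D. D \<subset> v ` C \<longrightarrow> lattice_indep (below P y) D"
    show "\<forall>D. D \<subset> C \<longrightarrow> ind D"
    proof (intro allI impI)
      fix D assume D: "D \<subset> C"
      then have "v ` D \<subset> v ` C"
        using inj_v by (metis inj_image_subset_iff psubset_eq inj_image_eq_iff)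
      then show "ind D"
        using l lattice_indep_iff[OF y, of D] D C by blast
    qed
  next
    assume l: "\<forall>D. D \<subset> C \<longrightarrow> ind D"
    show "\<forall>D. D \<subset> v ` C \<longrightarrow> lattice_indep (below P y) D"
    proof (intro allI impI)
      fix D assume D: "D \<subset> v ` C"
      then obtain D' where D': "D = v ` D'" "D' \<subseteq> C"
        by (meson psubset_imp_subset subset_imageE)
      then have "D' \<subset> C"
        using D by blast
      then show "lattice_indep (below P y) D"
        using l lattice_indep_iff[OF y, of D'] D' C by blast
    qed
  qed
  then show ?thesis
    unfolding lattice_circuit_def circ_def atoms_below[OF y] using lattice_indep_iff[OF y C] n C by blast
qed

lemma lattice_circuit_below:
  assumes y: "y \<in> carrier P" and C: "lattice_circuit (below P y) C"
  obtains C' where "C = v ` C'" "C' \<subseteq> E y" "circ C'"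
proof -
  have "C \<subseteq> v ` E y"
    using C atoms_below[OF y] unfolding lattice_circuit_def by blast
  then obtain C' where C': "C' \<subseteq> E y" "C = v ` C'"
    by (meson subset_imageE)
  then show ?thesis
    using that lattice_circuit_iff[OF y C'(1)] C by blast
qed

lemma nested_circuit_iff: "nested_circuit L H r C \<longleftrightarrow> circ C"
proof (cases "nested L H C")
  case True
  then show ?thesis
    unfolding nested_circuit_def using lattice_circuit_iff[OF J_coord(1)[OF True] E_J_sup[OF True]] by blast
qed (auto simp: nested_circuit_def circ_def)

lemma nested_rep_props:
  assumes y: "y \<in> carrier P"
  shows "nested L H (nested_rep L H r y)" "J (nested_rep L H r y) = y"
proof -
  have "nested L H (nested_rep L H r y) \<and> J (nested_rep L H r y) = y"
    unfolding nested_rep_def by (rule someI[of _ "E y"]) (use nested_E J_E y in blast)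
  then show "nested L H (nested_rep L H r y)" "J (nested_rep L H r y) = y" by auto
qed

text \<open>Nested means bounded, and sets with the same join have the same upper bounds. Hence the
  ideal of DP_y is the same for all S with join y.\<close>

lemma nested_Un_iff:
  assumes "nested L H S" "nested L H S'" "J S = J S'" "T \<subseteq> H"
  shows "nested L H (S \<union> T) \<longleftrightarrow> nested L H (S' \<union> T)"
proof -
  have "nested L H (B \<union> T)" if n: "nested L H (A \<union> T)" and A: "nested L H A" "nested L H B" "J A = J B" for A B
  proof -
    have "A \<subseteq> E (J (A \<union> T))"
      using E_J_sup[OF n] by blast
    then have "E (J A) \<subseteq> E (J (A \<union> T))"
      using E_J_mono[OF n] by blast
    then have "B \<union> T \<subseteq> E (J (A \<union> T))"
      using E_J_sup[OF A(2)] E_J_sup[OF n] A(3) by auto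
    then show ?thesis
      using nested_mono[OF nested_E[OF J_coord(1)[OF n]]] by blast
  qed
  then show ?thesis
    using assms by metis
qed

end


section \<open>Ideals and cosets\<close>

lemma (in ideal) coset_eq_iff:
  assumes "x \<in> carrier R" "y \<in> carrier R"
  shows "I +> x = I +> y \<longleftrightarrow> x \<ominus> y \<in> I"
proof
  assume "I +> x = I +> y"
  then have "x \<in> I +> y"
    using a_rcos_self[OF assms(1)] by simp
  then show "x \<ominus> y \<in> I"
    using a_rcos_module_minus[of y x] assms ring_axioms by simp
next
  assume "x \<ominus> y \<in> I"
  then have "x \<in> I +> y"
    using a_rcos_module_minus[of y x] assms ring_axioms by simp
  then show "I +> x = I +> y"
    using a_repr_independence' assms by simp
qed

lemma carrier_Quot: "carrier (R Quot I) = (\<lambda>x. I +>\<^bsub>R\<^esub> x) ` carrier R"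
  unfolding FactRing_def A_RCOSETS_def' by auto

lemma add_Quot: "add (R Quot I) = set_add R" and mult_Quot: "mult (R Quot I) = rcoset_mult R I"
  and zero_Quot: "zero (R Quot I) = I"
  unfolding FactRing_def by auto

lemma coset_map_eqI:
  fixes R :: "'m ring" (structure)
  assumes "ideal I R" "f \<in> F" "\<And>g. g \<in> F \<Longrightarrow> h g \<in> carrier R \<and> h g \<ominus> h f \<in> I"
  shows "coset_map R I h F = I +> h f"
proof -
  have "I +> h g = I +> h f" if "g \<in> F" for g
    using ideal.coset_eq_iff[OF assms(1), of "h g" "h f"] assms(3)[OF that] assms(3)[OF assms(2)]
    by simp
  then have "(\<Union>g\<in>F. I +> h g) = (\<Union>g\<in>F. I +> h f)"
    by (rule SUP_cong[OF refl])
  moreover have "F \<noteq> {}"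
    using assms(2) by blast
  ultimately show ?thesis
    unfolding coset_map_def by (simp only: UN_constant if_False)
qed

section \<open>The exterior algebra\<close>

text \<open>The product of \<open>ext_alg\<close> without its carrier, so that its algebraic
  identities hold for arbitrary functions.\<close>

definition xmul :: "('e \<times> 'e) set \<Rightarrow> ('e set \<Rightarrow> 'c) \<Rightarrow> ('e set \<Rightarrow> 'c) \<Rightarrow> 'e set \<Rightarrow> 'c::comm_ring_1" where
  "xmul r f g U = (\<Sum>S\<in>Pow U. shuffle_sign r S (U - S) * f S * g (U - S))"

text \<open>Covers both kinds of coefficients: \<open>polys H\<close> for the bigraded algebras and
  all rationals for \<open>OS\<close>.\<close>

definition subring_set :: "'c::comm_ring_1 set \<Rightarrow> bool" where
  "subring_set A \<longleftrightarrow> 1 \<in> A \<and> (\<forall>a\<in>A. \<forall>b\<in>A. a + b \<in> A \<and> a * b \<in> A) \<and> (\<forall>a\<in>A. - a \<in> A)"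

lemma subring_setD:
  assumes "subring_set A"
  shows "1 \<in> A" "0 \<in> A" "\<And>a b. a \<in> A \<Longrightarrow> b \<in> A \<Longrightarrow> a + b \<in> A"
    "\<And>a b. a \<in> A \<Longrightarrow> b \<in> A \<Longrightarrow> a * b \<in> A" "\<And>a. a \<in> A \<Longrightarrow> - a \<in> A"
    "\<And>a b. a \<in> A \<Longrightarrow> b \<in> A \<Longrightarrow> a - b \<in> A"
    "\<And>n a. a \<in> A \<Longrightarrow> a ^ n \<in> A" "\<And>f K. (\<And>k. k \<in> K \<Longrightarrow> f k \<in> A) \<Longrightarrow> sum f K \<in> A"
proof -
  show 1: "1 \<in> A" and add: "\<And>a b. a \<in> A \<Longrightarrow> b \<in> A \<Longrightarrow> a + b \<in> A"
    and mul: "\<And>a b. a \<in> A \<Longrightarrow> b \<in> A \<Longrightarrow> a * b \<in> A" and neg: "\<And>a. a \<in> A \<Longrightarrow> - a \<in> A"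
    using assms unfolding subring_set_def by auto
  show 0: "0 \<in> A"
    using add[OF 1 neg[OF 1]] by simp
  show "a - b \<in> A" if "a \<in> A" "b \<in> A" for a b
    using add[OF that(1) neg[OF that(2)]] by simp
  show "a ^ n \<in> A" if "a \<in> A" for n a
    using that 1 mul by (induction n) auto
  show "sum f K \<in> A" if "\<And>k. k \<in> K \<Longrightarrow> f k \<in> A" for f K
    using that 0 add by (induction K rule: infinite_finite_induct) auto
qed

lemma subring_set_UNIV: "subring_set UNIV"
  unfolding subring_set_def by auto

lemma shuffle_sign_in: "subring_set A \<Longrightarrow> shuffle_sign r S T \<in> A"
  unfolding shuffle_sign_def by (intro subring_setD(7) subring_setD(5) subring_setD(1))

lemma ext_alg_simps:
  "carrier (ext_alg r E A) = {f. (\<forall>S. f S \<in> A) \<and> (\<forall>S. f S \<noteq> 0 \<longrightarrow> S \<subseteq> E)}"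
  "mult (ext_alg r E A) = xmul r" "one (ext_alg r E A) = ext_single {} 1"
  "zero (ext_alg r E A) = (\<lambda>S. 0)" "add (ext_alg r E A) = (\<lambda>f g S. f S + g S)"
  unfolding ext_alg_def xmul_def ext_single_def by (auto simp: fun_eq_iff)

lemma shuffle_sign_Un1:
  assumes "finite A" "finite B" "finite C" "A \<inter> B = {}"
  shows "shuffle_sign r (A \<union> B) C = shuffle_sign r A C * shuffle_sign r B C"
proof -
  have "{(s, t). s \<in> A \<union> B \<and> t \<in> C \<and> (t, s) \<in> r}
      = {(s, t). s \<in> A \<and> t \<in> C \<and> (t, s) \<in> r} \<union> {(s, t). s \<in> B \<and> t \<in> C \<and> (t, s) \<in> r}"
    by auto
  moreover have "finite {(s, t). s \<in> A \<and> t \<in> C \<and> (t, s) \<in> r}"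
    by (rule finite_subset[of _ "A \<times> C"]) (use assms in auto)
  moreover have "finite {(s, t). s \<in> B \<and> t \<in> C \<and> (t, s) \<in> r}"
    by (rule finite_subset[of _ "B \<times> C"]) (use assms in auto)
  moreover have "{(s, t). s \<in> A \<and> t \<in> C \<and> (t, s) \<in> r} \<inter> {(s, t). s \<in> B \<and> t \<in> C \<and> (t, s) \<in> r} = {}"
    using assms by auto
  ultimately have "card {(s, t). s \<in> A \<union> B \<and> t \<in> C \<and> (t, s) \<in> r} =
      card {(s, t). s \<in> A \<and> t \<in> C \<and> (t, s) \<in> r} + card {(s, t). s \<in> B \<and> t \<in> C \<and> (t, s) \<in> r}"
    by (simp add: card_Un_disjoint)
  then show ?thesis
    unfolding shuffle_sign_def by (simp add: power_add)
qed

lemma shuffle_sign_Un2: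
  assumes "finite A" "finite B" "finite C" "B \<inter> C = {}"
  shows "shuffle_sign r A (B \<union> C) = shuffle_sign r A B * shuffle_sign r A C"
proof -
  have "{(s, t). s \<in> A \<and> t \<in> B \<union> C \<and> (t, s) \<in> r}
      = {(s, t). s \<in> A \<and> t \<in> B \<and> (t, s) \<in> r} \<union> {(s, t). s \<in> A \<and> t \<in> C \<and> (t, s) \<in> r}"
    by auto
  moreover have "finite {(s, t). s \<in> A \<and> t \<in> B \<and> (t, s) \<in> r}"
    by (rule finite_subset[of _ "A \<times> B"]) (use assms in auto)
  moreover have "finite {(s, t). s \<in> A \<and> t \<in> C \<and> (t, s) \<in> r}"
    by (rule finite_subset[of _ "A \<times> C"]) (use assms in auto)
  moreover have "{(s, t). s \<in> A \<and> t \<in> B \<and> (t, s) \<in> r} \<inter> {(s, t). s \<in> A \<and> t \<in> C \<and> (t, s) \<in> r} = {}"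
    using assms by auto
  ultimately have "card {(s, t). s \<in> A \<and> t \<in> B \<union> C \<and> (t, s) \<in> r} =
      card {(s, t). s \<in> A \<and> t \<in> B \<and> (t, s) \<in> r} + card {(s, t). s \<in> A \<and> t \<in> C \<and> (t, s) \<in> r}"
    by (simp add: card_Un_disjoint)
  then show ?thesis
    unfolding shuffle_sign_def by (simp add: power_add)
qed

lemma shuffle_sign_empty [simp]: "shuffle_sign r {} T = 1" "shuffle_sign r T {} = 1"
  unfolding shuffle_sign_def by auto

lemma shuffle_sign_sq: "shuffle_sign r S T * shuffle_sign r S T = 1"
  unfolding shuffle_sign_def by (simp flip: power_add power_mult_distrib)

text \<open>Both sides sum over the ordered splittings of U into three blocks, and the signs agree
  because \<open>shuffle_sign\<close> is multiplicative over disjoint unions in each argument. On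
  infinite U both sides are 0.\<close>

lemma xmul_assoc: "xmul r (xmul r f g) h U = xmul r f (xmul r g h) U"
proof (cases "finite U")
  case True
  let ?s = "shuffle_sign r"
  have "xmul r (xmul r f g) h U
      = (\<Sum>V\<in>Pow U. \<Sum>S\<in>Pow V. ?s V (U - V) * (?s S (V - S) * f S * g (V - S)) * h (U - V))"
    unfolding xmul_def by (simp add: sum_distrib_left sum_distrib_right)
  also have "\<dots> = (\<Sum>(V, S)\<in>Sigma (Pow U) Pow.
      ?s V (U - V) * (?s S (V - S) * f S * g (V - S)) * h (U - V))"
    using True by (subst sum.Sigma) (auto intro: finite_subset)
  also have "\<dots> = (\<Sum>(S, T)\<in>Sigma (Pow U) (\<lambda>S. Pow (U - S)).
      ?s S (U - S) * f S * (?s T (U - S - T) * g T * h (U - S - T)))"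
  proof (rule sum.reindex_bij_witness[of _ "\<lambda>(S, T). (S \<union> T, S)" "\<lambda>(V, S). (S, V - S)"])
    fix a assume "a \<in> Sigma (Pow U) Pow"
    then obtain V S where a: "a = (V, S)" "V \<subseteq> U" "S \<subseteq> V" by auto
    have fin: "finite S" "finite (V - S)" "finite (U - V)"
      using finite_subset[OF _ True] a by blast+
    have e: "U - S - (V - S) = U - V" "S \<union> (V - S) = V" "(V - S) \<union> (U - V) = U - S"
      using a by auto
    have s1: "?s V (U - V) = ?s S (U - V) * ?s (V - S) (U - V)"
      using shuffle_sign_Un1[OF fin, of r] unfolding e(2) by blast
    have "(V - S) \<inter> (U - V) = {}"
      by auto
    then have s2: "?s S (U - S) = ?s S (V - S) * ?s S (U - V)"
      using shuffle_sign_Un2[OF fin, of r] unfolding e(3) by blast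
    show "(case case a of (V, S) \<Rightarrow> (S, V - S) of (S, T) \<Rightarrow>
        ?s S (U - S) * f S * (?s T (U - S - T) * g T * h (U - S - T)))
      = (case a of (V, S) \<Rightarrow> ?s V (U - V) * (?s S (V - S) * f S * g (V - S)) * h (U - V))"
      unfolding a(1) prod.case e(1) s1 s2 by (simp only: ac_simps)
  qed auto
  also have "\<dots> = (\<Sum>S\<in>Pow U. \<Sum>T\<in>Pow (U - S).
      ?s S (U - S) * f S * (?s T (U - S - T) * g T * h (U - S - T)))"
    using True by (subst sum.Sigma) (auto intro: finite_subset)
  also have "\<dots> = xmul r f (xmul r g h) U"
    unfolding xmul_def by (simp add: sum_distrib_left sum_distrib_right)
  finally show ?thesis .
qed (simp add: xmul_def finite_Pow_iff)

lemma xmul_single_left: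
  assumes "finite U"
  shows "xmul r (ext_single S a) g U = (if S \<subseteq> U then shuffle_sign r S (U - S) * a * g (U - S) else 0)"
proof -
  have "xmul r (ext_single S a) g U
      = (\<Sum>V\<in>Pow U. if V = S then shuffle_sign r S (U - S) * a * g (U - S) else 0)"
    unfolding xmul_def ext_single_def by (rule sum.cong) auto
  then show ?thesis
    using assms by (simp add: sum.delta)
qed

lemma xmul_single_right:
  assumes "finite U"
  shows "xmul r g (ext_single T b) U = (if T \<subseteq> U then shuffle_sign r (U - T) T * g (U - T) * b else 0)"
proof -
  have "xmul r g (ext_single T b) U
      = (\<Sum>V\<in>Pow U. if V = U - T then (if T \<subseteq> U then shuffle_sign r (U - T) T * g (U - T) * b else 0) else 0)"
    unfolding xmul_def ext_single_def by (rule sum.cong) (auto simp: double_diff)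
  then show ?thesis
    using assms by (simp add: sum.delta)
qed

lemma xmul_infinite: "infinite U \<Longrightarrow> xmul r f g U = 0"
  unfolding xmul_def by (simp add: finite_Pow_iff)

lemma xmul_single_single:
  assumes "finite S" "finite T"
  shows "xmul r (ext_single S a) (ext_single T b)
    = (if S \<inter> T = {} then ext_single (S \<union> T) (shuffle_sign r S T * a * b) else (\<lambda>_. 0))"
proof
  fix U
  show "xmul r (ext_single S a) (ext_single T b) U
    = (if S \<inter> T = {} then ext_single (S \<union> T) (shuffle_sign r S T * a * b) else (\<lambda>_. 0)) U"
  proof (cases "finite U")
    case True
    have "S \<subseteq> U \<and> U - S = T \<longleftrightarrow> S \<inter> T = {} \<and> U = S \<union> T"
      by auto
    then show ?thesis
      unfolding xmul_single_left[OF True] by (auto simp: ext_single_def)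
  next
    case False
    then have "U \<noteq> S \<union> T"
      using assms by auto
    then show ?thesis
      using xmul_infinite[OF False] by (simp add: ext_single_def)
  qed
qed

lemma xmul_one_left: "finite E \<Longrightarrow> (\<And>S. f S \<noteq> 0 \<Longrightarrow> S \<subseteq> E) \<Longrightarrow> xmul r (ext_single {} 1) f = f"
  and xmul_one_right: "finite E \<Longrightarrow> (\<And>S. f S \<noteq> 0 \<Longrightarrow> S \<subseteq> E) \<Longrightarrow> xmul r f (ext_single {} 1) = f"
proof -
  assume E: "finite E" "\<And>S. f S \<noteq> 0 \<Longrightarrow> S \<subseteq> E"
  have "f U = 0" if "infinite U" for U
    using E that finite_subset by blast
  then have "xmul r (ext_single {} 1) f U = f U \<and> xmul r f (ext_single {} 1) U = f U" for U
    by (cases "finite U") (auto simp: xmul_single_left xmul_single_right xmul_infinite)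
  then show "xmul r (ext_single {} 1) f = f" "xmul r f (ext_single {} 1) = f"
    by auto
qed

lemma xmul_add_left: "xmul r (\<lambda>S. f S + g S) h U = xmul r f h U + xmul r g h U"
  and xmul_add_right: "xmul r h (\<lambda>S. f S + g S) U = xmul r h f U + xmul r h g U"
  and xmul_zero_left [simp]: "xmul r (\<lambda>S. 0) h U = 0"
  and xmul_zero_right [simp]: "xmul r h (\<lambda>S. 0) U = 0"
  and xmul_scale_left: "xmul r (\<lambda>S. c * f S) h U = c * xmul r f h U"
  and xmul_scale_right: "xmul r h (\<lambda>S. c * f S) U = c * xmul r h f U"
  unfolding xmul_def
  by (simp_all add: sum.distrib sum_subtractf sum_distrib_left algebra_simps)

lemma xmul_zero_fun [simp]: "xmul r (\<lambda>S. 0) h = (\<lambda>S. 0)" "xmul r h (\<lambda>S. 0) = (\<lambda>S. 0)"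
  by (rule ext, simp)+

lemma xmul_add_fun: "xmul r (\<lambda>S. f S + g S) h = (\<lambda>U. xmul r f h U + xmul r g h U)"
  "xmul r h (\<lambda>S. f S + g S) = (\<lambda>U. xmul r h f U + xmul r h g U)"
  by (rule ext, simp add: xmul_add_left xmul_add_right)+

lemma xmul_nonzero:
  assumes "xmul r f g U \<noteq> 0"
  shows "\<exists>S\<subseteq>U. f S \<noteq> 0 \<and> g (U - S) \<noteq> 0"
proof (rule ccontr)
  assume "\<not> ?thesis"
  then have "xmul r f g U = (\<Sum>S\<in>Pow U. 0)"
    unfolding xmul_def by (intro sum.cong) auto
  then show False using assms by simp
qed

lemma xmul_closed:
  assumes A: "subring_set A" and f: "f \<in> carrier (ext_alg r E A)" and g: "g \<in> carrier (ext_alg r E A)"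
  shows "xmul r f g \<in> carrier (ext_alg r E A)"
proof -
  have "U \<subseteq> E" if nz: "xmul r f g U \<noteq> 0" for U
  proof -
    obtain S where S: "S \<subseteq> U" "f S \<noteq> 0" "g (U - S) \<noteq> 0"
      using xmul_nonzero[OF nz] by blast
    then have "S \<subseteq> E" "U - S \<subseteq> E"
      using f g unfolding ext_alg_simps by auto
    then show ?thesis by blast
  qed
  moreover have "xmul r f g U \<in> A" for U
    unfolding xmul_def using f g unfolding ext_alg_simps
    by (intro subring_setD(8)[OF A] subring_setD(4)[OF A] shuffle_sign_in[OF A]) auto
  ultimately show ?thesis
    unfolding ext_alg_simps by auto
qed

lemma ring_ext_alg:
  assumes E: "finite E" and A: "subring_set A"
  shows "ring (ext_alg r E A)"
proof (rule ringI)
  note D = subring_setD[OF A]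
  show "abelian_group (ext_alg r E A)"
  proof (rule abelian_groupI)
    fix x assume x: "x \<in> carrier (ext_alg r E A)"
    have "(\<lambda>S. - x S) \<in> carrier (ext_alg r E A)"
      using x D(5) unfolding ext_alg_simps by auto
    moreover have "(\<lambda>S. - x S) \<oplus>\<^bsub>ext_alg r E A\<^esub> x = \<zero>\<^bsub>ext_alg r E A\<^esub>"
      unfolding ext_alg_simps by auto
    ultimately show "\<exists>y\<in>carrier (ext_alg r E A). y \<oplus>\<^bsub>ext_alg r E A\<^esub> x = \<zero>\<^bsub>ext_alg r E A\<^esub>"
      by blast
  next
    fix x y assume "x \<in> carrier (ext_alg r E A)" "y \<in> carrier (ext_alg r E A)"
    then show "x \<oplus>\<^bsub>ext_alg r E A\<^esub> y \<in> carrier (ext_alg r E A)"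
      using D(3) unfolding ext_alg_simps by (auto, metis add.right_neutral in_mono)
  qed (use D(2) in \<open>auto simp: ext_alg_simps algebra_simps\<close>)
  show "Group.monoid (ext_alg r E A)"
  proof (rule monoidI)
    show "\<one>\<^bsub>ext_alg r E A\<^esub> \<in> carrier (ext_alg r E A)"
      using D(1,2) unfolding ext_alg_simps ext_single_def by auto
    show "x \<otimes>\<^bsub>ext_alg r E A\<^esub> y \<in> carrier (ext_alg r E A)"
      if "x \<in> carrier (ext_alg r E A)" "y \<in> carrier (ext_alg r E A)" for x y
      using xmul_closed[OF A that] unfolding ext_alg_simps(2) .
    show "\<one>\<^bsub>ext_alg r E A\<^esub> \<otimes>\<^bsub>ext_alg r E A\<^esub> x = x" if "x \<in> carrier (ext_alg r E A)" for x
      using that xmul_one_left[OF E] unfolding ext_alg_simps by auto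
    show "x \<otimes>\<^bsub>ext_alg r E A\<^esub> \<one>\<^bsub>ext_alg r E A\<^esub> = x" if "x \<in> carrier (ext_alg r E A)" for x
      using that xmul_one_right[OF E] unfolding ext_alg_simps by auto
  qed (auto simp: ext_alg_simps xmul_assoc)
qed (auto simp: ext_alg_simps xmul_add_left xmul_add_right)

lemma ext_single_in:
  "subring_set A \<Longrightarrow> S \<subseteq> E \<Longrightarrow> a \<in> A \<Longrightarrow> ext_single S a \<in> carrier (ext_alg r E A)"
  using subring_setD(2) unfolding ext_alg_simps ext_single_def by auto

lemma a_minus_ext_alg:
  assumes E: "finite E" and A: "subring_set A"
    and f: "f \<in> carrier (ext_alg r E A)" and g: "g \<in> carrier (ext_alg r E A)"
  shows "f \<ominus>\<^bsub>ext_alg r E A\<^esub> g = (\<lambda>S. f S - g S)"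
proof -
  interpret ring "ext_alg r E A"
    by (rule ring_ext_alg[OF E A])
  have m: "(\<lambda>S. - g S) \<in> carrier (ext_alg r E A)"
    using g subring_setD(5)[OF A] unfolding ext_alg_simps by auto
  have "\<ominus>\<^bsub>ext_alg r E A\<^esub> g = (\<lambda>S. - g S)"
    by (rule minus_equality[OF _ g m]) (auto simp: ext_alg_simps)
  then show ?thesis
    unfolding a_minus_def by (simp add: ext_alg_simps)
qed

lemma xmul_scalar:
  assumes E: "finite E" and f: "f \<in> carrier (ext_alg r E A)"
  shows "xmul r (ext_single {} c) f = (\<lambda>S. c * f S)"
proof
  fix U
  have "f U = 0" if "infinite U"
    using f E that finite_subset unfolding ext_alg_simps by blast
  then show "xmul r (ext_single {} c) f U = c * f U"
    by (cases "finite U") (simp_all add: xmul_single_left xmul_infinite)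
qed

lemma sum_singles:
  assumes "finite E" "f \<in> carrier (ext_alg r E A)"
  shows "f = (\<lambda>U. \<Sum>S\<in>Pow E. ext_single S (f S) U)"
proof
  fix U
  have "(\<Sum>S\<in>Pow E. ext_single S (f S) U) = (\<Sum>S\<in>Pow E. if U = S then f U else 0)"
    unfolding ext_single_def by (rule sum.cong) auto
  also have "\<dots> = (if U \<in> Pow E then f U else 0)"
    using assms(1) by (intro sum.delta') simp
  also have "\<dots> = f U"
    using assms(2) unfolding ext_alg_simps by auto
  finally show "f U = (\<Sum>S\<in>Pow E. ext_single S (f S) U)" by simp
qed

locale ext_ideal =
  fixes r :: "('e \<times> 'e) set" and E :: "'e set" and A :: "'c::comm_ring_1 set" and I :: "('e set \<Rightarrow> 'c) set"
  assumes finE: "finite E" and subA: "subring_set A" and idl: "ideal I (ext_alg r E A)"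
begin

sublocale ideal I "ext_alg r E A"
  by (rule idl)

lemmas A_simps = subring_setD[OF subA]

lemma I_carrier: "f \<in> I \<Longrightarrow> f \<in> carrier (ext_alg r E A)"
  using Icarr .

lemma I_zero: "(\<lambda>S. 0) \<in> I"
  using additive_subgroup.zero_closed[OF is_additive_subgroup] unfolding ext_alg_simps .

lemma I_add: "f \<in> I \<Longrightarrow> g \<in> I \<Longrightarrow> (\<lambda>S. f S + g S) \<in> I"
  using additive_subgroup.a_closed[OF is_additive_subgroup, of f g] unfolding ext_alg_simps .

lemma I_xmul_left: "f \<in> I \<Longrightarrow> g \<in> carrier (ext_alg r E A) \<Longrightarrow> xmul r g f \<in> I"
  using I_l_closed[of f g] unfolding ext_alg_simps(2) .

lemma I_xmul_right: "f \<in> I \<Longrightarrow> g \<in> carrier (ext_alg r E A) \<Longrightarrow> xmul r f g \<in> I"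
  using I_r_closed[of f g] unfolding ext_alg_simps(2) .

lemma I_scale: "f \<in> I \<Longrightarrow> c \<in> A \<Longrightarrow> (\<lambda>S. c * f S) \<in> I"
proof -
  assume f: "f \<in> I" and c: "c \<in> A"
  have "xmul r (ext_single {} c) f = (\<lambda>S. c * f S)"
    by (rule xmul_scalar[OF finE I_carrier[OF f]])
  moreover have "xmul r (ext_single {} c) f \<in> I"
    using f by (rule I_xmul_left) (rule ext_single_in[OF subA empty_subsetI c])
  ultimately show ?thesis
    by (simp only:)
qed

lemma I_minus: "f \<in> I \<Longrightarrow> (\<lambda>S. - f S) \<in> I"
  using I_scale[of f "- 1"] A_simps by auto

lemma I_diff: "f \<in> I \<Longrightarrow> g \<in> I \<Longrightarrow> (\<lambda>S. f S - g S) \<in> I"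
  using I_add[of f "\<lambda>S. - g S"] I_minus[of g] by simp

lemma I_sum: "(\<And>k. k \<in> K \<Longrightarrow> f k \<in> I) \<Longrightarrow> (\<lambda>S. \<Sum>k\<in>K. f k S) \<in> I"
  by (induction K rule: infinite_finite_induct) (auto simp: I_zero I_add)

lemma coset_eq_iff': "f \<in> carrier (ext_alg r E A) \<Longrightarrow> g \<in> carrier (ext_alg r E A) \<Longrightarrow>
    I +>\<^bsub>ext_alg r E A\<^esub> f = I +>\<^bsub>ext_alg r E A\<^esub> g \<longleftrightarrow> (\<lambda>S. f S - g S) \<in> I"
  using coset_eq_iff[of f g] a_minus_ext_alg[OF finE subA, of f r g] by simp

lemma I_singles:
  assumes f: "f \<in> carrier (ext_alg r E A)" and s: "\<And>S. S \<subseteq> E \<Longrightarrow> ext_single S (f S) \<in> I"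
  shows "f \<in> I"
proof -
  have "f = (\<lambda>U. \<Sum>S\<in>Pow E. ext_single S (f S) U)"
    by (rule sum_singles[OF finE f])
  moreover have "(\<lambda>U. \<Sum>S\<in>Pow E. ext_single S (f S) U) \<in> I"
    by (rule I_sum) (use s in auto)
  ultimately show ?thesis by simp
qed

lemma single_superset:
  assumes S: "ext_single S 1 \<in> I" "S \<subseteq> T" "T \<subseteq> E" and a: "a \<in> A"
  shows "ext_single T a \<in> I"
proof -
  have fin: "finite S" "finite (T - S)"
    using S finE finite_subset by (auto intro: finite_subset)
  \<comment> \<open>The second factor carries the sign of the shuffle, which cancels against the
    sign produced by the product.\<close>
  have "xmul r (ext_single S 1) (ext_single (T - S) (shuffle_sign r S (T - S) * a)) \<in> I"
    using S a by (intro I_xmul_right ext_single_in subA A_simps shuffle_sign_in) auto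
  moreover have "xmul r (ext_single S 1) (ext_single (T - S) (shuffle_sign r S (T - S) * a)) = ext_single T a"
    unfolding xmul_single_single[OF fin] using S(2)
    by (simp add: mult.assoc[symmetric] shuffle_sign_sq Un_absorb1 Diff_disjoint)
  ultimately show ?thesis by simp
qed

lemma single_minus: "ext_single S (- 1) \<in> I \<Longrightarrow> ext_single S 1 \<in> I"
proof -
  assume "ext_single S (- 1) \<in> I"
  then have "(\<lambda>U. - ext_single S (- 1 :: 'c) U) \<in> I"
    by (rule I_minus)
  moreover have "(\<lambda>U. - ext_single S (- 1 :: 'c) U) = ext_single S 1"
    unfolding ext_single_def by auto
  ultimately show ?thesis by simp
qed

lemma single_sign: "ext_single S ((- 1) ^ n) \<in> I \<Longrightarrow> ext_single S 1 \<in> I"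
  using single_minus by (cases "even n") auto

text \<open>Modulo the ideal only one term of the boundary is left, and its coefficient is a sign.
  This is used for a circuit through an element c with e_c in the ideal: every other term contains
  e_c.\<close>

lemma boundary_solve:
  assumes C: "ext_boundary r C \<in> I" "finite C" "c \<in> C"
    and other: "\<And>g. g \<in> C \<Longrightarrow> g \<noteq> c \<Longrightarrow> ext_single (C - {g}) 1 \<in> I"
  shows "ext_single (C - {c}) 1 \<in> I"
proof -
  let ?t = "\<lambda>g. ext_single (C - {g}) ((- 1) ^ card {h \<in> C. (h, g) \<in> r}) :: 'e set \<Rightarrow> 'c"
  have "?t g \<in> I" if g: "g \<in> C" "g \<noteq> c" for g
  proof -
    have "(\<lambda>U. (- 1) ^ card {h \<in> C. (h, g) \<in> r} * ext_single (C - {g}) (1 :: 'c) U) \<in> I"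
      using other[OF g] by (intro I_scale A_simps)
    moreover have "(\<lambda>U. (- 1) ^ card {h \<in> C. (h, g) \<in> r} * ext_single (C - {g}) (1 :: 'c) U) = ?t g"
      unfolding ext_single_def by auto
    ultimately show ?thesis by simp
  qed
  then have "(\<lambda>U. \<Sum>g\<in>C - {c}. ?t g U) \<in> I"
    by (intro I_sum) auto
  then have "(\<lambda>U. ext_boundary r C U - (\<Sum>g\<in>C - {c}. ?t g U)) \<in> I"
    using C(1) by (rule I_diff[rotated])
  moreover have "(\<lambda>U. ext_boundary r C U - (\<Sum>g\<in>C - {c}. ?t g U)) = ?t c"
    unfolding ext_boundary_def using C by (auto simp: sum.remove[of C c])
  ultimately show ?thesis
    using single_sign by simp
qed

text \<open>\<open>e\<^sub>c \<partial>e\<^sub>C = \<plusminus> e\<^sub>C\<close>: multiplying by \<open>e\<^sub>c\<close> kills all other terms.\<close>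

lemma single_circuit:
  assumes C: "ext_boundary r C \<in> I" "C \<subseteq> E" "C \<noteq> {}"
  shows "ext_single C 1 \<in> I"
proof -
  obtain c where c: "c \<in> C"
    using C by blast
  have finC: "finite C"
    using C finE finite_subset by blast
  let ?n = "card {h \<in> C. (h, c) \<in> r}"
  have "xmul r (ext_single {c} 1) (ext_boundary r C) U
      = ext_single C (shuffle_sign r {c} (C - {c}) * (- 1) ^ ?n :: 'c) U" for U
  proof (cases "finite U")
    case True
    have b: "ext_boundary r C (U - {c}) = (if U = C then (- 1) ^ ?n else 0 :: 'c)" if "c \<in> U"
    proof -
      have "ext_boundary r C (U - {c})
          = (\<Sum>g\<in>C. if g = c then (if U = C then (- 1) ^ ?n else 0 :: 'c) else 0)"
        unfolding ext_boundary_def ext_single_def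
      proof (rule sum.cong[OF refl])
        fix g assume "g \<in> C"
        have "U - {c} = C - {g} \<longleftrightarrow> g = c \<and> U = C"
          using that c by blast
        then show "(if U - {c} = C - {g} then (- 1) ^ card {h \<in> C. (h, g) \<in> r} else 0)
            = (if g = c then (if U = C then (- 1) ^ ?n else 0 :: 'c) else 0)"
          by auto
      qed
      then show ?thesis
        using finC c by (simp add: sum.delta)
    qed
    show ?thesis
      unfolding xmul_single_left[OF True] using b c by (auto simp: ext_single_def)
  next
    case False
    then show ?thesis
      using finC by (auto simp: xmul_infinite ext_single_def)
  qed
  then have "xmul r (ext_single {c} 1) (ext_boundary r C)
      = ext_single C (shuffle_sign r {c} (C - {c}) * (- 1) ^ ?n :: 'c)"
    by (rule ext)
  moreover have "xmul r (ext_single {c} 1) (ext_boundary r C) \<in> I"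
    using C(1) by (rule I_xmul_left) (rule ext_single_in[OF subA _ A_simps(1)], use c C in blast)
  ultimately have "ext_single C (shuffle_sign r {c} (C - {c}) * (- 1) ^ ?n) \<in> I"
    by (simp only:)
  then show ?thesis
    unfolding shuffle_sign_def power_add[symmetric] by (rule single_sign)
qed

end

section \<open>Induction over the exterior algebra and its ideals\<close>

lemma ext_alg_induct:
  assumes E: "finite E" and A: "subring_set A" and f: "f \<in> carrier (ext_alg r E A)"
    and zero: "Q (\<lambda>S. 0)" and add: "\<And>f g. Q f \<Longrightarrow> Q g \<Longrightarrow> Q (\<lambda>S. f S + g S)"
    and single: "\<And>S a. S \<subseteq> E \<Longrightarrow> a \<in> A \<Longrightarrow> Q (ext_single S a)"
  shows "Q f"
proof -
  have "Q (\<lambda>U. \<Sum>S\<in>K. ext_single S (f S) U)" if K: "K \<subseteq> Pow E" for K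
  proof -
    have "finite K"
      using finite_subset[OF K] E by simp
    then show ?thesis
      using K
    proof (induction K rule: finite_induct)
      case (insert S K)
      have "Q (\<lambda>U. ext_single S (f S) U + (\<Sum>S\<in>K. ext_single S (f S) U))"
        using insert f unfolding ext_alg_simps by (intro add single) auto
      then show ?case
        using insert.hyps by simp
    qed (use zero in simp)
  qed
  then have "Q (\<lambda>U. \<Sum>S\<in>Pow E. ext_single S (f S) U)"
    by blast
  then show ?thesis
    unfolding sum_singles[OF E f, symmetric] .
qed

text \<open>The property Q need not be stable under multiplication, so the f with Q f need not form
  an ideal. The f all of whose two-sided multiples satisfy Q do form one, and additivity reduces the
  multipliers to monomials.\<close>

lemma ext_Idl_induct:
  assumes E: "finite E" and A: "subring_set A" and G: "G \<subseteq> carrier (ext_alg r E A)"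
    and f: "f \<in> Idl\<^bsub>ext_alg r E A\<^esub> G"
    and zero: "Q (\<lambda>S. 0)" and add: "\<And>f g. Q f \<Longrightarrow> Q g \<Longrightarrow> Q (\<lambda>S. f S + g S)"
    and gen: "\<And>g U a W b. g \<in> G \<Longrightarrow> U \<subseteq> E \<Longrightarrow> W \<subseteq> E \<Longrightarrow> a \<in> A \<Longrightarrow> b \<in> A \<Longrightarrow>
      Q (xmul r (xmul r (ext_single U a) g) (ext_single W b))"
  shows "Q f"
proof -
  let ?R = "ext_alg r E A"
  interpret ring ?R
    by (rule ring_ext_alg[OF E A])
  note D = subring_setD[OF A]
  let ?K = "{f \<in> carrier ?R. \<forall>a\<in>carrier ?R. \<forall>b\<in>carrier ?R. Q (xmul r (xmul r a f) b)}"
  have assoc: "xmul r (xmul r f g) h = xmul r f (xmul r g h)" for f g h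
    using xmul_assoc by blast
  have "ideal ?K ?R"
  proof (rule idealI[OF ring_axioms])
    show "subgroup ?K (add_monoid ?R)"
    proof (rule add.subgroupI)
      show "?K \<noteq> {}"
        using zero D(2) by (auto simp: ext_alg_simps intro!: exI[of _ "\<lambda>S. 0"])
    next
      fix f assume f: "f \<in> ?K"
      have neg: "\<ominus>\<^bsub>?R\<^esub> f = (\<lambda>S. - f S)"
        using a_minus_ext_alg[OF E A _ , of "\<lambda>S. 0" r f] f D(2) unfolding a_minus_def by (simp add: ext_alg_simps)
      have m: "(\<lambda>S. - f S) \<in> carrier ?R"
        using f D(5) unfolding ext_alg_simps by auto
      have "Q (xmul r (xmul r a (\<lambda>S. - f S)) b)" if ab: "a \<in> carrier ?R" "b \<in> carrier ?R" for a b
      proof -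
        have "(\<lambda>S. - 1 * a S) \<in> carrier ?R"
          using ab D(5) unfolding ext_alg_simps by auto
        then have "Q (xmul r (xmul r (\<lambda>S. - 1 * a S) f) b)"
          using f ab by blast
        \<comment> \<open>Q is not assumed to be closed under negation; the sign is moved into the
          left multiplier instead.\<close>
        moreover have "xmul r a (\<lambda>S. - 1 * f S) = xmul r (\<lambda>S. - 1 * a S) f"
          unfolding xmul_scale_left xmul_scale_right fun_eq_iff by simp
        ultimately show ?thesis by simp
      qed
      then show "\<ominus>\<^bsub>?R\<^esub> f \<in> ?K"
        unfolding neg using m by blast
    next
      fix f g assume fg: "f \<in> ?K" "g \<in> ?K"
      have "Q (xmul r (xmul r a (\<lambda>S. f S + g S)) b)" if ab: "a \<in> carrier ?R" "b \<in> carrier ?R" for a b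
      proof -
        have "Q (xmul r (xmul r a f) b)" "Q (xmul r (xmul r a g) b)"
          using fg ab by blast+
        then show ?thesis
          unfolding xmul_add_fun by (rule add)
      qed
      moreover have "(\<lambda>S. f S + g S) \<in> carrier ?R"
        using a_closed[of f g] fg unfolding ext_alg_simps(5) by blast
      ultimately show "f \<oplus>\<^bsub>?R\<^esub> g \<in> ?K"
        unfolding ext_alg_simps(5) by blast
    qed blast
  next
    fix f x assume f: "f \<in> ?K" and x: "x \<in> carrier ?R"
    have "Q (xmul r (xmul r a (xmul r x f)) b)" if "a \<in> carrier ?R" "b \<in> carrier ?R" for a b
      using f that(2) xmul_closed[OF A that(1) x] unfolding assoc[of a x f, symmetric] by blast
    then show "x \<otimes>\<^bsub>?R\<^esub> f \<in> ?K"
      using f xmul_closed[OF A x, of f] unfolding ext_alg_simps(2) by blast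
    have "Q (xmul r (xmul r a (xmul r f x)) b)" if "a \<in> carrier ?R" "b \<in> carrier ?R" for a b
    proof -
      have "Q (xmul r (xmul r a f) (xmul r x b))"
        using f that xmul_closed[OF A x that(2)] by blast
      then show ?thesis
        by (simp only: assoc)
    qed
    then show "f \<otimes>\<^bsub>?R\<^esub> x \<in> ?K"
      using f xmul_closed[OF A _ x, of f] unfolding ext_alg_simps(2) by blast
  qed
  moreover have "G \<subseteq> ?K"
  proof
    fix g assume g: "g \<in> G"
    have "Q (xmul r (xmul r (ext_single U a) g) b)"
      if U: "U \<subseteq> E" "a \<in> A" and b: "b \<in> carrier ?R" for U a b
    proof (rule ext_alg_induct[OF E A b])
      show "Q (xmul r (xmul r (ext_single U a) g) (\<lambda>S. 0))"
        using zero by simp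
      show "Q (xmul r (xmul r (ext_single U a) g) (\<lambda>S. f S + f' S))"
        if "Q (xmul r (xmul r (ext_single U a) g) f)" "Q (xmul r (xmul r (ext_single U a) g) f')" for f f'
        unfolding xmul_add_fun using that by (rule add)
    qed (use gen[OF g U(1)] U in blast)
    then have "Q (xmul r (xmul r a g) b)" if a: "a \<in> carrier ?R" and b: "b \<in> carrier ?R" for a b
    proof (intro ext_alg_induct[OF E A a, of "\<lambda>a. Q (xmul r (xmul r a g) b)"])
      show "Q (xmul r (xmul r (\<lambda>S. 0) g) b)"
        using zero by simp
      show "Q (xmul r (xmul r (\<lambda>S. f S + f' S) g) b)"
        if "Q (xmul r (xmul r f g) b)" "Q (xmul r (xmul r f' g) b)" for f f'
        unfolding xmul_add_fun using that by (rule add)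
    qed (use b in blast)
    then show "g \<in> ?K"
      using g G by blast
  qed
  ultimately have "f \<in> ?K"
    using f genideal_minimal by blast
  moreover have "xmul r (xmul r \<one>\<^bsub>?R\<^esub> f) \<one>\<^bsub>?R\<^esub> = f"
    using l_one[of f] r_one[of f] \<open>f \<in> ?K\<close> unfolding ext_alg_simps(2) by simp
  ultimately show "Q f"
    using one_closed by fastforce
qed

section \<open>Change of coefficients and of generators\<close>

lemma mem_map_prod_iff: "inj v \<Longrightarrow> (v a, v b) \<in> map_prod v v ` r \<longleftrightarrow> (a, b) \<in> r"
  by (auto simp: inj_eq intro: rev_image_eqI)

text \<open>The bigraded algebras have generators indexed by H, while those of \<open>OS\<close> are
  indexed by vertices. Since the order is carried along by the injection v, all signs are
  preserved.\<close>

lemma shuffle_sign_transport: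
  assumes "inj v"
  shows "shuffle_sign (map_prod v v ` r) (v ` S) (v ` T) = shuffle_sign r S T"
proof -
  have "{(s, t). s \<in> v ` S \<and> t \<in> v ` T \<and> (t, s) \<in> map_prod v v ` r}
      = map_prod v v ` {(s, t). s \<in> S \<and> t \<in> T \<and> (t, s) \<in> r}"
    using mem_map_prod_iff[OF assms] by (auto simp: inj_eq[OF assms])
  moreover have "inj (map_prod v v)"
    using assms by (simp add: prod.inj_map)
  ultimately show ?thesis
    unfolding shuffle_sign_def by (simp add: card_image[OF inj_on_subset[OF _ subset_UNIV]])
qed

lemma xmul_transport:
  assumes v: "inj v"
  shows "xmul (map_prod v v ` r) f g (v ` S) = xmul r (\<lambda>S. f (v ` S)) (\<lambda>S. g (v ` S)) S"
proof -
  have inj: "inj_on (image v) (Pow S)"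
    using v by (auto simp: inj_on_def inj_image_eq_iff)
  have "Pow (v ` S) = image v ` Pow S"
    by (auto simp: image_Pow_surj[symmetric] elim!: subset_imageE)
  then have "xmul (map_prod v v ` r) f g (v ` S) = (\<Sum>T\<in>Pow S.
      shuffle_sign (map_prod v v ` r) (v ` T) (v ` S - v ` T) * f (v ` T) * g (v ` S - v ` T))"
    unfolding xmul_def using sum.reindex[OF inj] by (simp add: o_def)
  also have "\<dots> = xmul r (\<lambda>S. f (v ` S)) (\<lambda>S. g (v ` S)) S"
    unfolding xmul_def
    by (rule sum.cong) (auto simp: image_set_diff[OF v, symmetric] shuffle_sign_transport[OF v])
  finally show ?thesis .
qed

lemma ext_boundary_transport:
  assumes v: "inj v"
  shows "ext_boundary (map_prod v v ` r) (v ` C) (v ` S) = ext_boundary r C S"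
proof -
  have "{h \<in> v ` C. (h, v g) \<in> map_prod v v ` r} = v ` {h \<in> C. (h, g) \<in> r}" for g
    using mem_map_prod_iff[OF v] by (auto simp: inj_eq[OF v])
  then have card: "card {h \<in> v ` C. (h, v g) \<in> map_prod v v ` r} = card {h \<in> C. (h, g) \<in> r}" for g
    by (simp add: card_image[OF inj_on_subset[OF v subset_UNIV]])
  have "v ` C - {v g} = v ` (C - {g})" for g
    using image_set_diff[OF v, of C "{g}"] by simp
  then have eq: "v ` S = v ` C - {v g} \<longleftrightarrow> S = C - {g}" for g
    using inj_image_eq_iff[OF v] by simp
  then show ?thesis
    unfolding ext_boundary_def ext_single_def
    by (simp only: sum.reindex[OF inj_on_subset[OF v subset_UNIV]] o_def card eq)
qed

lemma ext_boundary_nonzero: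
  assumes "(ext_boundary r C S :: 'c::comm_ring_1) \<noteq> 0"
  shows "\<exists>c\<in>C. S = C - {c}"
proof (rule ccontr)
  assume "\<not> ?thesis"
  then have "(ext_boundary r C S :: 'c) = (\<Sum>g\<in>C. 0)"
    unfolding ext_boundary_def ext_single_def by (intro sum.cong) auto
  then show False using assms by simp
qed

lemma ext_boundary_in:
  assumes "subring_set A" "C \<subseteq> E"
  shows "ext_boundary r C \<in> carrier (ext_alg r E A)"
proof -
  note D = subring_setD[OF assms(1)]
  have "ext_boundary r C S \<in> A" for S
    unfolding ext_boundary_def ext_single_def using D by (intro D(8)) auto
  then show ?thesis
    unfolding ext_alg_simps using ext_boundary_nonzero assms(2) by blast
qed

lemma pconst_simps:
  "pconst (a + b) = pconst a + pconst b" "pconst (a * b) = pconst a * pconst b"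
  "pconst 0 = 0" "pconst 1 = 1" "pconst (- a) = - pconst a" "pconst (a - b) = pconst a - pconst b"
  unfolding pconst_def by (simp_all add: single_add mult_single single_uminus single_diff)

lemma pconst_sum: "pconst (sum f K) = (\<Sum>k\<in>K. pconst (f k))"
  by (induction K rule: infinite_finite_induct) (auto simp: pconst_simps)

lemma pconst_power: "pconst (a ^ n) = pconst a ^ n"
  by (induction n) (auto simp: pconst_simps)

lemma pconst_shuffle_sign: "pconst (shuffle_sign r S T) = shuffle_sign r S T"
  unfolding shuffle_sign_def by (simp add: pconst_power pconst_simps)

text \<open>Extension of scalars from the rationals to polynomials is multiplicative. It is what
  connects the rational algebra \<open>OS\<close> with algebras over polynomials.\<close>

lemma pconst_xmul: "pconst (xmul r f g U) = xmul r (\<lambda>S. pconst (f S)) (\<lambda>S. pconst (g S)) U"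
  unfolding xmul_def by (simp add: pconst_sum pconst_simps pconst_shuffle_sign)

lemma pconst_boundary: "pconst (ext_boundary r C U) = ext_boundary r C U"
  unfolding ext_boundary_def ext_single_def pconst_sum
  by (rule sum.cong) (auto simp: pconst_power pconst_simps)

lemma pconst_single: "pconst (ext_single S a U) = ext_single S (pconst a) U"
  unfolding ext_single_def by (simp add: pconst_simps)

section \<open>Polynomials\<close>

lemma subring_polys: "subring_set (polys H)"
proof -
  have "a * b \<in> polys H" if "a \<in> polys H" "b \<in> polys H" for a b :: "'a qpoly"
  proof -
    have "Poly_Mapping.keys m \<subseteq> H" if m: "m \<in> Poly_Mapping.keys (a * b)" for m
    proof -
      obtain s t where "m = s + t" "s \<in> Poly_Mapping.keys a" "t \<in> Poly_Mapping.keys b"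
        using m keys_mult[of a b] by blast
      then show ?thesis
        using \<open>a \<in> polys H\<close> \<open>b \<in> polys H\<close> keys_add[of s t] unfolding polys_def by blast
    qed
    then show ?thesis
      unfolding polys_def by blast
  qed
  moreover have "a + b \<in> polys H" if "a \<in> polys H" "b \<in> polys H" for a b :: "'a qpoly"
    using that keys_add[of a b] unfolding polys_def by blast
  moreover have "- a \<in> polys H" if "a \<in> polys H" for a :: "'a qpoly"
    using that unfolding polys_def by (auto simp: in_keys_iff)
  moreover have "1 \<in> polys H"
    unfolding polys_def by simp
  ultimately show ?thesis
    unfolding subring_set_def by blast
qed

lemmas polys_simps = subring_setD[OF subring_polys]

lemma pvar_in: "g \<in> H \<Longrightarrow> pvar g \<in> polys H"
  unfolding pvar_def polys_def by simp

lemma pconst_in: "pconst c \<in> polys H"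
  unfolding pconst_def polys_def by auto

lemma x_mono_in: "T \<subseteq> H \<Longrightarrow> x_mono T \<in> polys H"
  unfolding x_mono_def
  by (induction T rule: infinite_finite_induct) (auto simp: polys_simps pvar_in)

lemma c_elem_in: "c_elem L H g \<in> polys H"
  unfolding c_elem_def by (intro polys_simps(8)) (auto simp: pvar_in)

lemma poly_ring_simps:
  "carrier (poly_ring H) = polys H" "mult (poly_ring H) = (*)" "one (poly_ring H) = 1"
  "zero (poly_ring H) = 0" "add (poly_ring H) = (+)"
  unfolding poly_ring_def by auto

lemma cring_poly_ring: "cring (poly_ring H)"
proof (rule cringI)
  show "abelian_group (poly_ring H)"
  proof (rule abelian_groupI)
    fix x assume "x \<in> carrier (poly_ring H)"
    then show "\<exists>y\<in>carrier (poly_ring H). y \<oplus>\<^bsub>poly_ring H\<^esub> x = \<zero>\<^bsub>poly_ring H\<^esub>"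
      unfolding poly_ring_simps using polys_simps(5) by (intro bexI[of _ "- x"]) auto
  qed (auto simp: poly_ring_simps polys_simps algebra_simps)
  show "comm_monoid (poly_ring H)"
    by (rule comm_monoidI) (auto simp: poly_ring_simps polys_simps algebra_simps)
qed (auto simp: poly_ring_simps algebra_simps)

lemma a_minus_poly_ring:
  assumes "f \<in> polys H" "g \<in> polys H"
  shows "f \<ominus>\<^bsub>poly_ring H\<^esub> g = f - g"
proof -
  interpret cring "poly_ring H" by (rule cring_poly_ring)
  have "\<ominus>\<^bsub>poly_ring H\<^esub> g = - g"
    by (rule minus_equality) (use assms in \<open>auto simp: poly_ring_simps polys_simps\<close>)
  then show ?thesis
    unfolding a_minus_def by (simp add: poly_ring_simps)
qed

locale poly_ideal =
  fixes H :: "'a set" and K :: "'a qpoly set"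
  assumes idlK: "ideal K (poly_ring H)"
begin

sublocale ideal K "poly_ring H"
  by (rule idlK)

lemma K_in: "p \<in> K \<Longrightarrow> p \<in> polys H"
  using Icarr unfolding poly_ring_simps .

lemma K_zero: "0 \<in> K"
  using additive_subgroup.zero_closed[OF is_additive_subgroup] unfolding poly_ring_simps .

lemma K_add: "p \<in> K \<Longrightarrow> q \<in> K \<Longrightarrow> p + q \<in> K"
  using additive_subgroup.a_closed[OF is_additive_subgroup, of p q] unfolding poly_ring_simps .

lemma K_mult: "p \<in> K \<Longrightarrow> q \<in> polys H \<Longrightarrow> p * q \<in> K" and K_mult': "p \<in> K \<Longrightarrow> q \<in> polys H \<Longrightarrow> q * p \<in> K"
  using I_r_closed[of p q] I_l_closed[of p q] unfolding poly_ring_simps by auto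

lemma K_eq_iff: "p \<in> polys H \<Longrightarrow> q \<in> polys H \<Longrightarrow>
    K +>\<^bsub>poly_ring H\<^esub> p = K +>\<^bsub>poly_ring H\<^esub> q \<longleftrightarrow> p - q \<in> K"
  using coset_eq_iff[of p q] a_minus_poly_ring[of p H q] unfolding poly_ring_simps by simp

end

lemma poly_homog_simps:
  "poly_homog i 0" "poly_homog i p \<Longrightarrow> poly_homog i q \<Longrightarrow> poly_homog i (p + q)"
  "poly_homog i p \<Longrightarrow> poly_homog i (pconst c * p)"
proof -
  show "poly_homog i 0"
    unfolding poly_homog_def by simp
  show "poly_homog i (p + q)" if "poly_homog i p" "poly_homog i q"
    using that keys_add[of p q] unfolding poly_homog_def by blast
  have "Poly_Mapping.keys (pconst c * p) \<subseteq> Poly_Mapping.keys p"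
    using keys_mult[of "pconst c" p] unfolding pconst_def by (auto split: if_splits)
  then show "poly_homog i p \<Longrightarrow> poly_homog i (pconst c * p)"
    unfolding poly_homog_def by blast
qed


section \<open>Tensor products\<close>

lemma lookup_scale: "Poly_Mapping.lookup (Poly_Mapping.map ((*) (c::rat)) t) k = c * Poly_Mapping.lookup t k"
  by (simp add: Poly_Mapping.map.rep_eq when_def)

lemma pm_module: "Modules.module (\<lambda>c::rat. Poly_Mapping.map ((*) c) :: ('k \<Rightarrow>\<^sub>0 rat) \<Rightarrow> _)"
  by unfold_locales (auto intro!: poly_mapping_eqI simp: lookup_scale lookup_add algebra_simps)

lemma scale_single: "Poly_Mapping.map ((*) (c::rat)) (Poly_Mapping.single k x) = Poly_Mapping.single k (c * x)"
  by (simp add: map_single)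

text \<open>Additive extension from the basis. The scalar is an argument of h because the target is
  only an additive group; linearity is recovered from additivity of h in that argument.\<close>

definition lext :: "('k \<Rightarrow> rat \<Rightarrow> 'b) \<Rightarrow> ('k \<Rightarrow>\<^sub>0 rat) \<Rightarrow> 'b::ab_group_add" where
  "lext h t = (\<Sum>k\<in>Poly_Mapping.keys t. h k (Poly_Mapping.lookup t k))"

locale lext_fun =
  fixes h :: "'k \<Rightarrow> rat \<Rightarrow> 'b::ab_group_add"
  assumes h_add: "h k (x + y) = h k x + h k y"
begin

lemma h_zero: "h k 0 = 0"
  using h_add[of k 0 0] by simp

lemma lext_superset: "finite F \<Longrightarrow> Poly_Mapping.keys t \<subseteq> F \<Longrightarrow> lext h t = (\<Sum>k\<in>F. h k (Poly_Mapping.lookup t k))"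
  unfolding lext_def by (rule sum.mono_neutral_left) (auto simp: h_zero in_keys_iff)

lemma lext_add: "lext h (s + t) = lext h s + lext h t"
proof -
  let ?F = "Poly_Mapping.keys s \<union> Poly_Mapping.keys t"
  have "lext h (s + t) = (\<Sum>k\<in>?F. h k (Poly_Mapping.lookup (s + t) k))"
    using keys_add[of s t] by (intro lext_superset) auto
  also have "\<dots> = lext h s + lext h t"
    by (subst (1 2) lext_superset[of ?F]) (auto simp: lookup_add h_add sum.distrib)
  finally show ?thesis .
qed

lemma lext_zero: "lext h 0 = 0"
  unfolding lext_def by simp

lemma lext_minus: "lext h (- t) = - lext h t"
  using lext_add[of t "- t"] lext_zero by (simp add: eq_neg_iff_add_eq_0 add.commute)

lemma lext_diff: "lext h (s - t) = lext h s - lext h t"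
  using lext_add[of s "- t"] lext_minus[of t] by simp

lemma lext_single: "lext h (Poly_Mapping.single k x) = h k x"
  unfolding lext_def by (simp add: h_zero)

lemma lext_sum: "lext h (\<Sum>i\<in>I. f i) = (\<Sum>i\<in>I. lext h (f i))"
  by (induction I rule: infinite_finite_induct) (auto simp: lext_zero lext_add)

end

lemma pm_decompose: "t = (\<Sum>k\<in>Poly_Mapping.keys t. Poly_Mapping.single k (Poly_Mapping.lookup t k))"
proof (rule poly_mapping_eqI)
  fix k
  have "(\<Sum>i\<in>Poly_Mapping.keys t. Poly_Mapping.lookup (Poly_Mapping.single i (Poly_Mapping.lookup t i)) k)
      = (\<Sum>i\<in>Poly_Mapping.keys t. if k = i then Poly_Mapping.lookup t k else 0)"
    by (rule sum.cong) (auto simp: lookup_single when_def)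
  then show "Poly_Mapping.lookup t k
      = Poly_Mapping.lookup (\<Sum>k\<in>Poly_Mapping.keys t. Poly_Mapping.single k (Poly_Mapping.lookup t k)) k"
    by (simp add: lookup_sum in_keys_iff)
qed

locale tens =
  fixes M :: "(rat, 'm) module" and N :: "(rat, 'n) module"
begin

definition ker :: "(('m \<times> 'n) \<Rightarrow>\<^sub>0 rat) set" where "ker = tensor_kernel M N"

lemmas ker_span = ker_def[unfolded tensor_kernel_def]

lemma ker_zero: "0 \<in> ker"
  unfolding ker_span by (rule module.span_zero[OF pm_module])

lemma ker_add: "s \<in> ker \<Longrightarrow> t \<in> ker \<Longrightarrow> s + t \<in> ker"
  unfolding ker_span by (rule module.span_add[OF pm_module])

lemma ker_minus: "t \<in> ker \<Longrightarrow> - t \<in> ker"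
  unfolding ker_span by (rule module.span_neg[OF pm_module])

lemma ker_scale: "t \<in> ker \<Longrightarrow> Poly_Mapping.map ((*) c) t \<in> ker"
  unfolding ker_span by (rule module.span_scale[OF pm_module])

lemma ker_sum: "(\<And>i. i \<in> I \<Longrightarrow> f i \<in> ker) \<Longrightarrow> sum f I \<in> ker"
  unfolding ker_span by (rule module.span_sum[OF pm_module])

lemma ker_rels: "tensor_rels M N \<subseteq> ker"
  unfolding ker_span by (rule module.span_superset[OF pm_module])

lemma ker_le:
  assumes "tensor_rels M N \<subseteq> W" "0 \<in> W" "\<And>s t. s \<in> W \<Longrightarrow> t \<in> W \<Longrightarrow> s + t \<in> W"
    "\<And>c t. t \<in> W \<Longrightarrow> Poly_Mapping.map ((*) c) t \<in> W"
  shows "ker \<subseteq> W"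
  unfolding ker_span using assms
  by (intro module.span_minimal[OF pm_module]) (auto simp: module.subspace_def[OF pm_module])

text \<open>Equality in the tensor product, stated for representatives, so that computations need
  not handle cosets.\<close>

definition eqv :: "(('m \<times> 'n) \<Rightarrow>\<^sub>0 rat) \<Rightarrow> (('m \<times> 'n) \<Rightarrow>\<^sub>0 rat) \<Rightarrow> bool" where
  "eqv s t \<longleftrightarrow> s - t \<in> ker"

lemma eqv_refl [simp]: "eqv t t"
  unfolding eqv_def by (simp add: ker_zero)

lemma eqv_sym: "eqv s t \<Longrightarrow> eqv t s"
  unfolding eqv_def using ker_minus by force

lemma eqv_trans [trans]: "eqv s t \<Longrightarrow> eqv t u \<Longrightarrow> eqv s u"
  unfolding eqv_def using ker_add[of "s - t" "t - u"] by simp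

lemma eqv_add: "eqv s s' \<Longrightarrow> eqv t t' \<Longrightarrow> eqv (s + t) (s' + t')"
  unfolding eqv_def using ker_add[of "s - s'" "t - t'"] by (simp add: algebra_simps)

lemma eqv_sum: "(\<And>i. i \<in> I \<Longrightarrow> eqv (f i) (g i)) \<Longrightarrow> eqv (sum f I) (sum g I)"
  unfolding eqv_def sum_subtractf[symmetric] by (rule ker_sum)

lemma eqv_zero: "eqv t 0 \<longleftrightarrow> t \<in> ker"
  unfolding eqv_def by simp

lemma eqv_rels:
  assumes "a \<in> carrier M" "b \<in> carrier N"
  shows "a' \<in> carrier M \<Longrightarrow> eqv (Poly_Mapping.single (a \<oplus>\<^bsub>M\<^esub> a', b) 1)
      (Poly_Mapping.single (a, b) 1 + Poly_Mapping.single (a', b) 1)"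
    "b' \<in> carrier N \<Longrightarrow> eqv (Poly_Mapping.single (a, b \<oplus>\<^bsub>N\<^esub> b') 1)
      (Poly_Mapping.single (a, b) 1 + Poly_Mapping.single (a, b') 1)"
    "eqv (Poly_Mapping.single (c \<odot>\<^bsub>M\<^esub> a, b) 1) (Poly_Mapping.single (a, b) c)"
    "eqv (Poly_Mapping.single (a, c \<odot>\<^bsub>N\<^esub> b) 1) (Poly_Mapping.single (a, b) c)"
  unfolding eqv_def diff_diff_eq[symmetric]
  by (rule subsetD[OF ker_rels], use assms in \<open>unfold tensor_rels_def Let_def, blast\<close>)+

end

section \<open>The ideal of relations\<close>

context nested_blowup
begin

abbreviation "R \<equiv> ext_alg r H (polys H)"

text \<open>The choice \<open>Z = {}\<close> presents the hat version; \<open>Z = {\<top>}\<close>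
  presents B as a single quotient of the free algebra instead of a quotient of a quotient.\<close>

definition gens :: "'a set \<Rightarrow> ('a set \<Rightarrow> 'a qpoly) set" where
  "gens Z = {ext_single S (x_mono T) | S T. S \<subseteq> H \<and> T \<subseteq> H \<and> \<not> nested L H (S \<union> T)}
      \<union> {ext_boundary r S | S. nested_circuit L H r S}
      \<union> {ext_single {} (c_elem L H g) | g. g \<in> atoms L}
      \<union> (\<lambda>z. ext_single {z} 1) ` Z"

definition rel :: "'a set \<Rightarrow> ('a set \<Rightarrow> 'a qpoly) set" where
  "rel Z = Idl\<^bsub>R\<^esub> (gens Z)"

lemma Bhat_ideal_eq: "Bhat_ideal L H r = rel {}"
  unfolding Bhat_ideal_def rel_def gens_def free_gc_def by simp

lemma gens_carrier:
  assumes "Z \<subseteq> H"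
  shows "gens Z \<subseteq> carrier R"
proof -
  have "circ C \<Longrightarrow> C \<subseteq> H" for C
    unfolding circ_def using nested_sub by blast
  then show ?thesis
    unfolding gens_def nested_circuit_iff using assms
    by (auto intro!: ext_single_in[OF subring_polys] ext_boundary_in[OF subring_polys]
        x_mono_in c_elem_in polys_simps(1))
qed

lemma ext_ideal_rel: "Z \<subseteq> H \<Longrightarrow> ext_ideal r H (polys H) (rel Z)"
  unfolding rel_def
  by (intro ext_ideal.intro finite_H subring_polys ring.genideal_ideal ring_ext_alg gens_carrier)

end

locale nested_rel = nested_blowup L H r for L :: "'a gorder" (structure) and H r +
  fixes Z :: "'a set"
  assumes ZH: "Z \<subseteq> H"
begin

sublocale B: ext_ideal r H "polys H" "rel Z"
  by (rule ext_ideal_rel[OF ZH])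

lemma gens_rel: "gens Z \<subseteq> rel Z"
  unfolding rel_def using ring.genideal_self[OF ring_ext_alg[OF finite_H subring_polys]] gens_carrier[OF ZH] .

lemma rel_nonnested: "S \<subseteq> H \<Longrightarrow> T \<subseteq> H \<Longrightarrow> \<not> nested L H (S \<union> T) \<Longrightarrow> ext_single S (x_mono T) \<in> rel Z"
  using gens_rel unfolding gens_def by blast

lemma rel_circ: "circ C \<Longrightarrow> ext_boundary r C \<in> rel Z"
  using gens_rel unfolding gens_def nested_circuit_iff by blast

lemma rel_atom: "g \<in> atoms L \<Longrightarrow> ext_single {} (c_elem L H g) \<in> rel Z"
  using gens_rel unfolding gens_def by blast

lemma rel_Z: "z \<in> Z \<Longrightarrow> ext_single {z} 1 \<in> rel Z"
  using gens_rel unfolding gens_def by blast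

lemma rel_mono: "rel {} \<subseteq> rel Z"
proof -
  have "gens {} \<subseteq> rel Z"
    using gens_rel unfolding gens_def by blast
  then show ?thesis
    using ring.genideal_minimal[OF ring_ext_alg[OF finite_H subring_polys] B.idl]
    unfolding rel_def[of "{}"] by blast
qed

lemma rel_contains_circ:
  assumes "circ C" "C \<subseteq> S" "S \<subseteq> H" "p \<in> polys H"
  shows "ext_single S p \<in> rel Z"
proof -
  have "ext_single C 1 \<in> rel Z"
    using B.single_circuit[OF rel_circ[OF assms(1)] _ circ_nonempty[OF assms(1)]] assms(2,3) by blast
  then show ?thesis
    using B.single_superset assms by blast
qed

text \<open>A nested dependent set contains a circuit C, and e_C is already in the ideal. A set that
  is not nested is covered by the first kind of relation, with no x-variables.\<close>

lemma rel_not_ind: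
  assumes S: "S \<subseteq> H" "\<not> ind S" and p: "p \<in> polys H"
  shows "ext_single S p \<in> rel Z"
proof (cases "nested L H S")
  case True
  then obtain C where "C \<subseteq> S" "circ C"
    using dep_has_circ S by blast
  then show ?thesis
    using rel_contains_circ S p by blast
next
  case False
  then have "ext_single S 1 \<in> rel Z"
    using rel_nonnested[of S "{}"] S by (simp add: x_mono_def)
  then show ?thesis
    using B.single_superset[of S S] S p by blast
qed

text \<open>If z is not in S, then z lies in the closure of S, so \<open>insert z S\<close> contains
  a circuit C. If z is in C, \<open>boundary_solve\<close> puts the monomial of
  \<open>C - {z}\<close>, a subset of S, into the ideal; otherwise C itself is a subset of
  S.\<close>

lemma rel_above_Z:
  assumes S: "ind S" "E (J S) \<inter> Z \<noteq> {}" and p: "p \<in> polys H"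
  shows "ext_single S p \<in> rel Z"
proof -
  obtain z where z: "z \<in> Z" "z \<in> E (J S)"
    using S by blast
  have n: "nested L H S"
    using S unfolding ind_def by blast
  have SH: "S \<subseteq> H"
    using nested_sub[OF n] .
  show ?thesis
  proof (cases "z \<in> S")
    case True
    then show ?thesis
      using B.single_superset[OF rel_Z[OF z(1)] _ SH p] by blast
  next
    case zS: False
    have sub: "insert z S \<subseteq> E (J S)"
      using z(2) E_J_sup[OF n] by blast
    have n': "nested L H (insert z S)"
      using nested_mono[OF nested_E[OF J_coord(1)[OF n]] sub] .
    have "insert z S - {z} = S"
      using zS by auto
    then have "\<not> ind (insert z S)"
      using z(2) unfolding ind_def by auto
    then obtain C where C: "C \<subseteq> insert z S" "circ C"
      using dep_has_circ[OF n'] by blast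
    show ?thesis
    proof (cases "z \<in> C")
      case True
      have CH: "C \<subseteq> H"
        using C(1) nested_sub[OF n'] by blast
      have "ext_single (C - {g}) 1 \<in> rel Z" if "g \<in> C" "g \<noteq> z" for g
        using B.single_superset[OF rel_Z[OF z(1)], of "C - {g}" 1] True that CH polys_simps(1) by blast
      then have "ext_single (C - {z}) 1 \<in> rel Z"
        using B.boundary_solve[OF rel_circ[OF C(2)] finite_subset[OF CH finite_H] True] by blast
      moreover have "C - {z} \<subseteq> S"
        using C(1) by blast
      ultimately show ?thesis
        using B.single_superset SH p by blast
    next
      case False
      then show ?thesis
        using rel_contains_circ[OF C(2) _ SH p] C(1) by blast
    qed
  qed
qed

end

section \<open>The ideals of \<open>DP\<close> and of its quotients DP_y\<close>

lemma (in nested_blowup) poly_ideal_DP: "poly_ideal H (DP_ideal L H S)"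
proof -
  have "{x_mono T | T. T \<subseteq> H \<and> \<not> nested L H (S \<union> T)} \<union> c_elem L H ` atoms L \<subseteq> carrier (poly_ring H)"
    unfolding poly_ring_simps by (auto intro: x_mono_in c_elem_in)
  then show ?thesis
    unfolding DP_ideal_def
    by (intro poly_ideal.intro ring.genideal_ideal cring.axioms(1) cring_poly_ring)
qed

lemma (in nested_blowup) DP_gens: "T \<subseteq> H \<Longrightarrow> \<not> nested L H (S \<union> T) \<Longrightarrow> x_mono T \<in> DP_ideal L H S"
  "g \<in> atoms L \<Longrightarrow> c_elem L H g \<in> DP_ideal L H S"
  unfolding DP_ideal_def genideal_def by blast+

lemma (in nested_blowup) DP_ideal_le:
  assumes I: "0 \<in> I" "\<And>p q. p \<in> I \<Longrightarrow> q \<in> I \<Longrightarrow> p + q \<in> I"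
      "\<And>p q. p \<in> I \<Longrightarrow> q \<in> polys H \<Longrightarrow> q * p \<in> I" "I \<subseteq> polys H"
    and g: "\<And>T. T \<subseteq> H \<Longrightarrow> \<not> nested L H (S \<union> T) \<Longrightarrow> x_mono T \<in> I"
      "\<And>g. g \<in> atoms L \<Longrightarrow> c_elem L H g \<in> I"
  shows "DP_ideal L H S \<subseteq> I"
proof -
  interpret cring "poly_ring H" by (rule cring_poly_ring)
  \<comment> \<open>Negatives are multiples by the constant polynomial - 1, so closure under
    multiplication suffices.\<close>
  have neg: "\<ominus>\<^bsub>poly_ring H\<^esub> p = - 1 * p" if "p \<in> polys H" for p
    by (rule minus_equality) (use that polys_simps(5) in \<open>auto simp: poly_ring_simps\<close>)
  have "ideal I (poly_ring H)"
  proof (rule idealI[OF ring_axioms])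
    show "subgroup I (add_monoid (poly_ring H))"
    proof (rule add.subgroupI)
      show "I \<subseteq> carrier (poly_ring H)"
        using I(4) unfolding poly_ring_simps .
      show "\<ominus>\<^bsub>poly_ring H\<^esub> p \<in> I" if "p \<in> I" for p
        unfolding neg[OF subsetD[OF I(4) that]] by (rule I(3)[OF that polys_simps(5)[OF polys_simps(1)]])
      show "p \<oplus>\<^bsub>poly_ring H\<^esub> q \<in> I" if "p \<in> I" "q \<in> I" for p q
        using I(2)[OF that] unfolding poly_ring_simps .
    qed (use I(1) in auto)
  qed (use I(3) in \<open>auto simp: poly_ring_simps mult.commute\<close>)
  moreover have "{x_mono T | T. T \<subseteq> H \<and> \<not> nested L H (S \<union> T)} \<union> c_elem L H ` atoms L \<subseteq> I"
    using g by blast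
  ultimately show ?thesis
    unfolding DP_ideal_def by (rule genideal_minimal)
qed


section \<open>The summand of one element of the blowup\<close>

locale nested_cell = nested_blowup L H r for L :: "'a gorder" (structure) and H r +
  fixes y :: "'a blow" and j :: nat
  assumes yP: "y \<in> carrier P" and rky: "rk y = j"
begin

abbreviation "vo \<equiv> map_prod v v ` r"
abbreviation "X \<equiv> ext_alg vo (v ` E y) (UNIV :: rat set)"
definition "OI = OS_ideal (vertex_order L r) (below P y)"
definition "Ky = DPy_ideal L H r y"
abbreviation "M \<equiv> OS_part (vertex_order L r) (below P y) j"
abbreviation "N' \<equiv> DPy_space L H r y"
abbreviation oc :: "('a blow set \<Rightarrow> rat) \<Rightarrow> ('a blow set \<Rightarrow> rat) set" where
  "oc f \<equiv> OI +>\<^bsub>X\<^esub> f"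
abbreviation kc :: "'a qpoly \<Rightarrow> 'a qpoly set" where
  "kc p \<equiv> Ky +>\<^bsub>poly_ring H\<^esub> p"
abbreviation "Xj \<equiv> {f \<in> carrier X. ext_homog j f}"

lemma exterior_eq: "exterior (vertex_order L r) (below P y) = X"
  unfolding exterior_def vertex_order_def atoms_below[OF yP] ..

lemma finE: "finite (E y)"
  using finite_subset[OF E_sub finite_H] .

lemma OI_eq: "OI = Idl\<^bsub>X\<^esub> {ext_boundary vo (v ` C) | C. C \<subseteq> E y \<and> circ C}"
proof -
  have *: "lattice_circuit (below P y) C \<longleftrightarrow> (\<exists>C'. C = v ` C' \<and> C' \<subseteq> E y \<and> circ C')" for C
  proof
    assume "lattice_circuit (below P y) C"
    then show "\<exists>C'. C = v ` C' \<and> C' \<subseteq> E y \<and> circ C'"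
      by (rule lattice_circuit_below[OF yP]) blast
  next
    assume "\<exists>C'. C = v ` C' \<and> C' \<subseteq> E y \<and> circ C'"
    then show "lattice_circuit (below P y) C"
      using lattice_circuit_iff[OF yP] by blast
  qed
  have "{ext_boundary vo C | C. lattice_circuit (below P y) C}
      = {ext_boundary vo (v ` C) :: _ \<Rightarrow> rat | C. C \<subseteq> E y \<and> circ C}"
    unfolding * by (rule Collect_cong) blast
  then show ?thesis
    unfolding OI_def OS_ideal_def exterior_eq unfolding vertex_order_def by simp
qed

lemma OI_gens: "{ext_boundary vo (v ` C) | C. C \<subseteq> E y \<and> circ C} \<subseteq> carrier X"
  by (auto intro!: ext_boundary_in[OF subring_set_UNIV])

sublocale O: ext_ideal vo "v ` E y" "UNIV :: rat set" OI
  unfolding OI_eq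
  by (intro ext_ideal.intro finite_imageI finE subring_set_UNIV ring.genideal_ideal ring_ext_alg OI_gens)

sublocale K: poly_ideal H Ky
  unfolding Ky_def DPy_ideal_def by (rule poly_ideal_DP)

lemma OI_circ: "C \<subseteq> E y \<Longrightarrow> circ C \<Longrightarrow> ext_boundary vo (v ` C) \<in> OI"
  unfolding OI_eq using ring.genideal_self[OF ring_ext_alg[OF finite_imageI[OF finE] subring_set_UNIV] OI_gens]
  by blast

lemma OI_not_ind:
  assumes "S \<subseteq> E y" "\<not> ind S"
  shows "ext_single (v ` S) a \<in> OI"
proof -
  have "nested L H S"
    using nested_mono[OF nested_E[OF yP] assms(1)] .
  then obtain C where C: "C \<subseteq> S" "circ C"
    using dep_has_circ assms(2) by blast
  have "ext_single (v ` C) 1 \<in> OI"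
    using O.single_circuit[OF OI_circ[OF _ C(2)]] C assms(1) circ_nonempty[OF C(2)] by blast
  then show ?thesis
    using O.single_superset[of "v ` C" "v ` S" a] C(1) assms(1) by blast
qed

lemma module_M:
  "carrier M = oc ` Xj" "add M = set_add X"
  "smult M = (\<lambda>c x. oc (ext_single {} c) \<otimes>\<^bsub>X Quot OI\<^esub> x)"
  unfolding OS_part_def alg_module_def OS_def exterior_eq OI_def[symmetric] by (simp_all add: add_Quot)

lemma module_N:
  "carrier N' = kc ` polys H" "add N' = set_add (poly_ring H)"
  "smult N' = (\<lambda>c x. kc (pconst c) \<otimes>\<^bsub>poly_ring H Quot Ky\<^esub> x)"
  unfolding DPy_space_def alg_module_def DPy_def Ky_def[symmetric]
  by (simp_all add: add_Quot carrier_Quot poly_ring_simps)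

lemma Xj_closed:
  "(\<lambda>S. 0) \<in> Xj" "a \<in> Xj \<Longrightarrow> a' \<in> Xj \<Longrightarrow> (\<lambda>S. a S + a' S) \<in> Xj"
  "a \<in> Xj \<Longrightarrow> (\<lambda>S. c * a S) \<in> Xj" "S \<subseteq> E y \<Longrightarrow> card S = j \<Longrightarrow> ext_single (v ` S) c \<in> Xj"
proof -
  show "(\<lambda>S. 0) \<in> Xj"
    unfolding ext_alg_simps ext_homog_def by simp
  show "(\<lambda>S. a S + a' S) \<in> Xj" if "a \<in> Xj" "a' \<in> Xj"
  proof -
    have "a S \<noteq> 0 \<or> a' S \<noteq> 0" if "a S + a' S \<noteq> 0" for S
      using that by auto
    then show ?thesis
      using that unfolding ext_alg_simps ext_homog_def by blast
  qed
  show "(\<lambda>S. c * a S) \<in> Xj" if "a \<in> Xj"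
    using that unfolding ext_alg_simps ext_homog_def by simp
  show "ext_single (v ` S) c \<in> Xj" if S: "S \<subseteq> E y" "card S = j"
  proof -
    have "card (v ` S) = j"
      using card_image[OF inj_on_subset[OF inj_v subset_UNIV]] S(2) by simp
    then show ?thesis
      using ext_single_in[OF subring_set_UNIV, of "v ` S" "v ` E y" c vo] S(1)
      unfolding ext_homog_def ext_single_def by auto
  qed
qed

lemma oc_add: "a \<in> Xj \<Longrightarrow> a' \<in> Xj \<Longrightarrow> oc a \<oplus>\<^bsub>M\<^esub> oc a' = oc (\<lambda>S. a S + a' S)"
  unfolding module_M using O.a_rcos_sum[of a a'] by (simp add: ext_alg_simps(5))

lemma oc_scale: "a \<in> Xj \<Longrightarrow> c \<odot>\<^bsub>M\<^esub> oc a = oc (\<lambda>S. c * a S)"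
proof -
  assume a: "a \<in> Xj"
  have "oc (ext_single {} c) \<otimes>\<^bsub>X Quot OI\<^esub> oc a = oc (ext_single {} c \<otimes>\<^bsub>X\<^esub> a)"
    unfolding mult_Quot
    using O.rcoset_mult_add[OF ext_single_in[OF subring_set_UNIV, of "{}" _ c], of a] a by simp
  then show ?thesis
    unfolding module_M ext_alg_simps(2) using xmul_scalar[OF O.finE, of a vo UNIV c] a by simp
qed

lemma kc_add: "p \<in> polys H \<Longrightarrow> q \<in> polys H \<Longrightarrow> kc p \<oplus>\<^bsub>N'\<^esub> kc q = kc (p + q)"
  unfolding module_N using K.a_rcos_sum[of p q] by (simp add: poly_ring_simps)

lemma kc_mult: "p \<in> polys H \<Longrightarrow> q \<in> polys H \<Longrightarrow> kc p \<otimes>\<^bsub>poly_ring H Quot Ky\<^esub> kc q = kc (p * q)"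
  unfolding mult_Quot using K.rcoset_mult_add[of p q] by (simp add: poly_ring_simps)

lemma kc_scale: "p \<in> polys H \<Longrightarrow> c \<odot>\<^bsub>N'\<^esub> kc p = kc (pconst c * p)"
  unfolding module_N using kc_mult[OF pconst_in] by simp

sublocale tens M N' .

text \<open>A representative of c (a \<otimes> p): the basis of the free module is indexed by pairs
  of cosets, so a and p enter only through their classes.\<close>

definition tn :: "('a blow set \<Rightarrow> rat) \<Rightarrow> 'a qpoly \<Rightarrow> rat
    \<Rightarrow> ((('a blow set \<Rightarrow> rat) set \<times> 'a qpoly set) \<Rightarrow>\<^sub>0 rat)" where
  "tn a p c = Poly_Mapping.single (oc a, kc p) c"

lemma tn_add_left: "a \<in> Xj \<Longrightarrow> a' \<in> Xj \<Longrightarrow> p \<in> polys H \<Longrightarrow> eqv (tn (\<lambda>S. a S + a' S) p 1) (tn a p 1 + tn a' p 1)"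
  using eqv_rels(1)[of "oc a" "kc p" "oc a'"] oc_add[of a a'] unfolding module_M(1) module_N(1) tn_def by simp

lemma tn_add_right: "a \<in> Xj \<Longrightarrow> p \<in> polys H \<Longrightarrow> q \<in> polys H \<Longrightarrow> eqv (tn a (p + q) 1) (tn a p 1 + tn a q 1)"
  using eqv_rels(2)[of "oc a" "kc p" "kc q"] kc_add[of p q] unfolding module_M(1) module_N(1) tn_def by simp

lemma tn_scale_left: "a \<in> Xj \<Longrightarrow> p \<in> polys H \<Longrightarrow> eqv (tn (\<lambda>S. c * a S) p 1) (tn a p c)"
  using eqv_rels(3)[of "oc a" "kc p" c] oc_scale[of a c] unfolding module_M(1) module_N(1) tn_def by simp

lemma tn_scale_right: "a \<in> Xj \<Longrightarrow> p \<in> polys H \<Longrightarrow> eqv (tn a (pconst c * p) 1) (tn a p c)"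
  using eqv_rels(4)[of "oc a" "kc p" c] kc_scale[of p c] unfolding module_M(1) module_N(1) tn_def by simp

lemma tn_zero_left: "p \<in> polys H \<Longrightarrow> tn (\<lambda>S. 0) p 1 \<in> ker"
  using tn_scale_left[OF Xj_closed(1), of p 0] by (simp add: tn_def eqv_zero)

lemma tn_zero_right: "a \<in> Xj \<Longrightarrow> tn a 0 1 \<in> ker"
  using tn_scale_right[OF _ polys_simps(2), of a 0] by (simp add: tn_def eqv_zero)

lemma tn_OI: "a \<in> OI \<Longrightarrow> p \<in> polys H \<Longrightarrow> tn a p 1 \<in> ker"
proof -
  assume a: "a \<in> OI" and p: "p \<in> polys H"
  have "oc a = oc (\<lambda>S. 0)"
    using O.coset_eq_iff'[OF O.I_carrier[OF a] O.I_carrier[OF O.I_zero]] a by simp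
  then show ?thesis
    using tn_zero_left[OF p] unfolding tn_def by simp
qed

lemma tn_Ky: "a \<in> Xj \<Longrightarrow> p \<in> Ky \<Longrightarrow> tn a p 1 \<in> ker"
proof -
  assume a: "a \<in> Xj" and p: "p \<in> Ky"
  have "kc p = kc 0"
    using K.K_eq_iff[OF K.K_in[OF p] polys_simps(2)] p by simp
  then show ?thesis
    using tn_zero_right[OF a] unfolding tn_def by simp
qed

text \<open>Dependent sets are kept. Their monomials vanish in \<open>OS\<close>, but all monomials
  of a boundary must be present for it to become an element of the ideal of
  \<open>OS\<close>.\<close>

definition cells :: "'a set set" where
  "cells = {S. S \<subseteq> E y \<and> card S = j}"

abbreviation ev :: "'a set \<Rightarrow> 'a blow set \<Rightarrow> rat" where
  "ev S \<equiv> ext_single (v ` S) 1"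

lemma finite_cells: "finite cells"
  by (rule finite_subset[of _ "Pow (E y)"]) (auto simp: cells_def finE)

lemma ev_in: "S \<in> cells \<Longrightarrow> ev S \<in> Xj"
  unfolding cells_def using Xj_closed(4) by blast

text \<open>The component of \<open>\<Sum> f S e\<^sub>S\<close> in the summand of \<open>y\<close>.\<close>

definition T :: "('a set \<Rightarrow> 'a qpoly) \<Rightarrow> ((('a blow set \<Rightarrow> rat) set \<times> 'a qpoly set) \<Rightarrow>\<^sub>0 rat)" where
  "T f = (\<Sum>S\<in>cells. tn (ev S) (f S) 1)"

lemma R_coeff: "f \<in> carrier R \<Longrightarrow> f S \<in> polys H"
  unfolding ext_alg_simps by blast

lemma T_add:
  assumes "\<And>S. f S \<in> polys H" "\<And>S. g S \<in> polys H"
  shows "eqv (T (\<lambda>S. f S + g S)) (T f + T g)"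
  unfolding T_def sum.distrib[symmetric]
  by (rule eqv_sum) (rule tn_add_right[OF ev_in assms])

lemma T_zero: "T (\<lambda>S. 0) \<in> ker"
  unfolding T_def by (rule ker_sum) (rule tn_zero_right[OF ev_in])

lemma T_single:
  assumes "p \<in> polys H" "S \<in> cells \<Longrightarrow> tn (ev S) p 1 \<in> ker"
  shows "T (ext_single S p) \<in> ker"
  unfolding T_def
proof (rule ker_sum)
  fix S' assume S': "S' \<in> cells"
  show "tn (ev S') (ext_single S p S') 1 \<in> ker"
    using assms(2) tn_zero_right[OF ev_in[OF S']] S' by (cases "S' = S") (auto simp: ext_single_def)
qed

text \<open>The part of degree j below y of a rational combination of the e_S, with the generators
  renamed to vertices.\<close>

definition push :: "('a set \<Rightarrow> rat) \<Rightarrow> 'a blow set \<Rightarrow> rat" where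
  "push w = (\<lambda>X. \<Sum>S\<in>cells. w S * ev S X)"

text \<open>When all coefficients are rational multiples of one polynomial q, bilinearity collects
  the sum into a single pure tensor. In this form relations of the exterior factor can be
  recognized.\<close>

lemma T_const:
  assumes q: "q \<in> polys H"
  shows "eqv (T (\<lambda>S. q * pconst (w S))) (tn (push w) q 1)"
proof -
  have "eqv (\<Sum>S\<in>F. tn (ev S) (q * pconst (w S)) 1) (tn (\<lambda>X. \<Sum>S\<in>F. w S * ev S X) q 1)
      \<and> (\<lambda>X. \<Sum>S\<in>F. w S * ev S X) \<in> Xj" if "F \<subseteq> cells" for F
    using finite_subset[OF that finite_cells] that
  proof (induction F rule: finite_induct)
    case empty
    then show ?case
      using tn_zero_left[OF q] Xj_closed(1) eqv_sym eqv_zero by auto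
  next
    case (insert S F)
    then have S: "ev S \<in> Xj" and F: "(\<lambda>X. \<Sum>S\<in>F. w S * ev S X) \<in> Xj"
        "eqv (\<Sum>S\<in>F. tn (ev S) (q * pconst (w S)) 1) (tn (\<lambda>X. \<Sum>S\<in>F. w S * ev S X) q 1)"
      using ev_in by auto
    have wS: "(\<lambda>X. w S * ev S X) \<in> Xj"
      using Xj_closed(3)[OF S] .
    have "eqv (tn (ev S) (q * pconst (w S)) 1) (tn (ev S) q (w S))"
      using tn_scale_right[OF S q, of "w S"] by (simp add: mult.commute)
    also have "eqv \<dots> (tn (\<lambda>X. w S * ev S X) q 1)"
      using eqv_sym[OF tn_scale_left[OF S q]] .
    finally have "eqv (tn (ev S) (q * pconst (w S)) 1 + (\<Sum>S\<in>F. tn (ev S) (q * pconst (w S)) 1))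
        (tn (\<lambda>X. w S * ev S X) q 1 + tn (\<lambda>X. \<Sum>S\<in>F. w S * ev S X) q 1)"
      using F(2) by (rule eqv_add)
    also have "eqv \<dots> (tn (\<lambda>X. w S * ev S X + (\<Sum>S\<in>F. w S * ev S X)) q 1)"
      using eqv_sym[OF tn_add_left[OF wS F(1) q]] .
    finally show ?case
      using insert.hyps Xj_closed(2)[OF wS F(1)] by simp
  qed
  then show ?thesis
    unfolding T_def push_def by blast
qed

lemma push_eval: "push w (v ` S) = (if S \<in> cells then w S else 0)"
  and push_outside: "A \<notin> image v ` cells \<Longrightarrow> push w A = 0"
proof -
  have "push w (v ` S) = (\<Sum>S'\<in>cells. if S = S' then w S else 0)"
    unfolding push_def ext_single_def
    by (rule sum.cong) (auto simp: inj_image_eq_iff[OF inj_v])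
  then show "push w (v ` S) = (if S \<in> cells then w S else 0)"
    using finite_cells by simp
  show "push w A = 0" if "A \<notin> image v ` cells"
    unfolding push_def ext_single_def using that by (intro sum.neutral) auto
qed

lemma push_eqI:
  assumes a: "a \<in> carrier X" and w: "\<And>S. S \<subseteq> E y \<Longrightarrow> a (v ` S) = (if card S = j then w S else 0)"
  shows "push w = a"
proof
  fix A
  show "push w A = a A"
  proof (cases "A \<subseteq> v ` E y")
    case True
    then obtain S where S: "A = v ` S" "S \<subseteq> E y"
      by (meson subset_imageE)
    then show ?thesis
      unfolding S(1) push_eval w[OF S(2)] cells_def by simp
  next
    case False
    then have "A \<notin> image v ` cells"
      unfolding cells_def by blast
    moreover have "a A = 0"
      using a False unfolding ext_alg_simps by blast
    ultimately show ?thesis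
      using push_outside by simp
  qed
qed

text \<open>A circuit and the same circuit without one element have the same upper bounds, so that
  a two-sided multiple of \<open>\<partial>e\<^sub>C\<close> involves either no or only monomials below \<open>y\<close>.\<close>

lemma push_circ:
  assumes C: "circ C"
  shows "push (xmul r (xmul r (ext_single U 1) (ext_boundary r C)) (ext_single W 1)) \<in> OI"
    (is "push ?w \<in> OI")
proof -
  have supp: "\<exists>c\<in>C. finite S \<and> U \<subseteq> S \<and> W \<subseteq> S \<and> C - {c} \<subseteq> S \<and> card S = card U + (card C - 1) + card W"
    if nz: "?w S \<noteq> 0" for S
  proof -
    have fin: "finite S"
      using nz xmul_infinite by blast
    have W: "W \<subseteq> S" "xmul r (ext_single U 1) (ext_boundary r C) (S - W) \<noteq> (0::rat)"
      using nz unfolding xmul_single_right[OF fin] by (auto split: if_splits)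
    have fin': "finite (S - W)"
      using fin by simp
    have U: "U \<subseteq> S - W" "ext_boundary r C (S - W - U) \<noteq> (0::rat)"
      using W(2) unfolding xmul_single_left[OF fin'] by (auto split: if_splits)
    obtain c where c: "c \<in> C" "S - W - U = C - {c}"
      using ext_boundary_nonzero[OF U(2)] by blast
    have "card S = card W + card (S - W)" "card (S - W) = card U + card (S - W - U)"
      using W U fin fin' by (metis add_diff_inverse_nat card_Diff_subset card_mono finite_subset not_less)+
    then have "card S = card U + (card C - 1) + card W"
      unfolding c(2) using c(1) by simp
    then show ?thesis
      using c W U fin by blast
  qed
  show ?thesis
  proof (cases "U \<subseteq> E y \<and> C \<subseteq> E y \<and> W \<subseteq> E y")
    case True
    let ?a = "xmul vo (xmul vo (ext_single (v ` U) 1) (ext_boundary vo (v ` C))) (ext_single (v ` W) 1)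
        :: 'a blow set \<Rightarrow> rat"
    have a: "?a \<in> OI"
      using True by (intro O.I_xmul_right O.I_xmul_left OI_circ C ext_single_in subring_set_UNIV) auto
    have single: "(\<lambda>S. ext_single (v ` U) 1 (v ` S)) = (ext_single U 1 :: 'a set \<Rightarrow> rat)" for U
      unfolding ext_single_def by (simp add: inj_image_eq_iff[OF inj_v])
    have val: "?a (v ` S) = ?w S" for S
      by (simp add: xmul_transport[OF inj_v] ext_boundary_transport[OF inj_v] single cong: if_cong)
    show ?thesis
    \<comment> \<open>The multiple of the boundary is homogeneous of this degree, so its monomials
      all have j elements or none of them has.\<close>
    proof (cases "j = card U + (card C - 1) + card W")
      case True
      have "push ?w = ?a"
        by (rule push_eqI[OF O.I_carrier[OF a]]) (use val supp True in auto)
      then show ?thesis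
        using a by simp
    next
      case False
      have "push ?w = (\<lambda>S. 0)"
        by (rule push_eqI[OF O.I_carrier[OF O.I_zero]]) (use supp False in auto)
      then show ?thesis
        using O.I_zero by simp
    qed
  next
    case False
    have "?w S = 0" if S: "S \<subseteq> E y" for S
    proof (rule ccontr)
      assume "?w S \<noteq> 0"
      then obtain c where c: "c \<in> C" "U \<subseteq> S" "W \<subseteq> S" "C - {c} \<subseteq> S"
        using supp by blast
      have "C - {c} \<subseteq> E (J (E y))"
        using c(4) S unfolding J_E[OF yP] by blast
      then have "E (J (C - {c})) \<subseteq> E y"
        using E_J_mono[OF nested_E[OF yP]] unfolding J_E[OF yP] by blast
      then have "C \<subseteq> E y"
        using circ_closure[OF C c(1)] by blast
      then show False
        using False c S by blast
    qed
    then have "push ?w = (\<lambda>S. 0)"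
      by (intro push_eqI[OF O.I_carrier[OF O.I_zero]]) auto
    then show ?thesis
      using O.I_zero by simp
  qed
qed

text \<open>This is where \<open>rk y = j\<close> enters: an independent set below y that attains
  the rank of y must have join y.\<close>

lemma ind_cell: "S \<in> cells \<Longrightarrow> ind S \<Longrightarrow> J S = y"
  using ind_le_rank(2)[of S y] yP rky unfolding cells_def by simp

lemma nested_rep_cell:
  assumes "S \<in> cells" "ind S" "T' \<subseteq> H"
  shows "nested L H (nested_rep L H r y \<union> T') \<longleftrightarrow> nested L H (S \<union> T')"
  using nested_Un_iff[OF nested_rep_props(1)[OF yP], of S T'] nested_rep_props(2)[OF yP]
    ind_cell[OF assms(1,2)] assms(2,3) unfolding ind_def by simp

text \<open>The induction over the ideal leaves monomial multiples of the four kinds of generators.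
  Boundaries die in the \<open>OS\<close> factor, the elements \<open>c_elem\<close> in the DP_y
  factor, and relations for sets that are not nested in one of the two; since Z avoids
  \<open>E y\<close>, generators from Z meet no cell.\<close>

lemma T_rel:
  assumes Z: "Z \<subseteq> H" "Z \<inter> E y = {}" and f: "f \<in> rel Z"
  shows "T f \<in> ker"
proof -
  \<comment> \<open>That the coefficients are polynomials over H is carried along because
    \<open>T_add\<close> requires it.\<close>
  have "T f \<in> ker \<and> (\<forall>S. f S \<in> polys H)"
  proof (rule ext_Idl_induct[OF finite_H subring_polys gens_carrier[OF Z(1)] f[unfolded rel_def],
        where Q = "\<lambda>f. T f \<in> ker \<and> (\<forall>S. f S \<in> polys H)"])
    show "T (\<lambda>S. 0) \<in> ker \<and> (\<forall>S. 0 \<in> polys H)"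
      using T_zero polys_simps(2) by blast
    show "T (\<lambda>S. f S + g S) \<in> ker \<and> (\<forall>S. f S + g S \<in> polys H)"
      if "T f \<in> ker \<and> (\<forall>S. f S \<in> polys H)" "T g \<in> ker \<and> (\<forall>S. g S \<in> polys H)" for f g
    proof -
      have "eqv (T (\<lambda>S. f S + g S)) (T f + T g)"
        using T_add that by blast
      moreover have "eqv (T f + T g) 0"
        unfolding eqv_zero using that ker_add by blast
      ultimately have "eqv (T (\<lambda>S. f S + g S)) 0"
        by (rule eqv_trans)
      then show ?thesis
        using that polys_simps(3) unfolding eqv_zero by blast
    qed
    fix g U a W b
    assume g: "g \<in> gens Z" and UW: "U \<subseteq> H" "W \<subseteq> H" and ab: "a \<in> polys H" "b \<in> polys H"
    let ?f = "xmul r (xmul r (ext_single U a) g) (ext_single W b)"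
    have fin: "finite U" "finite W"
      using UW finite_H finite_subset by auto
    have "?f \<in> carrier R"
      using g gens_carrier[OF Z(1)] UW ab
      by (intro xmul_closed subring_polys ext_single_in) auto
    then have pol: "\<forall>S. ?f S \<in> polys H"
      using R_coeff by blast
    \<comment> \<open>The common case of monomial generators p e_S: a two-sided monomial multiple is
      zero or has one monomial, whose index set contains S and whose coefficient is a multiple of
      p.\<close>
    have single: "T ?f \<in> ker" if gS: "g = ext_single S p" "S \<subseteq> H" "p \<in> polys H"
      and k: "\<And>U q. S \<subseteq> U \<Longrightarrow> U \<in> cells \<Longrightarrow> q \<in> polys H \<Longrightarrow> tn (ev U) (p * q) 1 \<in> ker" for S p
    proof -
      have finS: "finite S"
        using gS finite_H finite_subset by auto
      show ?thesis
      proof (cases "U \<inter> S = {} \<and> (U \<union> S) \<inter> W = {}")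
        case True
        let ?s = "shuffle_sign r U S * shuffle_sign r (U \<union> S) W :: 'a qpoly"
        have "?f = ext_single (U \<union> S \<union> W) (p * (?s * a * b))"
          using True finS fin unfolding gS(1)
          by (simp add: xmul_single_single mult_ac)
        moreover have q: "?s * a * b \<in> polys H"
          using ab by (intro polys_simps(4) shuffle_sign_in subring_polys)
        ultimately show ?thesis
          using T_single[of "p * (?s * a * b)" "U \<union> S \<union> W"] k[of "U \<union> S \<union> W" "?s * a * b"] polys_simps(4)[OF gS(3) q]
          by auto
      next
        case False
        then have "?f = (\<lambda>S. 0)"
          using finS fin unfolding gS(1) by (auto simp: xmul_single_single)
        then show ?thesis
          using T_zero by simp
      qed
    qed
    from g have "T ?f \<in> ker"
      unfolding gens_def nested_circuit_iff
    proof (elim UnE CollectE exE conjE imageE)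
      fix S T' assume S: "g = ext_single S (x_mono T')" "S \<subseteq> H" "T' \<subseteq> H" "\<not> nested L H (S \<union> T')"
      show ?thesis
      proof (rule single[OF S(1,2) x_mono_in[OF S(3)]])
        fix U q assume U: "S \<subseteq> U" "U \<in> cells" and q: "q \<in> polys H"
        show "tn (ev U) (x_mono T' * q) 1 \<in> ker"
        \<comment> \<open>An independent U has join y, so U can replace the chosen representative of
          y and \<open>x_mono T'\<close> vanishes in DP_y. For a dependent U the factor in
          \<open>OS\<close> vanishes.\<close>
        proof (cases "ind U")
          case True
          have "\<not> nested L H (U \<union> T')"
            using S(4) nested_mono[of "U \<union> T'" "S \<union> T'"] U(1) by blast
          then have "x_mono T' \<in> Ky"
            unfolding Ky_def DPy_ideal_def using nested_rep_cell[OF U(2) True S(3)] DP_gens(1)[OF S(3)] by blast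
          then show ?thesis
            using tn_Ky[OF ev_in[OF U(2)]] K.K_mult q by blast
        next
          case False
          then have "ev U \<in> OI"
            using OI_not_ind U(2) unfolding cells_def by blast
          then show ?thesis
            using tn_OI polys_simps(4)[OF x_mono_in[OF S(3)] q] by blast
        qed
      qed
    next
      fix S assume S: "g = ext_boundary r S" "circ S"
      let ?w = "xmul r (xmul r (ext_single U 1) (ext_boundary r S)) (ext_single W 1) :: 'a set \<Rightarrow> rat"
      \<comment> \<open>Splitting off the polynomial coefficients reduces the product to a rational
        one, to which \<open>push_circ\<close> applies.\<close>
      have e: "ext_single A c = (\<lambda>S. c * pconst (ext_single A 1 S))" for A and c :: "'a qpoly"
        unfolding pconst_single by (auto simp: ext_single_def pconst_simps)
      have "?f = xmul r (xmul r (\<lambda>S. a * pconst (ext_single U 1 S)) (\<lambda>A. pconst (ext_boundary r S A)))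
          (\<lambda>S. b * pconst (ext_single W 1 S))"
        by (simp only: S(1) pconst_boundary e[of U a, symmetric] e[of W b, symmetric])
      also have "\<dots> = (\<lambda>A. (a * b) * pconst (?w A))"
      proof
        fix A
        show "xmul r (xmul r (\<lambda>S. a * pconst (ext_single U 1 S)) (\<lambda>A. pconst (ext_boundary r S A)))
            (\<lambda>S. b * pconst (ext_single W 1 S)) A = (a * b) * pconst (?w A)"
          unfolding xmul_scale_right pconst_xmul xmul_scale_left[abs_def] xmul_scale_left
          by (simp add: mult_ac)
      qed
      finally have f: "?f = (\<lambda>A. (a * b) * pconst (?w A))" .
      have "eqv (T ?f) (tn (push ?w) (a * b) 1)"
        unfolding f by (rule T_const) (rule polys_simps(4)[OF ab])
      moreover have "tn (push ?w) (a * b) 1 \<in> ker"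
        by (rule tn_OI[OF push_circ[OF S(2)] polys_simps(4)[OF ab]])
      ultimately show ?thesis
        using eqv_trans eqv_zero by blast
    next
      fix h assume h: "g = ext_single {} (c_elem L H h)" "h \<in> atoms L"
      show ?thesis
      proof (rule single[OF h(1) _ c_elem_in])
        fix U q assume U: "U \<in> cells" and q: "q \<in> polys H"
        have "c_elem L H h \<in> Ky"
          unfolding Ky_def DPy_ideal_def using DP_gens(2)[OF h(2)] .
        then show "tn (ev U) (c_elem L H h * q) 1 \<in> ker"
          using tn_Ky[OF ev_in[OF U]] K.K_mult q by blast
      qed simp
    next
      fix z assume z: "g = ext_single {z} 1" "z \<in> Z"
      show ?thesis
      proof (rule single[OF z(1) _ polys_simps(1)])
        fix U q assume U: "{z} \<subseteq> U" "U \<in> cells"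
        then show "tn (ev U) (1 * q) 1 \<in> ker"
          using z(2) Z(2) unfolding cells_def by blast
      qed (use z Z in blast)
    qed
    then show "T ?f \<in> ker \<and> (\<forall>S. ?f S \<in> polys H)"
      using pol by blast
  qed
  then show ?thesis by blast
qed

end


section \<open>Lifting tensors to the free algebra\<close>

context nested_cell
begin

definition ra :: "('a blow set \<Rightarrow> rat) set \<Rightarrow> 'a blow set \<Rightarrow> rat" where
  "ra A = (SOME a. a \<in> Xj \<and> oc a = A)"

text \<open>The set V restricts the choice of representatives, so that a class of degree i can be
  lifted to a polynomial of degree i.\<close>

definition rb :: "'a qpoly set \<Rightarrow> 'a qpoly set \<Rightarrow> 'a qpoly" where
  "rb V B = (SOME p. p \<in> V \<and> kc p = B)"

lemma ra:
  assumes "A \<in> carrier M"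
  shows "ra A \<in> Xj \<and> oc (ra A) = A"
proof -
  obtain a where "a \<in> Xj \<and> oc a = A"
    using assms unfolding module_M(1) by auto
  then show ?thesis
    unfolding ra_def by (rule someI[of "\<lambda>a. a \<in> Xj \<and> oc a = A"])
qed

lemma rb:
  assumes "B \<in> kc ` V"
  shows "rb V B \<in> V \<and> kc (rb V B) = B"
proof -
  obtain p where "p \<in> V \<and> kc p = B"
    using assms by auto
  then show ?thesis
    unfolding rb_def by (rule someI)
qed

text \<open>The lift of a \<otimes> p: generators are renamed back from vertices to elements of H,
  and p becomes a factor of every coefficient.\<close>

definition psi :: "('a blow set \<Rightarrow> rat) \<Rightarrow> 'a qpoly \<Rightarrow> 'a set \<Rightarrow> 'a qpoly" where
  "psi a p S = (if S \<in> cells then pconst (a (v ` S)) * p else 0)"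

definition hpsi :: "'a qpoly set \<Rightarrow> 'a set \<Rightarrow> ('a blow set \<Rightarrow> rat) set \<times> 'a qpoly set \<Rightarrow> rat \<Rightarrow> 'a qpoly" where
  "hpsi V S k c = pconst c * psi (ra (fst k)) (rb V (snd k)) S"

text \<open>The inverse of \<open>T\<close> up to relations, computed from chosen representatives.\<close>

definition Psi :: "'a qpoly set \<Rightarrow> ((('a blow set \<Rightarrow> rat) set \<times> 'a qpoly set) \<Rightarrow>\<^sub>0 rat)
    \<Rightarrow> 'a set \<Rightarrow> 'a qpoly" where
  "Psi V t S = lext (hpsi V S) t"

lemma lext_hpsi: "lext_fun (hpsi V S)"
  by unfold_locales (simp add: hpsi_def pconst_simps algebra_simps)

lemma Psi_add: "Psi V (s + t) = (\<lambda>S. Psi V s S + Psi V t S)"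
  and Psi_diff: "Psi V (s - t) = (\<lambda>S. Psi V s S - Psi V t S)"
  and Psi_zero: "Psi V 0 = (\<lambda>S. 0)"
  and Psi_single: "Psi V (Poly_Mapping.single (A, B) c) = (\<lambda>S. pconst c * psi (ra A) (rb V B) S)"
  and Psi_sum: "Psi V (sum g I) = (\<lambda>S. \<Sum>i\<in>I. Psi V (g i) S)"
  unfolding Psi_def fun_eq_iff
  by (simp_all add: lext_fun.lext_add[OF lext_hpsi] lext_fun.lext_diff[OF lext_hpsi]
      lext_fun.lext_zero[OF lext_hpsi] lext_fun.lext_single[OF lext_hpsi] lext_fun.lext_sum[OF lext_hpsi] hpsi_def)

lemma Psi_scale: "Psi V (Poly_Mapping.map ((*) c) t) = (\<lambda>S. pconst c * Psi V t S)"
proof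
  fix S
  have "Poly_Mapping.keys (Poly_Mapping.map ((*) c) t) \<subseteq> Poly_Mapping.keys t"
    by (auto simp: in_keys_iff lookup_scale)
  then have "Psi V (Poly_Mapping.map ((*) c) t) S
      = (\<Sum>k\<in>Poly_Mapping.keys t. hpsi V S k (Poly_Mapping.lookup (Poly_Mapping.map ((*) c) t) k))"
    unfolding Psi_def by (intro lext_fun.lext_superset[OF lext_hpsi]) auto
  also have "\<dots> = pconst c * Psi V t S"
    unfolding Psi_def lext_def by (simp add: lookup_scale hpsi_def pconst_simps sum_distrib_left mult_ac)
  finally show "Psi V (Poly_Mapping.map ((*) c) t) S = pconst c * Psi V t S" .
qed

lemma psi_add_left: "psi (\<lambda>A. a A + a' A) p S = psi a p S + psi a' p S"
  and psi_scale_left: "psi (\<lambda>A. c * a A) p S = pconst c * psi a p S"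
  and psi_diff_left: "psi (\<lambda>A. a A - a' A) p S = psi a p S - psi a' p S"
  and psi_add_right: "psi a (p + q) S = psi a p S + psi a q S"
  and psi_diff_right: "psi a (p - q) S = psi a p S - psi a q S"
  and psi_scale_right: "psi a (pconst c * p) S = pconst c * psi a p S"
  unfolding psi_def by (auto simp: pconst_simps algebra_simps)

lemma psi_in: "p \<in> polys H \<Longrightarrow> psi a p S \<in> polys H"
  unfolding psi_def using polys_simps(2) polys_simps(4)[OF pconst_in] by auto

lemma T_sum: "finite F \<Longrightarrow> (\<And>k S. k \<in> F \<Longrightarrow> g k S \<in> polys H) \<Longrightarrow>
    eqv (T (\<lambda>S. \<Sum>k\<in>F. g k S)) (\<Sum>k\<in>F. T (g k))"
proof (induction F rule: finite_induct)
  case empty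
  then show ?case
    using T_zero by (simp add: eqv_zero)
next
  case (insert k F)
  have "eqv (T (\<lambda>S. g k S + (\<Sum>k\<in>F. g k S))) (T (g k) + T (\<lambda>S. \<Sum>k\<in>F. g k S))"
    using insert.prems by (intro T_add polys_simps(8)) auto
  also have "eqv \<dots> (T (g k) + (\<Sum>k\<in>F. T (g k)))"
    using insert by (intro eqv_add eqv_refl) auto
  finally show ?case
    using insert.hyps by simp
qed

lemma T_cong: "(\<And>S. S \<in> cells \<Longrightarrow> f S = g S) \<Longrightarrow> T f = T g"
  unfolding T_def by (rule sum.cong) auto

lemma T_psi:
  assumes a: "a \<in> Xj" and p: "p \<in> polys H"
  shows "eqv (T (\<lambda>S. pconst c * psi a p S)) (tn a p c)"
proof -
  have "push (\<lambda>S. c * a (v ` S)) = (\<lambda>A. c * a A)"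
  proof (rule push_eqI)
    show "(\<lambda>A. c * a A) \<in> carrier X"
      using Xj_closed(3)[OF a] by blast
    fix S
    have "card (v ` S) = card S"
      using card_image[OF inj_on_subset[OF inj_v subset_UNIV]] .
    then show "c * a (v ` S) = (if card S = j then c * a (v ` S) else 0)"
      using a unfolding ext_homog_def by auto
  qed
  moreover have "T (\<lambda>S. pconst c * psi a p S) = T (\<lambda>S. p * pconst (c * a (v ` S)))"
    by (rule T_cong) (simp add: psi_def pconst_simps mult_ac)
  ultimately have "eqv (T (\<lambda>S. pconst c * psi a p S)) (tn (\<lambda>A. c * a A) p 1)"
    using T_const[OF p, of "\<lambda>S. c * a (v ` S)"] by simp
  also have "eqv \<dots> (tn a p c)"
    by (rule tn_scale_left[OF a p])
  finally show ?thesis .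
qed

text \<open>The half of the inverse property that gives surjectivity. It uses only that the chosen
  representatives lie in the right cosets.\<close>

lemma T_Psi:
  assumes V: "V \<subseteq> polys H" and t: "Poly_Mapping.keys t \<subseteq> carrier M \<times> kc ` V"
  shows "eqv (T (Psi V t)) t"
proof -
  let ?g = "\<lambda>k S. pconst (Poly_Mapping.lookup t k) * psi (ra (fst k)) (rb V (snd k)) S"
  have rep: "ra (fst k) \<in> Xj" "oc (ra (fst k)) = fst k" "rb V (snd k) \<in> V" "kc (rb V (snd k)) = snd k"
    if "k \<in> Poly_Mapping.keys t" for k
    using ra[of "fst k"] rb[of "snd k" V] t that by auto
  have "Psi V t = (\<lambda>S. \<Sum>k\<in>Poly_Mapping.keys t. ?g k S)"
    unfolding Psi_def lext_def hpsi_def ..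
  then have "eqv (T (Psi V t)) (\<Sum>k\<in>Poly_Mapping.keys t. T (?g k))"
    using rep(3) V by (simp only:) (intro T_sum polys_simps(4) pconst_in psi_in, auto)
  also have "eqv \<dots> (\<Sum>k\<in>Poly_Mapping.keys t. Poly_Mapping.single k (Poly_Mapping.lookup t k))"
  proof (rule eqv_sum)
    fix k assume k: "k \<in> Poly_Mapping.keys t"
    have "eqv (T (?g k)) (tn (ra (fst k)) (rb V (snd k)) (Poly_Mapping.lookup t k))"
      using T_psi rep(1,3)[OF k] V by blast
    then show "eqv (T (?g k)) (Poly_Mapping.single k (Poly_Mapping.lookup t k))"
      unfolding tn_def rep(2,4)[OF k] by simp
  qed
  also have "(\<Sum>k\<in>Poly_Mapping.keys t. Poly_Mapping.single k (Poly_Mapping.lookup t k)) = t"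
    using pm_decompose[of t] by simp
  finally show ?thesis .
qed

text \<open>The values of f at dependent cells do not matter, and an independent cell has join y. So
  values prescribed for different y cannot conflict.\<close>

lemma T_cong_ind:
  assumes "\<And>S. S \<in> cells \<Longrightarrow> ind S \<Longrightarrow> f S = g S" "\<And>S. f S \<in> polys H" "\<And>S. g S \<in> polys H"
  shows "eqv (T f) (T g)"
  unfolding T_def
proof (rule eqv_sum)
  fix S assume S: "S \<in> cells"
  show "eqv (tn (ev S) (f S) 1) (tn (ev S) (g S) 1)"
  proof (cases "ind S")
    case False
    then have "ev S \<in> OI"
      using OI_not_ind S unfolding cells_def by blast
    then have "tn (ev S) (f S) 1 \<in> ker" "tn (ev S) (g S) 1 \<in> ker"
      using tn_OI assms(2,3) by blast+
    then show ?thesis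
      using ker_add[OF _ ker_minus] unfolding eqv_def by force
  qed (use assms(1) S in simp)
qed

lemma Psi_in:
  assumes V: "\<And>p q. p \<in> V \<Longrightarrow> q \<in> V \<Longrightarrow> p + q \<in> V" "\<And>c p. p \<in> V \<Longrightarrow> pconst c * p \<in> V" "0 \<in> V"
    and t: "Poly_Mapping.keys t \<subseteq> carrier M \<times> kc ` V"
  shows "Psi V t S \<in> V"
proof -
  have "hpsi V S k c \<in> V" if "k \<in> Poly_Mapping.keys t" for k c
    using rb[of "snd k" V] t that V(2,3) unfolding hpsi_def psi_def by auto
  moreover have "sum g F \<in> V" if "\<And>k. k \<in> F \<Longrightarrow> g k \<in> V" for g :: "(('a blow set \<Rightarrow> rat) set \<times> 'a qpoly set) \<Rightarrow> 'a qpoly" and F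
    using that V(1,3) by (induction F rule: infinite_finite_induct) auto
  ultimately show ?thesis
    unfolding Psi_def lext_def by simp
qed

section \<open>The module structure of a summand\<close>

definition act :: "'a qpoly set \<Rightarrow> ((('a blow set \<Rightarrow> rat) set \<times> 'a qpoly set) \<Rightarrow>\<^sub>0 rat)
    \<Rightarrow> ((('a blow set \<Rightarrow> rat) set \<times> 'a qpoly set) \<Rightarrow>\<^sub>0 rat)" where
  "act F t = lext (\<lambda>k. Poly_Mapping.single (fst k, DPy_act L H r y F (snd k))) t"

lemma lext_act: "lext_fun (\<lambda>k. Poly_Mapping.single (fst k, DPy_act L H r y F (snd k)))"
  by unfold_locales (simp add: single_add)

definition cls :: "((('a blow set \<Rightarrow> rat) set \<times> 'a qpoly set) \<Rightarrow>\<^sub>0 rat)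
    \<Rightarrow> ((('a blow set \<Rightarrow> rat) set \<times> 'a qpoly set) \<Rightarrow>\<^sub>0 rat) set" where
  "cls t = (\<lambda>k. k + t) ` ker"

abbreviation "FM \<equiv> free_module (carrier M) (carrier N') (DPy_act L H r y)"

lemma cls_eq: "ker +>\<^bsub>FM\<^esub> t = cls t"
  unfolding cls_def a_r_coset_def r_coset_def free_module_def by auto

lemma cls_eq_iff: "cls s = cls t \<longleftrightarrow> eqv s t"
proof
  assume "cls s = cls t"
  moreover have "s \<in> cls s"
    unfolding cls_def using ker_zero by force
  ultimately show "eqv s t"
    unfolding cls_def eqv_def by auto
next
  have sub: "cls s \<subseteq> cls t" if st: "eqv s t" for s t
  proof
    fix x assume "x \<in> cls s"
    then obtain k where k: "k \<in> ker" "x = k + s"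
      unfolding cls_def by blast
    have "k + (s - t) \<in> ker"
      using ker_add[OF k(1)] st unfolding eqv_def by blast
    moreover have "x = (k + (s - t)) + t"
      using k(2) by simp
    ultimately show "x \<in> cls t"
      unfolding cls_def by blast
  qed
  assume "eqv s t"
  then show "cls s = cls t"
    using sub eqv_sym by blast
qed

lemma cls_self: "t \<in> cls t"
  unfolding cls_def using ker_zero by force

lemma cls_add: "set_add FM (cls s) (cls t) = cls (s + t)"
proof -
  have "set_add FM (cls s) (cls t) = {a + b | a b. a \<in> cls s \<and> b \<in> cls t}"
    unfolding set_add_def set_mult_def free_module_def by auto
  also have "\<dots> = cls (s + t)"
  proof (intro equalityI subsetI)
    fix x assume "x \<in> {a + b | a b. a \<in> cls s \<and> b \<in> cls t}"
    then obtain k l where "k \<in> ker" "l \<in> ker" "x = (k + s) + (l + t)"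
      unfolding cls_def by blast
    moreover from this have "x = (k + l) + (s + t)"
      by (simp add: algebra_simps)
    ultimately show "x \<in> cls (s + t)"
      unfolding cls_def using ker_add by blast
  next
    fix x assume "x \<in> cls (s + t)"
    then obtain k where k: "k \<in> ker" "x = k + (s + t)"
      unfolding cls_def by blast
    then have "x = (k + s) + t" "k + s \<in> cls s"
      unfolding cls_def by (auto simp: algebra_simps)
    then show "x \<in> {a + b | a b. a \<in> cls s \<and> b \<in> cls t}"
      using cls_self by blast
  qed
  finally show ?thesis .
qed

lemma FM_smult: "smult FM F t = act F t"
  unfolding free_module_def act_def lext_def by (simp add: split_beta)

lemma DPy_act_kc:
  assumes q: "q \<in> polys H" and p: "p \<in> polys H"
  shows "DPy_act L H r y (DP_ideal L H {} +>\<^bsub>poly_ring H\<^esub> q) (kc p) = kc (q * p)"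
proof -
  interpret D: poly_ideal H "DP_ideal L H {}"
    by (rule poly_ideal_DP)
  \<comment> \<open>Enlarging a set that is not nested by the representative of y keeps it not
    nested, so DP_y is a quotient of \<open>DP\<close> and the action is well defined.\<close>
  have sub: "DP_ideal L H {} \<subseteq> Ky"
  proof (rule DP_ideal_le)
    show "x_mono T' \<in> Ky" if "T' \<subseteq> H" "\<not> nested L H ({} \<union> T')" for T'
    proof -
      have "\<not> nested L H (nested_rep L H r y \<union> T')"
        using that(2) nested_mono[of "nested_rep L H r y \<union> T'" "{} \<union> T'"] by blast
      then show ?thesis
        unfolding Ky_def DPy_ideal_def using DP_gens(1)[OF that(1)] by blast
    qed
    show "c_elem L H g \<in> Ky" if "g \<in> atoms L" for g
      unfolding Ky_def DPy_ideal_def by (rule DP_gens(2)[OF that])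
  qed (use K.K_zero K.K_add K.K_mult' K.K_in in auto)
  have "coset_map (poly_ring H) Ky (\<lambda>f. f) (DP_ideal L H {} +>\<^bsub>poly_ring H\<^esub> q) = kc q"
  proof (rule coset_map_eqI[OF K.idlK])
    show "q \<in> DP_ideal L H {} +>\<^bsub>poly_ring H\<^esub> q"
      using D.a_rcos_self[of q] q by (simp add: poly_ring_simps)
    fix g assume g: "g \<in> DP_ideal L H {} +>\<^bsub>poly_ring H\<^esub> q"
    then obtain d where d: "d \<in> DP_ideal L H {}" "g = d + q"
      unfolding a_r_coset_def r_coset_def by (auto simp: poly_ring_simps)
    then have gp: "g \<in> polys H"
      using polys_simps(3)[OF D.K_in[OF d(1)] q] by simp
    have "g \<ominus>\<^bsub>poly_ring H\<^esub> q = d"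
      using a_minus_poly_ring[OF gp q] d(2) by simp
    then show "g \<in> carrier (poly_ring H) \<and> g \<ominus>\<^bsub>poly_ring H\<^esub> q \<in> Ky"
      using gp d(1) sub by (auto simp: poly_ring_simps)
  qed
  then show ?thesis
    unfolding DPy_act_def DPy_def Ky_def[symmetric] using kc_mult[OF q p] by simp
qed

lemma act_T:
  assumes q: "q \<in> polys H" and f: "\<And>S. f S \<in> polys H"
  shows "act (DP_ideal L H {} +>\<^bsub>poly_ring H\<^esub> q) (T f) = T (\<lambda>S. q * f S)"
  unfolding act_def T_def lext_fun.lext_sum[OF lext_act] tn_def lext_fun.lext_single[OF lext_act]
  by (simp add: DPy_act_kc[OF q f])

text \<open>Multiplication by q acts on the second factor only and is additive and rational-linear
  there, so it sends each bilinearity relation to one of the same kind.\<close>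

lemma act_ker:
  assumes q: "q \<in> polys H" and t: "t \<in> ker"
  shows "act (DP_ideal L H {} +>\<^bsub>poly_ring H\<^esub> q) t \<in> ker"
proof -
  let ?F = "DP_ideal L H {} +>\<^bsub>poly_ring H\<^esub> q"
  note lin = lext_fun.lext_add[OF lext_act] lext_fun.lext_diff[OF lext_act] lext_fun.lext_single[OF lext_act]
  have "ker \<subseteq> {t. act ?F t \<in> ker}"
  proof (rule ker_le)
    have N: "\<exists>p\<in>polys H. b = kc p" if "b \<in> carrier N'" for b
      using that unfolding module_N(1) by blast
    have kN: "kc p \<in> carrier N'" if "p \<in> polys H" for p
      using that unfolding module_N(1) by blast
    have e1: "act ?F (Poly_Mapping.single (a \<oplus>\<^bsub>M\<^esub> a', b) 1 - Poly_Mapping.single (a, b) 1 - Poly_Mapping.single (a', b) 1) \<in> ker"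
      if ab: "a \<in> carrier M" "a' \<in> carrier M" "b \<in> carrier N'" for a a' b
    proof -
      obtain p where p: "p \<in> polys H" "b = kc p"
        using N ab(3) by blast
      show ?thesis
        using eqv_rels(1)[OF ab(1) kN[OF polys_simps(4)[OF q p(1)]] ab(2)]
        unfolding act_def lin p(2) by (simp add: DPy_act_kc[OF q p(1)] eqv_def diff_diff_eq)
    qed
    have e2: "act ?F (Poly_Mapping.single (a, b \<oplus>\<^bsub>N'\<^esub> b') 1 - Poly_Mapping.single (a, b) 1 - Poly_Mapping.single (a, b') 1) \<in> ker"
      if ab: "a \<in> carrier M" "b \<in> carrier N'" "b' \<in> carrier N'" for a b b'
    proof -
      obtain p p' where p: "p \<in> polys H" "b = kc p" "p' \<in> polys H" "b' = kc p'"
        using N ab(2,3) by meson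
      have s: "kc p \<oplus>\<^bsub>N'\<^esub> kc p' = kc (p + p')" "kc (q * p) \<oplus>\<^bsub>N'\<^esub> kc (q * p') = kc (q * (p + p'))"
        using kc_add[OF p(1,3)] kc_add[OF polys_simps(4)[OF q p(1)] polys_simps(4)[OF q p(3)]]
        by (simp_all add: distrib_left)
      show ?thesis
        using eqv_rels(2)[OF ab(1) kN[OF polys_simps(4)[OF q p(1)]] kN[OF polys_simps(4)[OF q p(3)]]]
        unfolding act_def lin p(2,4) s
        by (simp add: DPy_act_kc[OF q] p polys_simps(3) eqv_def diff_diff_eq)
    qed
    have e3: "act ?F (Poly_Mapping.single (c \<odot>\<^bsub>M\<^esub> a, b) 1 - Poly_Mapping.single (a, b) c) \<in> ker"
      if ab: "a \<in> carrier M" "b \<in> carrier N'" for a b c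
    proof -
      obtain p where p: "p \<in> polys H" "b = kc p"
        using N ab(2) by blast
      show ?thesis
        using eqv_rels(3)[OF ab(1) kN[OF polys_simps(4)[OF q p(1)]], of c]
        unfolding act_def lin p(2) by (simp add: DPy_act_kc[OF q p(1)] eqv_def)
    qed
    have e4: "act ?F (Poly_Mapping.single (a, c \<odot>\<^bsub>N'\<^esub> b) 1 - Poly_Mapping.single (a, b) c) \<in> ker"
      if ab: "a \<in> carrier M" "b \<in> carrier N'" for a b c
    proof -
      obtain p where p: "p \<in> polys H" "b = kc p"
        using N ab(2) by blast
      have s: "c \<odot>\<^bsub>N'\<^esub> kc p = kc (pconst c * p)" "c \<odot>\<^bsub>N'\<^esub> kc (q * p) = kc (q * (pconst c * p))"
        using kc_scale[OF p(1)] kc_scale[OF polys_simps(4)[OF q p(1)]] by (simp_all add: mult_ac)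
      show ?thesis
        using eqv_rels(4)[OF ab(1) kN[OF polys_simps(4)[OF q p(1)]], of c]
        unfolding act_def lin p(2) s
        by (simp add: DPy_act_kc[OF q] p(1) polys_simps(4)[OF pconst_in p(1)] eqv_def)
    qed
    show "tensor_rels M N' \<subseteq> {t. act ?F t \<in> ker}"
      unfolding tensor_rels_def Let_def using e1 e2 e3 e4 by (auto simp only: mem_Collect_eq)
    show "0 \<in> {t. act ?F t \<in> ker}"
      unfolding act_def using ker_zero by (simp add: lext_fun.lext_zero[OF lext_act])
    show "s + t \<in> {t. act ?F t \<in> ker}" if "s \<in> {t. act ?F t \<in> ker}" "t \<in> {t. act ?F t \<in> ker}" for s t
      using that ker_add unfolding act_def by (simp add: lin)
    show "Poly_Mapping.map ((*) c) t \<in> {t. act ?F t \<in> ker}" if "t \<in> {t. act ?F t \<in> ker}" for c t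
    proof -
      have "Poly_Mapping.keys (Poly_Mapping.map ((*) c) t) \<subseteq> Poly_Mapping.keys t"
        by (auto simp: in_keys_iff lookup_scale)
      then have "act ?F (Poly_Mapping.map ((*) c) t) = (\<Sum>k\<in>Poly_Mapping.keys t.
          Poly_Mapping.single (fst k, DPy_act L H r y ?F (snd k)) (Poly_Mapping.lookup (Poly_Mapping.map ((*) c) t) k))"
        unfolding act_def by (intro lext_fun.lext_superset[OF lext_act]) auto
      also have "\<dots> = Poly_Mapping.map ((*) c) (act ?F t)"
        unfolding act_def lext_def module.scale_sum_right[OF pm_module] scale_single lookup_scale ..
      finally show ?thesis
        using that ker_scale by simp
    qed
  qed
  then show ?thesis
    using t by blast
qed

lemma act_cls:
  assumes q: "q \<in> polys H"
  shows "(\<Union>x\<in>cls t. cls (act (DP_ideal L H {} +>\<^bsub>poly_ring H\<^esub> q) x))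
    = cls (act (DP_ideal L H {} +>\<^bsub>poly_ring H\<^esub> q) t)" (is "(\<Union>x\<in>_. cls (act ?F x)) = _")
proof -
  have "cls (act ?F x) = cls (act ?F t)" if x: "x \<in> cls t" for x
  proof -
    obtain k where k: "k \<in> ker" "x = k + t"
      using x unfolding cls_def by blast
    have "act ?F x = act ?F k + act ?F t"
      unfolding k(2) act_def by (rule lext_fun.lext_add[OF lext_act])
    then show ?thesis
      unfolding cls_eq_iff eqv_def using act_ker[OF q k(1)] by simp
  qed
  then show ?thesis
    using cls_self[of t] by blast
qed

lemma OS_DPy_simps:
  "carrier (OS_DPy L H r j y) = cls ` {t. Poly_Mapping.keys t \<subseteq> carrier M \<times> carrier N'}"
  "cls s \<oplus>\<^bsub>OS_DPy L H r j y\<^esub> cls t = cls (s + t)"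
  "\<zero>\<^bsub>OS_DPy L H r j y\<^esub> = cls 0"
  "q \<in> polys H \<Longrightarrow> (DP_ideal L H {} +>\<^bsub>poly_ring H\<^esub> q) \<odot>\<^bsub>OS_DPy L H r j y\<^esub> cls t
      = cls (act (DP_ideal L H {} +>\<^bsub>poly_ring H\<^esub> q) t)"
  unfolding OS_DPy_def tensor_def quot_module_def ker_def[symmetric] cls_eq FM_smult
  using cls_add act_cls
  by (auto simp: A_RCOSETS_def' cls_eq cls_def) (auto simp: free_module_def)

lemma OS_DPy_part_eq: "OS_DPy_part L H r i j y
    = cls ` {t. Poly_Mapping.keys t \<subseteq> carrier M \<times> kc ` {p \<in> polys H. poly_homog i p}}"
  unfolding OS_DPy_part_def tensor_part_def ker_def[symmetric] cls_eq DPy_part_def Ky_def[symmetric] ..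

lemma T_keys:
  assumes "\<And>S. f S \<in> V"
  shows "Poly_Mapping.keys (T f) \<subseteq> carrier M \<times> kc ` V"
proof -
  have "Poly_Mapping.keys (sum g F) \<subseteq> (\<Union>k\<in>F. Poly_Mapping.keys (g k))" if "finite F"
    for g :: "'a set \<Rightarrow> (('a blow set \<Rightarrow> rat) set \<times> 'a qpoly set) \<Rightarrow>\<^sub>0 rat" and F
    using that
  proof (induction F rule: finite_induct)
    case (insert x F)
    then show ?case
      using keys_add[of "g x" "sum g F"] by auto
  qed simp
  then have "Poly_Mapping.keys (T f) \<subseteq> (\<Union>S\<in>cells. Poly_Mapping.keys (tn (ev S) (f S) 1))"
    unfolding T_def using finite_cells by blast
  also have "\<dots> \<subseteq> carrier M \<times> kc ` V"
    unfolding tn_def module_M(1) using ev_in assms by auto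
  finally show ?thesis .
qed

end

section \<open>Relations of a summand hold in the whole algebra\<close>

context nested_rel
begin

text \<open>The polynomials d with d e_S in \<open>rel Z\<close> form an ideal; \<open>imp\<close>
  says that it contains the monomial generators belonging to S', and the elements
  \<open>c_elem\<close> are relations without any e.\<close>

lemma rel_single_DP:
  assumes S: "S \<subseteq> H" and imp: "\<And>T. T \<subseteq> H \<Longrightarrow> \<not> nested L H (S' \<union> T) \<Longrightarrow> \<not> nested L H (S \<union> T)"
    and d: "d \<in> DP_ideal L H S'"
  shows "ext_single S d \<in> rel Z"
proof -
  have finS: "finite S"
    using S finite_H finite_subset by blast
  have "DP_ideal L H S' \<subseteq> {k \<in> polys H. ext_single S k \<in> rel Z}"
  proof (rule DP_ideal_le)
    have "ext_single S 0 = (\<lambda>S :: 'a set. 0 :: 'a qpoly)"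
      unfolding ext_single_def by auto
    then show "0 \<in> {k \<in> polys H. ext_single S k \<in> rel Z}"
      using B.I_zero by (simp add: polys_simps(2))
    show "p + q \<in> {k \<in> polys H. ext_single S k \<in> rel Z}"
      if "p \<in> {k \<in> polys H. ext_single S k \<in> rel Z}" "q \<in> {k \<in> polys H. ext_single S k \<in> rel Z}" for p q
    proof -
      have "ext_single S (p + q) = (\<lambda>U. ext_single S p U + ext_single S q U)"
        unfolding ext_single_def by auto
      then show ?thesis
        using that B.I_add[of "ext_single S p" "ext_single S q"] polys_simps(3)[of p H q] by simp
    qed
    show "q * p \<in> {k \<in> polys H. ext_single S k \<in> rel Z}"
      if "p \<in> {k \<in> polys H. ext_single S k \<in> rel Z}" "q \<in> polys H" for p q
    proof -
      have "ext_single S (q * p) = (\<lambda>U. q * ext_single S p U)"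
        unfolding ext_single_def by auto
      then show ?thesis
        using that B.I_scale[of "ext_single S p" q] polys_simps(4)[of q H p] by simp
    qed
    show "x_mono T \<in> {k \<in> polys H. ext_single S k \<in> rel Z}"
      if T: "T \<subseteq> H" "\<not> nested L H (S' \<union> T)" for T
      using rel_nonnested[OF S T(1) imp[OF T]] x_mono_in[OF T(1)] by simp
    show "c_elem L H g \<in> {k \<in> polys H. ext_single S k \<in> rel Z}" if g: "g \<in> atoms L" for g
    proof -
      have "xmul r (ext_single S 1) (ext_single {} (c_elem L H g)) \<in> rel Z"
        by (intro B.I_xmul_left rel_atom[OF g] ext_single_in[OF subring_polys S polys_simps(1)])
      moreover have "xmul r (ext_single S 1) (ext_single {} (c_elem L H g)) = ext_single S (c_elem L H g)"
        using finS by (simp add: xmul_single_single)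
      ultimately show ?thesis
        using c_elem_in by simp
    qed
  qed auto
  then show ?thesis
    using d by blast
qed

end

locale nested_cell_rel = nested_cell L H r y j + nested_rel L H r Z
  for L :: "'a gorder" (structure) and H r y j Z
begin

text \<open>Renames the exterior algebra below y back into the free algebra, with constant
  coefficients. It is multiplicative because a subset of \<open>E y\<close> splits only into subsets
  of \<open>E y\<close>.\<close>

definition emb :: "('a blow set \<Rightarrow> rat) \<Rightarrow> 'a set \<Rightarrow> 'a qpoly" where
  "emb d S = (if S \<subseteq> E y then pconst (d (v ` S)) else 0)"

lemma emb_in: "emb d \<in> carrier R"
  unfolding emb_def ext_alg_simps
  by (auto simp: pconst_in polys_simps(2) dest: subsetD[OF E_sub] split: if_splits)

lemma emb_xmul: "emb (xmul vo d d') = xmul r (emb d) (emb d')"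
proof
  fix S
  show "emb (xmul vo d d') S = xmul r (emb d) (emb d') S"
  proof (cases "S \<subseteq> E y")
    case True
    have "xmul r (emb d) (emb d') S = xmul r (\<lambda>S. pconst (d (v ` S))) (\<lambda>S. pconst (d' (v ` S))) S"
      unfolding xmul_def by (rule sum.cong) (use True in \<open>auto simp: emb_def\<close>)
    then show ?thesis
      using True unfolding emb_def xmul_transport[OF inj_v] pconst_xmul by simp
  next
    case False
    have "xmul r (emb d) (emb d') S = 0"
    proof (rule ccontr)
      assume "xmul r (emb d) (emb d') S \<noteq> 0"
      then obtain U where U: "U \<subseteq> S" "emb d U \<noteq> 0" "emb d' (S - U) \<noteq> 0"
        using xmul_nonzero by blast
      then have "U \<subseteq> E y" "S - U \<subseteq> E y"
        unfolding emb_def by (auto split: if_splits)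
      then show False
        using False by blast
    qed
    then show ?thesis
      using False unfolding emb_def by simp
  qed
qed

text \<open>A circuit below y is a circuit of the whole complex, so \<open>emb\<close> sends the
  generators of the ideal to relations, and multiplicativity does the rest.\<close>

lemma emb_OI:
  assumes d: "d \<in> OI"
  shows "emb d \<in> rel Z"
proof (rule ext_Idl_induct[OF O.finE subring_set_UNIV OI_gens d[unfolded OI_eq], where Q = "\<lambda>d. emb d \<in> rel Z"])
  have "emb (\<lambda>S. 0) = (\<lambda>S. 0)"
    unfolding emb_def by (auto simp: pconst_simps)
  then show "emb (\<lambda>S. 0) \<in> rel Z"
    using B.I_zero by simp
next
  fix f g assume "emb f \<in> rel Z" "emb g \<in> rel Z"
  then have "(\<lambda>S. emb f S + emb g S) \<in> rel Z"
    by (rule B.I_add)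
  moreover have "emb (\<lambda>S. f S + g S) = (\<lambda>S. emb f S + emb g S)"
    unfolding emb_def by (auto simp: pconst_simps)
  ultimately show "emb (\<lambda>S. f S + g S) \<in> rel Z"
    by simp
next
  fix g :: "'a blow set \<Rightarrow> rat" and U a W b
  assume "g \<in> {ext_boundary vo (v ` C) | C. C \<subseteq> E y \<and> circ C}"
  then obtain C where C: "g = ext_boundary vo (v ` C)" "C \<subseteq> E y" "circ C" by blast
  have "emb g S = ext_boundary r C S" for S
  proof (cases "S \<subseteq> E y")
    case False
    then have "\<not> (\<exists>c\<in>C. S = C - {c})"
      using C(2) by blast
    then have "ext_boundary r C S = (0 :: 'a qpoly)"
      using ext_boundary_nonzero by blast
    then show ?thesis
      using False unfolding emb_def by simp
  qed (simp add: emb_def C(1) ext_boundary_transport[OF inj_v] pconst_boundary)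
  then have "emb g = ext_boundary r C"
    by (rule ext)
  then have "emb g \<in> rel Z"
    using rel_circ[OF C(3)] by simp
  then show "emb (xmul vo (xmul vo (ext_single U a) g) (ext_single W b)) \<in> rel Z"
    unfolding emb_xmul by (intro B.I_xmul_right B.I_xmul_left emb_in)
qed

text \<open>If S is independent, its join is y and it may replace the chosen representative in the
  ideal of DP_y. If S is dependent, the monomial vanishes anyway.\<close>

lemma single_Ky:
  assumes k: "k \<in> Ky" and S: "S \<in> cells"
  shows "ext_single S k \<in> rel Z"
proof (cases "ind S")
  case True
  show ?thesis
  proof (rule rel_single_DP)
    show "S \<subseteq> H"
      using S E_sub unfolding cells_def by blast
    show "k \<in> DP_ideal L H (nested_rep L H r y)"
      using k unfolding Ky_def DPy_ideal_def .
  qed (use nested_rep_cell[OF S True] in blast)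
next
  case False
  then show ?thesis
    using rel_not_ind[of S k] S E_sub K.K_in[OF k] unfolding cells_def by blast
qed

lemma psi_carrier: "p \<in> polys H \<Longrightarrow> psi a p \<in> carrier R"
  unfolding ext_alg_simps using psi_in[of p a] E_sub[of y] by (auto simp: psi_def cells_def)

lemma psi_OI:
  assumes a: "a \<in> Xj" "a \<in> OI" and p: "p \<in> polys H"
  shows "psi a p \<in> rel Z"
proof -
  \<comment> \<open>As a is homogeneous of degree j, restricting it to cells loses nothing below
    y.\<close>
  have "psi a p S = p * emb a S" for S
  proof -
    have "card (v ` S) = card S"
      using card_image[OF inj_on_subset[OF inj_v subset_UNIV]] .
    then have "a (v ` S) = 0" if "card S \<noteq> j"
      using a(1) that unfolding ext_homog_def by auto
    then show ?thesis
      unfolding psi_def emb_def cells_def by (auto simp: pconst_simps mult_ac)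
  qed
  then have "psi a p = (\<lambda>S. p * emb a S)" ..
  then show ?thesis
    using B.I_scale[OF emb_OI[OF a(2)] p] by simp
qed

lemma psi_Ky:
  assumes k: "k \<in> Ky"
  shows "psi a k \<in> rel Z"
proof (rule B.I_singles[OF psi_carrier[OF K.K_in[OF k]]])
  fix S
  show "ext_single S (psi a k S) \<in> rel Z"
  proof (cases "S \<in> cells")
    case True
    then show ?thesis
      using single_Ky[OF K.K_mult'[OF k pconst_in] True] by (simp add: psi_def)
  next
    case False
    then have "ext_single S (psi a k S) = (\<lambda>S. 0)"
      by (auto simp: ext_single_def psi_def)
    then show ?thesis
      using B.I_zero by simp
  qed
qed

text \<open>The difference splits into a contribution of a - a' in the ideal of \<open>OS\<close>
  and one of p - p' in the ideal of DP_y. So the lift is independent of representatives modulo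
  relations.\<close>

lemma psi_cong:
  assumes a: "a \<in> Xj" "a' \<in> Xj" "oc a = oc a'" and p: "p \<in> polys H" "p' \<in> polys H" "kc p = kc p'"
  shows "(\<lambda>S. psi a p S - psi a' p' S) \<in> rel Z"
proof -
  have "(\<lambda>S. a S - a' S) \<in> OI"
    using O.coset_eq_iff'[of a a'] a by simp
  moreover have "(\<lambda>S. a S - a' S) \<in> Xj"
    using Xj_closed(2)[OF a(1) Xj_closed(3)[OF a(2), of "- 1"]] by simp
  ultimately have 1: "psi (\<lambda>S. a S - a' S) p \<in> rel Z"
    using psi_OI p(1) by blast
  have 2: "psi a' (p - p') \<in> rel Z"
    using psi_Ky K.K_eq_iff[OF p(1,2)] p(3) by blast
  have "(\<lambda>S. psi a p S - psi a' p' S) = (\<lambda>S. psi (\<lambda>S. a S - a' S) p S + psi a' (p - p') S)"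
    unfolding psi_diff_left psi_diff_right by simp
  then show ?thesis
    using B.I_add[OF 1 2] by simp
qed

abbreviation "PsiH \<equiv> Psi (polys H)"

text \<open>A bilinearity relation compares the chosen representative of a sum or a multiple with
  the sum or multiple of the chosen representatives. Both represent the same coset, so
  \<open>psi_cong\<close> applies.\<close>

lemma Psi_ker:
  assumes t: "t \<in> ker"
  shows "PsiH t \<in> rel Z"
proof -
  let ?W = "{t. PsiH t \<in> rel Z}"
  let ?b = "rb (polys H)"
  have M: "ra a \<in> Xj" "oc (ra a) = a" if "a \<in> carrier M" for a
    using ra[OF that] by auto
  have N: "?b b \<in> polys H" "kc (?b b) = b" if "b \<in> carrier N'" for b
    using rb[of b "polys H"] that unfolding module_N(1) by auto
  have Mc: "oc a \<in> carrier M" if "a \<in> Xj" for a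
    using that unfolding module_M(1) by blast
  have Nc: "kc p \<in> carrier N'" if "p \<in> polys H" for p
    using that unfolding module_N(1) by blast
  have "ker \<subseteq> ?W"
  proof (rule ker_le)
    have e1: "Poly_Mapping.single (a \<oplus>\<^bsub>M\<^esub> a', b) 1 - Poly_Mapping.single (a, b) 1 - Poly_Mapping.single (a', b) 1 \<in> ?W"
      if ab: "a \<in> carrier M" "a' \<in> carrier M" "b \<in> carrier N'" for a a' b
    proof -
      let ?s = "\<lambda>S. ra a S + ra a' S"
      have s: "?s \<in> Xj" "oc ?s = a \<oplus>\<^bsub>M\<^esub> a'"
        using Xj_closed(2) M(1)[OF ab(1)] M(1)[OF ab(2)] oc_add[OF M(1)[OF ab(1)] M(1)[OF ab(2)]]
          M(2)[OF ab(1)] M(2)[OF ab(2)] by auto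
      have c: "a \<oplus>\<^bsub>M\<^esub> a' \<in> carrier M"
        using Mc[OF s(1)] s(2) by simp
      have "(\<lambda>S. psi (ra (a \<oplus>\<^bsub>M\<^esub> a')) (?b b) S - psi ?s (?b b) S) \<in> rel Z"
        by (rule psi_cong[OF M(1)[OF c] s(1)]) (use M(2)[OF c] s(2) N(1)[OF ab(3)] in auto)
      then show ?thesis
        by (simp add: Psi_diff Psi_add Psi_single pconst_simps psi_add_left diff_diff_eq)
    qed
    have e2: "Poly_Mapping.single (a, b \<oplus>\<^bsub>N'\<^esub> b') 1 - Poly_Mapping.single (a, b) 1 - Poly_Mapping.single (a, b') 1 \<in> ?W"
      if ab: "a \<in> carrier M" "b \<in> carrier N'" "b' \<in> carrier N'" for a b b'
    proof -
      let ?s = "?b b + ?b b'"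
      have s: "?s \<in> polys H" "kc ?s = b \<oplus>\<^bsub>N'\<^esub> b'"
        using polys_simps(3) N(1)[OF ab(2)] N(1)[OF ab(3)] kc_add[OF N(1)[OF ab(2)] N(1)[OF ab(3)]]
          N(2)[OF ab(2)] N(2)[OF ab(3)] by auto
      have c: "b \<oplus>\<^bsub>N'\<^esub> b' \<in> carrier N'"
        using Nc[OF s(1)] s(2) by simp
      have "(\<lambda>S. psi (ra a) (?b (b \<oplus>\<^bsub>N'\<^esub> b')) S - psi (ra a) ?s S) \<in> rel Z"
        by (rule psi_cong[OF M(1)[OF ab(1)] M(1)[OF ab(1)] HOL.refl N(1)[OF c] s(1)]) (use N(2)[OF c] s(2) in simp)
      then show ?thesis
        by (simp add: Psi_diff Psi_add Psi_single pconst_simps psi_add_right diff_diff_eq)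
    qed
    have e3: "Poly_Mapping.single (c \<odot>\<^bsub>M\<^esub> a, b) 1 - Poly_Mapping.single (a, b) c \<in> ?W"
      if ab: "a \<in> carrier M" "b \<in> carrier N'" for a b c
    proof -
      let ?s = "\<lambda>S. c * ra a S"
      have s: "?s \<in> Xj" "oc ?s = c \<odot>\<^bsub>M\<^esub> a"
        using Xj_closed(3)[OF M(1)[OF ab(1)]] oc_scale[OF M(1)[OF ab(1)], of c] M(2)[OF ab(1)] by auto
      have c: "c \<odot>\<^bsub>M\<^esub> a \<in> carrier M"
        using Mc[OF s(1)] s(2) by simp
      have "(\<lambda>S. psi (ra (c \<odot>\<^bsub>M\<^esub> a)) (?b b) S - psi ?s (?b b) S) \<in> rel Z"
        by (rule psi_cong[OF M(1)[OF c] s(1)]) (use M(2)[OF c] s(2) N(1)[OF ab(2)] in auto)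
      then show ?thesis
        by (simp add: Psi_diff Psi_single pconst_simps psi_scale_left)
    qed
    have e4: "Poly_Mapping.single (a, c \<odot>\<^bsub>N'\<^esub> b) 1 - Poly_Mapping.single (a, b) c \<in> ?W"
      if ab: "a \<in> carrier M" "b \<in> carrier N'" for a b c
    proof -
      let ?s = "pconst c * ?b b"
      have s: "?s \<in> polys H" "kc ?s = c \<odot>\<^bsub>N'\<^esub> b"
        using polys_simps(4)[OF pconst_in N(1)[OF ab(2)]] kc_scale[OF N(1)[OF ab(2)], of c] N(2)[OF ab(2)] by auto
      have c: "c \<odot>\<^bsub>N'\<^esub> b \<in> carrier N'"
        using Nc[OF s(1)] s(2) by simp
      have "(\<lambda>S. psi (ra a) (?b (c \<odot>\<^bsub>N'\<^esub> b)) S - psi (ra a) ?s S) \<in> rel Z"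
        by (rule psi_cong[OF M(1)[OF ab(1)] M(1)[OF ab(1)] HOL.refl N(1)[OF c] s(1)]) (use N(2)[OF c] s(2) in simp)
      then show ?thesis
        by (simp add: Psi_diff Psi_single pconst_simps psi_scale_right)
    qed
    show "tensor_rels M N' \<subseteq> ?W"
      unfolding tensor_rels_def Let_def Un_subset_iff using e1 e2 e3 e4 by (intro conjI subsetI) (elim CollectE exE conjE, simp only:)+
    show "0 \<in> ?W"
      using B.I_zero by (simp add: Psi_zero)
    show "s + t \<in> ?W" if "s \<in> ?W" "t \<in> ?W" for s t
      using that B.I_add by (simp add: Psi_add)
    show "Poly_Mapping.map ((*) c) t \<in> ?W" if "t \<in> ?W" for c t
      using that B.I_scale[OF _ pconst_in] by (simp add: Psi_scale)
  qed
  then show ?thesis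
    using t by blast
qed

text \<open>The half of the inverse property that gives injectivity: up to a change of
  representatives, \<open>Psi\<close> returns from \<open>T f\<close> the part of f on cells, and
  \<open>Psi\<close> sends the tensor kernel to relations.\<close>

lemma restrict_rel:
  assumes f: "\<And>S. f S \<in> polys H" and t: "T f \<in> ker"
  shows "(\<lambda>S. if S \<in> cells then f S else 0) \<in> rel Z"
proof -
  let ?g = "\<lambda>S' S. psi (ra (oc (ev S'))) (rb (polys H) (kc (f S'))) S"
  have "(\<lambda>S. ?g S' S - psi (ev S') (f S') S) \<in> rel Z" if S': "S' \<in> cells" for S'
  proof (rule psi_cong)
    show "ra (oc (ev S')) \<in> Xj" "oc (ra (oc (ev S'))) = oc (ev S')"
      using ra[of "oc (ev S')"] ev_in[OF S'] unfolding module_M(1) by auto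
    show "rb (polys H) (kc (f S')) \<in> polys H" "kc (rb (polys H) (kc (f S'))) = kc (f S')"
      using rb[of "kc (f S')" "polys H"] f by auto
  qed (use ev_in[OF S'] f in auto)
  then have "(\<lambda>S. \<Sum>S'\<in>cells. ?g S' S - psi (ev S') (f S') S) \<in> rel Z"
    by (rule B.I_sum)
  moreover have "(\<lambda>S. \<Sum>S'\<in>cells. ?g S' S) \<in> rel Z"
    using Psi_ker[OF t] unfolding T_def Psi_sum tn_def Psi_single by (simp add: pconst_simps)
  ultimately have "(\<lambda>S. (\<Sum>S'\<in>cells. ?g S' S) - (\<Sum>S'\<in>cells. ?g S' S - psi (ev S') (f S') S)) \<in> rel Z"
    by (rule B.I_diff[rotated])
  moreover have "(\<Sum>S'\<in>cells. psi (ev S') (f S') S) = (if S \<in> cells then f S else 0)" for S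
  proof -
    have "(\<Sum>S'\<in>cells. psi (ev S') (f S') S) = (\<Sum>S'\<in>cells. if S = S' then f S else 0)"
      by (rule sum.cong) (auto simp: psi_def ext_single_def pconst_simps inj_image_eq_iff[OF inj_v])
    then show ?thesis
      using finite_cells by simp
  qed
  ultimately show ?thesis
    by (simp add: sum_subtractf)
qed

end


section \<open>Components of the decomposition map\<close>

context nested_cell_rel
begin

definition comp :: "('a set \<Rightarrow> 'a qpoly) \<Rightarrow> ((('a blow set \<Rightarrow> rat) set \<times> 'a qpoly set) \<Rightarrow>\<^sub>0 rat) set" where
  "comp f = cls (T f)"

definition part :: "'a qpoly set \<Rightarrow> ((('a blow set \<Rightarrow> rat) set \<times> 'a qpoly set) \<Rightarrow>\<^sub>0 rat) set set" where
  "part V = cls ` {t. Poly_Mapping.keys t \<subseteq> carrier M \<times> kc ` V}"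

lemma carrier_OS_DPy: "carrier (OS_DPy L H r j y) = part (polys H)"
  unfolding OS_DPy_simps part_def module_N(1) ..

lemma OS_DPy_part: "OS_DPy_part L H r i j y = part {p \<in> polys H. poly_homog i p}"
  unfolding OS_DPy_part_eq part_def ..

lemma comp_in: "(\<And>S. f S \<in> V) \<Longrightarrow> comp f \<in> part V"
  unfolding comp_def part_def using T_keys by blast

lemma comp_add:
  assumes "\<And>S. f S \<in> polys H" "\<And>S. g S \<in> polys H"
  shows "comp f \<oplus>\<^bsub>OS_DPy L H r j y\<^esub> comp g = comp (\<lambda>S. f S + g S)"
  unfolding comp_def OS_DPy_simps(2) cls_eq_iff by (rule eqv_sym[OF T_add[OF assms]])

lemma comp_smult:
  assumes "q \<in> polys H" "\<And>S. f S \<in> polys H"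
  shows "(DP_ideal L H {} +>\<^bsub>poly_ring H\<^esub> q) \<odot>\<^bsub>OS_DPy L H r j y\<^esub> comp f = comp (\<lambda>S. q * f S)"
  unfolding comp_def OS_DPy_simps(4)[OF assms(1)] act_T[OF assms] ..

text \<open>T is additive only modulo the kernel, so the difference is handled by applying
  \<open>T_add\<close> to (f - g) + g.\<close>

lemma T_diff:
  assumes "\<And>S. f S \<in> polys H" "\<And>S. g S \<in> polys H"
  shows "eqv (T f) (T g) \<longleftrightarrow> T (\<lambda>S. f S - g S) \<in> ker"
proof -
  have "eqv (T (\<lambda>S. (f S - g S) + g S)) (T (\<lambda>S. f S - g S) + T g)"
    using assms by (intro T_add polys_simps(6))
  then have "T f - (T (\<lambda>S. f S - g S) + T g) \<in> ker"
    unfolding eqv_def by simp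
  then have k: "T f - T g - T (\<lambda>S. f S - g S) \<in> ker"
    by (simp add: algebra_simps)
  show ?thesis
  proof
    assume "eqv (T f) (T g)"
    then show "T (\<lambda>S. f S - g S) \<in> ker"
      using ker_add[OF _ ker_minus[OF k]] unfolding eqv_def by force
  next
    assume "T (\<lambda>S. f S - g S) \<in> ker"
    then show "eqv (T f) (T g)"
      using ker_add[OF k] unfolding eqv_def by force
  qed
qed

lemma comp_cong:
  assumes "\<And>S. f S \<in> polys H" "\<And>S. g S \<in> polys H" "(\<lambda>S. f S - g S) \<in> rel Z" "Z \<inter> E y = {}"
  shows "comp f = comp g"
  unfolding comp_def cls_eq_iff T_diff[OF assms(1,2)] by (rule T_rel[OF ZH assms(4,3)])

lemma comp_eqD:
  assumes "\<And>S. f S \<in> polys H" "\<And>S. g S \<in> polys H" "comp f = comp g"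
  shows "(\<lambda>S. if S \<in> cells then f S - g S else 0) \<in> rel Z"
proof (rule restrict_rel)
  show "T (\<lambda>S. f S - g S) \<in> ker"
    using assms(3) unfolding comp_def cls_eq_iff T_diff[OF assms(1,2)] .
qed (intro polys_simps(6) assms(1,2))

text \<open>The conclusion quantifies over every f that agrees with h on independent sets with join
  y, so that one f can later serve all y simultaneously.\<close>

lemma comp_surj:
  assumes V: "\<And>p q. p \<in> V \<Longrightarrow> q \<in> V \<Longrightarrow> p + q \<in> V" "\<And>c p. p \<in> V \<Longrightarrow> pconst c * p \<in> V" "0 \<in> V" "V \<subseteq> polys H"
    and x: "x \<in> part V"
  shows "\<exists>h. (\<forall>S. h S \<in> V) \<and> (\<forall>f. (\<forall>S. f S \<in> V) \<longrightarrow> (\<forall>S. ind S \<longrightarrow> card S = j \<longrightarrow> J S = y \<longrightarrow> f S = h S) \<longrightarrow> comp f = x)"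
proof -
  obtain t where t: "Poly_Mapping.keys t \<subseteq> carrier M \<times> kc ` V" "x = cls t"
    using x unfolding part_def by blast
  have P: "Psi V t S \<in> V" for S
    using V(1-3) t(1) by (rule Psi_in)
  have "comp f = x" if f: "\<forall>S. f S \<in> V" "\<forall>S. ind S \<longrightarrow> card S = j \<longrightarrow> J S = y \<longrightarrow> f S = Psi V t S" for f
  proof -
    have "eqv (T f) (T (Psi V t))"
      by (rule T_cong_ind) (use f ind_cell V(4) P in \<open>auto simp: cells_def\<close>)
    then have "eqv (T f) t"
      using T_Psi[OF V(4) t(1)] by (rule eqv_trans)
    then show ?thesis
      unfolding comp_def t(2) cls_eq_iff .
  qed
  then show ?thesis
    using P by blast
qed

end

section \<open>The decomposition\<close>

context nested_rel
begin

definition "Rj j = {f \<in> carrier R. ext_homog j f}"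

definition "Y j = {y \<in> carrier P. rk y = j \<and> E y \<inter> Z = {}}"

abbreviation "cp j y \<equiv> nested_cell_rel.comp L H r y j"

lemma cell_rel: "y \<in> Y j \<Longrightarrow> nested_cell_rel L H r y j Z"
  unfolding Y_def
  by (intro nested_cell_rel.intro nested_cell.intro nested_cell_axioms.intro
      nested_blowup_axioms nested_rel_axioms) auto

definition Phi :: "nat \<Rightarrow> ('a set \<Rightarrow> 'a qpoly)
    \<Rightarrow> 'a blow \<Rightarrow> ((('a blow set \<Rightarrow> rat) set \<times> 'a qpoly set) \<Rightarrow>\<^sub>0 rat) set" where
  "Phi j f = (\<lambda>y\<in>Y j. cp j y f)"

lemma Rj_coeff: "f \<in> Rj j \<Longrightarrow> f S \<in> polys H"
  unfolding Rj_def ext_alg_simps by blast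

lemma RjI: "(\<And>S. f S \<in> polys H) \<Longrightarrow> (\<And>S. f S \<noteq> 0 \<Longrightarrow> S \<subseteq> H \<and> card S = j) \<Longrightarrow> f \<in> Rj j"
  unfolding Rj_def ext_alg_simps ext_homog_def by simp

lemma Rj_support: "f \<in> Rj j \<Longrightarrow> f S \<noteq> 0 \<Longrightarrow> S \<subseteq> H \<and> card S = j"
  unfolding Rj_def ext_alg_simps ext_homog_def by simp

lemma Rj_add:
  assumes "f \<in> Rj j" "g \<in> Rj j"
  shows "(\<lambda>S. f S + g S) \<in> Rj j"
proof (rule RjI)
  show "f S + g S \<in> polys H" for S
    by (intro polys_simps(3) Rj_coeff[OF assms(1)] Rj_coeff[OF assms(2)])
  show "S \<subseteq> H \<and> card S = j" if "f S + g S \<noteq> 0" for S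
    using that Rj_support[OF assms(1), of S] Rj_support[OF assms(2), of S] by (cases "f S = 0") auto
qed

lemma Rj_scale:
  assumes "f \<in> Rj j" "q \<in> polys H"
  shows "(\<lambda>S. q * f S) \<in> Rj j"
proof (rule RjI)
  show "q * f S \<in> polys H" for S
    by (intro polys_simps(4) assms(2) Rj_coeff[OF assms(1)])
  show "S \<subseteq> H \<and> card S = j" if "q * f S \<noteq> 0" for S
    using that Rj_support[OF assms(1), of S] by (cases "f S = 0") auto
qed

text \<open>For injectivity the difference is split by the join of its monomials. The part belonging
  to y is a relation by \<open>comp_eqD\<close>, and the monomials that belong to no summand vanish
  by themselves.\<close>

lemma Phi_eq_iff:
  assumes f: "f \<in> Rj j" and g: "g \<in> Rj j"
  shows "Phi j f = Phi j g \<longleftrightarrow> (\<lambda>S. f S - g S) \<in> rel Z"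
proof
  assume d: "(\<lambda>S. f S - g S) \<in> rel Z"
  have "cp j y f = cp j y g" if y: "y \<in> Y j" for y
  proof -
    interpret nested_cell_rel L H r y j Z
      by (rule cell_rel[OF y])
    show ?thesis
      by (rule comp_cong[OF Rj_coeff[OF f] Rj_coeff[OF g] d]) (use y in \<open>auto simp: Y_def\<close>)
  qed
  then show "Phi j f = Phi j g"
    unfolding Phi_def by (intro restrict_ext)
next
  assume e: "Phi j f = Phi j g"
  let ?d = "\<lambda>S. f S - g S"
  have d: "?d \<in> Rj j"
    using Rj_add[OF f Rj_scale[OF g polys_simps(5)[OF polys_simps(1)]]] by simp
  then have dR: "?d \<in> carrier R"
    unfolding Rj_def by blast
  have zero: "ext_single S 0 \<in> rel Z" for S
  proof -
    have "ext_single S 0 = (\<lambda>S. 0 :: 'a qpoly)"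
      unfolding ext_single_def by auto
    then show ?thesis
      using B.I_zero by simp
  qed
  have sub: "(\<lambda>S. if Q S then ?d S else 0) \<in> carrier R" for Q
    using dR polys_simps(2) unfolding ext_alg_simps by auto
  let ?Q = "\<lambda>y S. ind S \<and> card S = j \<and> J S = y"
  have g_rel: "(\<lambda>S. if ?Q y S then ?d S else 0) \<in> rel Z" if y: "y \<in> Y j" for y
  proof -
    interpret nested_cell_rel L H r y j Z
      by (rule cell_rel[OF y])
    have "comp f = comp g"
      using fun_cong[OF e, of y] y unfolding Phi_def by simp
    then have 1: "(\<lambda>S. if S \<in> cells then ?d S else 0) \<in> rel Z"
      by (rule comp_eqD[OF Rj_coeff[OF f] Rj_coeff[OF g]])
    \<comment> \<open>A dependent cell may lie below several y and would be counted repeatedly in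
      the sum over y, so dependent cells are removed first.\<close>
    have 2: "(\<lambda>S. if S \<in> cells \<and> \<not> ind S then ?d S else 0) \<in> rel Z"
    proof (rule B.I_singles[OF sub])
      fix S assume "S \<subseteq> H"
      then show "ext_single S (if S \<in> cells \<and> \<not> ind S then ?d S else 0) \<in> rel Z"
        using rel_not_ind[of S "?d S"] Rj_coeff[OF d, of S] zero by simp
    qed
    have "?Q y S \<longleftrightarrow> S \<in> cells \<and> ind S" for S
    proof
      assume Q: "?Q y S"
      then have "S \<subseteq> E (J S)"
        using E_J_sup[of S] unfolding ind_def by simp
      then show "S \<in> cells \<and> ind S"
        using Q unfolding cells_def by simp
    next
      assume "S \<in> cells \<and> ind S"
      then show "?Q y S"
        using ind_cell[of S] unfolding cells_def by simp
    qed
    then have "(\<lambda>S. if ?Q y S then ?d S else 0) = (\<lambda>S. (if S \<in> cells then ?d S else 0)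
        - (if S \<in> cells \<and> \<not> ind S then ?d S else 0))"
      by (simp add: fun_eq_iff)
    then show ?thesis
      using B.I_diff[OF 1 2] by simp
  qed
  have sum: "(\<lambda>S. \<Sum>y\<in>Y j. if ?Q y S then ?d S else 0) \<in> rel Z"
    by (rule B.I_sum) (rule g_rel)
  \<comment> \<open>An independent set with j elements has a join of rank j. So the remaining
    monomials have zero coefficient, are dependent, or have a join above some member of Z.\<close>
  have rest: "(\<lambda>S. if \<not> (ind S \<and> card S = j \<and> J S \<in> Y j) then ?d S else 0) \<in> rel Z"
  proof (rule B.I_singles[OF sub])
    fix S assume S: "S \<subseteq> H"
    have "ext_single S (?d S) \<in> rel Z" if n: "\<not> (ind S \<and> card S = j \<and> J S \<in> Y j)"
    proof (cases "card S = j")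
      case cS: True
      show ?thesis
      proof (cases "ind S")
        case True
        then have "J S \<notin> Y j"
          using n cS by blast
        moreover have "J S \<in> carrier P" "rk (J S) = j"
          using True cS J_coord(1)[of S] ind_rank[of S] unfolding ind_def by auto
        ultimately have "E (J S) \<inter> Z \<noteq> {}"
          unfolding Y_def by blast
        then show ?thesis
          by (rule rel_above_Z[OF True _ Rj_coeff[OF d]])
      next
        case False
        then show ?thesis
          by (rule rel_not_ind[OF S _ Rj_coeff[OF d]])
      qed
    next
      case False
      then have "?d S = 0"
        using Rj_support[OF d, of S] by blast
      then show ?thesis
        using zero by simp
    qed
    then show "ext_single S (if \<not> (ind S \<and> card S = j \<and> J S \<in> Y j) then ?d S else 0) \<in> rel Z"
      using zero by simp
  qed
  have "finite (Y j)"
    unfolding Y_def using finite_P by simp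
  then have "(\<Sum>y\<in>Y j. if ?Q y S then ?d S else 0)
      = (if ind S \<and> card S = j \<and> J S \<in> Y j then ?d S else 0)" for S
    by (cases "ind S \<and> card S = j") (auto simp: sum.delta')
  then have "?d S = (\<Sum>y\<in>Y j. if ?Q y S then ?d S else 0)
      + (if \<not> (ind S \<and> card S = j \<and> J S \<in> Y j) then ?d S else 0)" for S
    by simp
  then show "?d \<in> rel Z"
    using B.I_add[OF sum rest] by simp
qed

lemma Phi_surj:
  assumes V: "\<And>p q. p \<in> V \<Longrightarrow> q \<in> V \<Longrightarrow> p + q \<in> V" "\<And>c p. p \<in> V \<Longrightarrow> pconst c * p \<in> V" "0 \<in> V" "V \<subseteq> polys H"
    and x: "x \<in> (\<Pi>\<^sub>E y\<in>Y j. nested_cell_rel.part L H r y j V)"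
  shows "\<exists>f\<in>Rj j. (\<forall>S. f S \<in> V) \<and> Phi j f = x"
proof -
  have "\<exists>h. (\<forall>S. h S \<in> V) \<and> (\<forall>f. (\<forall>S. f S \<in> V) \<longrightarrow>
      (\<forall>S. ind S \<longrightarrow> card S = j \<longrightarrow> J S = y \<longrightarrow> f S = h S) \<longrightarrow> cp j y f = x y)" if y: "y \<in> Y j" for y
  proof (rule nested_cell_rel.comp_surj[OF cell_rel[OF y] V])
    show "x y \<in> nested_cell_rel.part L H r y j V"
      using x y by (rule PiE_mem)
  qed
  then obtain h where h: "\<And>y S. y \<in> Y j \<Longrightarrow> h y S \<in> V"
    and hx: "\<And>y f. y \<in> Y j \<Longrightarrow> (\<forall>S. f S \<in> V) \<Longrightarrow>
      (\<forall>S. ind S \<longrightarrow> card S = j \<longrightarrow> J S = y \<longrightarrow> f S = h y S) \<Longrightarrow> cp j y f = x y"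
    by metis
  \<comment> \<open>Gluing: each independent S takes its coefficient from the lift belonging to its
    own join.\<close>
  define f where "f S = (if ind S \<and> card S = j \<and> J S \<in> Y j then h (J S) S else 0)" for S
  have fV: "f S \<in> V" for S
    unfolding f_def using h V(3) by auto
  have "f S \<in> polys H" for S
    using fV V(4) by blast
  moreover have "S \<subseteq> H \<and> card S = j" if "f S \<noteq> 0" for S
    using that nested_sub[of S] unfolding f_def ind_def by (auto split: if_splits)
  ultimately have "f \<in> Rj j"
    by (rule RjI)
  moreover have "Phi j f = x"
  proof
    fix y
    show "Phi j f y = x y"
    proof (cases "y \<in> Y j")
      case True
      then have "cp j y f = x y"
        using fV by (intro hx) (auto simp: f_def)
      then show ?thesis
        using True unfolding Phi_def by simp
    next
      case False
      then show ?thesis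
        using x unfolding Phi_def by (simp add: PiE_def extensional_def)
    qed
  qed
  ultimately show ?thesis
    using fV by blast
qed

lemma Phi_in:
  assumes "\<And>S. f S \<in> V"
  shows "Phi j f \<in> (\<Pi>\<^sub>E y\<in>Y j. nested_cell_rel.part L H r y j V)"
proof -
  have "cp j y f \<in> nested_cell_rel.part L H r y j V" if y: "y \<in> Y j" for y
    by (rule nested_cell_rel.comp_in[OF cell_rel[OF y] assms])
  then show ?thesis
    unfolding Phi_def by (simp add: restrict_PiE_iff)
qed

text \<open>Both algebras are quotients of the same free module \<open>Rj j\<close>, but one is a
  set of cosets and the other a set of cosets of cosets. Abstracting from the quotient map
  \<open>pi\<close> treats them together.\<close>

lemma iso_of_presentation:
  fixes Mo :: "('a qpoly set, 'm) module" and pi :: "('a set \<Rightarrow> 'a qpoly) \<Rightarrow> 'm"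
  assumes car: "carrier Mo = pi ` Rj j"
    and add: "\<And>f g. f \<in> Rj j \<Longrightarrow> g \<in> Rj j \<Longrightarrow> pi f \<oplus>\<^bsub>Mo\<^esub> pi g = pi (\<lambda>S. f S + g S)"
    and smult: "\<And>q f. q \<in> polys H \<Longrightarrow> f \<in> Rj j \<Longrightarrow>
      (DP_ideal L H {} +>\<^bsub>poly_ring H\<^esub> q) \<odot>\<^bsub>Mo\<^esub> pi f = pi (\<lambda>S. q * f S)"
    and eq: "\<And>f g. f \<in> Rj j \<Longrightarrow> g \<in> Rj j \<Longrightarrow> pi f = pi g \<longleftrightarrow> (\<lambda>S. f S - g S) \<in> rel Z"
    and parts: "\<And>i. Md i = pi ` {f \<in> Rj j. \<forall>S. poly_homog i (f S)}"
  shows "graded_module_iso (DP L H) Mo Md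
    (direct_sum (Y j) (OS_DPy L H r j)) (\<lambda>i. \<Pi>\<^sub>E y\<in>Y j. OS_DPy_part L H r i j y)"
proof -
  let ?D = "direct_sum (Y j) (OS_DPy L H r j)"
  \<comment> \<open>The choice of preimage does not matter: \<open>pi\<close> and
    \<open>Phi j\<close> have the same kernel \<open>rel Z\<close>.\<close>
  define F where "F x = Phi j (SOME f. f \<in> Rj j \<and> pi f = x)" for x
  have F: "F (pi f) = Phi j f" if f: "f \<in> Rj j" for f
  proof -
    have s: "(SOME g. g \<in> Rj j \<and> pi g = pi f) \<in> Rj j \<and> pi (SOME g. g \<in> Rj j \<and> pi g = pi f) = pi f"
      by (rule someI[of "\<lambda>g. g \<in> Rj j \<and> pi g = pi f" f]) (use f in simp)
    show ?thesis
      unfolding F_def using Phi_eq_iff[OF conjunct1[OF s] f] eq[OF conjunct1[OF s] f] conjunct2[OF s] by blast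
  qed
  have carD: "carrier ?D = (\<Pi>\<^sub>E y\<in>Y j. nested_cell_rel.part L H r y j (polys H))"
    unfolding direct_sum_def using nested_cell_rel.carrier_OS_DPy[OF cell_rel] by (simp cong: PiE_cong)
  have partD: "(\<Pi>\<^sub>E y\<in>Y j. OS_DPy_part L H r i j y)
      = (\<Pi>\<^sub>E y\<in>Y j. nested_cell_rel.part L H r y j {p \<in> polys H. poly_homog i p})" for i
    using nested_cell_rel.OS_DPy_part[OF cell_rel] by (simp cong: PiE_cong)
  \<comment> \<open>With V all polynomials this gives surjectivity; with V the polynomials of degree
    i it gives the compatibility with the grading.\<close>
  have image: "F ` pi ` {f \<in> Rj j. \<forall>S. f S \<in> V} = (\<Pi>\<^sub>E y\<in>Y j. nested_cell_rel.part L H r y j V)"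
    if V: "\<And>p q. p \<in> V \<Longrightarrow> q \<in> V \<Longrightarrow> p + q \<in> V" "\<And>c p. p \<in> V \<Longrightarrow> pconst c * p \<in> V" "0 \<in> V" "V \<subseteq> polys H" for V
  proof (intro equalityI subsetI)
    fix x assume "x \<in> F ` pi ` {f \<in> Rj j. \<forall>S. f S \<in> V}"
    then obtain f where "f \<in> Rj j" "\<forall>S. f S \<in> V" "x = F (pi f)" by blast
    then show "x \<in> (\<Pi>\<^sub>E y\<in>Y j. nested_cell_rel.part L H r y j V)"
      using F Phi_in by simp
  next
    fix x assume "x \<in> (\<Pi>\<^sub>E y\<in>Y j. nested_cell_rel.part L H r y j V)"
    then obtain f where "f \<in> Rj j" "\<forall>S. f S \<in> V" "x = Phi j f"
      using Phi_surj[OF V] by metis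
    then show "x \<in> F ` pi ` {f \<in> Rj j. \<forall>S. f S \<in> V}"
      using F[of f] by (intro image_eqI[of _ F "pi f"]) auto
  qed
  have RjV: "{f \<in> Rj j. \<forall>S. f S \<in> polys H} = Rj j"
    using Rj_coeff by blast
  have bij: "bij_betw F (carrier Mo) (carrier ?D)"
  proof (rule bij_betw_imageI)
    show "inj_on F (carrier Mo)"
    proof (rule inj_onI)
      fix x x' assume "x \<in> carrier Mo" "x' \<in> carrier Mo" and e: "F x = F x'"
      then obtain f g where fg: "f \<in> Rj j" "g \<in> Rj j" "x = pi f" "x' = pi g"
        unfolding car by blast
      then have "Phi j f = Phi j g"
        using e F by simp
      then show "x = x'"
        using Phi_eq_iff[OF fg(1,2)] eq[OF fg(1,2)] fg(3,4) by simp
    qed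
    have "F ` pi ` {f \<in> Rj j. \<forall>S. f S \<in> polys H} = carrier ?D"
      unfolding carD by (rule image) (auto simp: polys_simps pconst_in)
    then show "F ` carrier Mo = carrier ?D"
      unfolding car RjV .
  qed
  have hom: "F (x \<oplus>\<^bsub>Mo\<^esub> x') = F x \<oplus>\<^bsub>?D\<^esub> F x'" if "x \<in> carrier Mo" "x' \<in> carrier Mo" for x x'
  proof -
    obtain f g where fg: "f \<in> Rj j" "g \<in> Rj j" "x = pi f" "x' = pi g"
      using \<open>x \<in> carrier Mo\<close> \<open>x' \<in> carrier Mo\<close> unfolding car by blast
    have "F (x \<oplus>\<^bsub>Mo\<^esub> x') = Phi j (\<lambda>S. f S + g S)"
      unfolding fg(3,4) add[OF fg(1,2)] by (rule F[OF Rj_add[OF fg(1,2)]])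
    also have "\<dots> = Phi j f \<oplus>\<^bsub>?D\<^esub> Phi j g"
      unfolding Phi_def direct_sum_def
      using nested_cell_rel.comp_add[OF cell_rel Rj_coeff[OF fg(1)] Rj_coeff[OF fg(2)]]
      by (simp cong: restrict_cong)
    finally show ?thesis
      unfolding fg(3,4) F[OF fg(1)] F[OF fg(2)] .
  qed
  have lin: "F (c \<odot>\<^bsub>Mo\<^esub> x) = c \<odot>\<^bsub>?D\<^esub> F x" if "c \<in> carrier (DP L H)" "x \<in> carrier Mo" for c x
  proof -
    obtain q where q: "q \<in> polys H" "c = DP_ideal L H {} +>\<^bsub>poly_ring H\<^esub> q"
      using \<open>c \<in> carrier (DP L H)\<close> unfolding DP_def carrier_Quot poly_ring_simps by blast
    obtain f where f: "f \<in> Rj j" "x = pi f"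
      using \<open>x \<in> carrier Mo\<close> unfolding car by blast
    have "F (c \<odot>\<^bsub>Mo\<^esub> x) = Phi j (\<lambda>S. q * f S)"
      unfolding q(2) f(2) smult[OF q(1) f(1)] by (rule F[OF Rj_scale[OF f(1) q(1)]])
    also have "\<dots> = c \<odot>\<^bsub>?D\<^esub> Phi j f"
      unfolding Phi_def direct_sum_def q(2)
      using nested_cell_rel.comp_smult[OF cell_rel q(1) Rj_coeff[OF f(1)]]
      by (simp cong: restrict_cong)
    finally show ?thesis
      unfolding f(2) F[OF f(1)] .
  qed
  have deg: "F ` Md i = (\<Pi>\<^sub>E y\<in>Y j. OS_DPy_part L H r i j y)" for i
  proof -
    have "{f \<in> Rj j. \<forall>S. poly_homog i (f S)} = {f \<in> Rj j. \<forall>S. f S \<in> {p \<in> polys H. poly_homog i p}}"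
      using Rj_coeff by blast
    moreover have "F ` pi ` {f \<in> Rj j. \<forall>S. f S \<in> {p \<in> polys H. poly_homog i p}}
        = (\<Pi>\<^sub>E y\<in>Y j. nested_cell_rel.part L H r y j {p \<in> polys H. poly_homog i p})"
      by (rule image) (auto simp: polys_simps pconst_in poly_homog_simps)
    ultimately show ?thesis
      unfolding parts partD by simp
  qed
  have "F \<in> hom (add_monoid Mo) (add_monoid ?D)"
    unfolding hom_def using hom bij_betw_imp_surj_on[OF bij] by auto
  then have "F \<in> iso (add_monoid Mo) (add_monoid ?D)"
    unfolding iso_def using bij by simp
  then show ?thesis
    unfolding graded_module_iso_def using lin deg by blast
qed

end

section \<open>The algebras \<open>B\<close> and its hat version\<close>

context nested_blowup
begin

abbreviation "bi \<equiv> Bhat_ideal L H r"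
abbreviation bc :: "('a set \<Rightarrow> 'a qpoly) \<Rightarrow> ('a set \<Rightarrow> 'a qpoly) set" where
  "bc f \<equiv> bi +>\<^bsub>R\<^esub> f"

lemma nested_rel_empty: "nested_rel L H r {}"
  by (intro nested_rel.intro nested_blowup_axioms nested_rel_axioms.intro) simp

lemma free_gc_eq: "free_gc H r = R"
  unfolding free_gc_def ..

lemma ext_ideal_bi: "ext_ideal r H (polys H) bi"
  unfolding Bhat_ideal_eq by (rule ext_ideal_rel) simp

lemma DP_to_Bhat_coset:
  assumes q: "q \<in> polys H"
  shows "DP_to_Bhat L H r (DP_ideal L H {} +>\<^bsub>poly_ring H\<^esub> q) = bc (ext_single {} q)"
proof -
  interpret I: ext_ideal r H "polys H" bi
    by (rule ext_ideal_bi)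
  interpret D: poly_ideal H "DP_ideal L H {}"
    by (rule poly_ideal_DP)
  have si: "ext_single {} g \<in> carrier R" if "g \<in> polys H" for g
    by (rule ext_single_in[OF subring_polys empty_subsetI that])
  show ?thesis
    unfolding DP_to_Bhat_def free_gc_eq
  proof (rule coset_map_eqI[OF I.idl])
    show "q \<in> DP_ideal L H {} +>\<^bsub>poly_ring H\<^esub> q"
      using D.a_rcos_self[of q] q by (simp add: poly_ring_simps)
    fix g assume g: "g \<in> DP_ideal L H {} +>\<^bsub>poly_ring H\<^esub> q"
    then obtain d where d: "d \<in> DP_ideal L H {}" "g = d + q"
      unfolding a_r_coset_def r_coset_def by (auto simp: poly_ring_simps)
    then have gp: "g \<in> polys H"
      using polys_simps(3)[OF D.K_in[OF d(1)] q] by simp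
    have "ext_single {} g \<ominus>\<^bsub>R\<^esub> ext_single {} q = ext_single {} d"
      unfolding a_minus_ext_alg[OF finite_H subring_polys si[OF gp] si[OF q]]
      using d(2) by (auto simp: ext_single_def)
    then show "ext_single {} g \<in> carrier R \<and> ext_single {} g \<ominus>\<^bsub>R\<^esub> ext_single {} q \<in> bi"
      using si[OF gp] nested_rel.rel_single_DP[OF nested_rel_empty empty_subsetI _ d(1)] unfolding Bhat_ideal_eq by simp
  qed
qed

lemma bc_add: "f \<in> carrier R \<Longrightarrow> g \<in> carrier R \<Longrightarrow> set_add R (bc f) (bc g) = bc (\<lambda>S. f S + g S)"
proof -
  interpret I: ext_ideal r H "polys H" bi
    by (rule ext_ideal_bi)
  show "f \<in> carrier R \<Longrightarrow> g \<in> carrier R \<Longrightarrow> set_add R (bc f) (bc g) = bc (\<lambda>S. f S + g S)"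
    using I.a_rcos_sum[of f g] by (simp add: ext_alg_simps(5))
qed

lemma bc_scale:
  assumes q: "q \<in> polys H" and f: "f \<in> carrier R"
  shows "bc (ext_single {} q) \<otimes>\<^bsub>R Quot bi\<^esub> bc f = bc (\<lambda>S. q * f S)"
proof -
  interpret I: ext_ideal r H "polys H" bi
    by (rule ext_ideal_bi)
  have "bc (ext_single {} q) \<otimes>\<^bsub>R Quot bi\<^esub> bc f = bc (ext_single {} q \<otimes>\<^bsub>R\<^esub> f)"
    unfolding mult_Quot
    by (rule I.rcoset_mult_add[OF ext_single_in[OF subring_polys empty_subsetI q] f])
  then show ?thesis
    unfolding ext_alg_simps(2) xmul_scalar[OF finite_H f] .
qed

lemma Bhat_col_eq:
  "carrier (Bhat_col L H r j) = bc ` {f \<in> carrier R. ext_homog j f}"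
  "add (Bhat_col L H r j) = set_add R"
  "smult (Bhat_col L H r j) = (\<lambda>c x. DP_to_Bhat L H r c \<otimes>\<^bsub>R Quot bi\<^esub> x)"
  unfolding Bhat_col_def alg_module_def Bhat_def free_gc_eq by (simp_all add: add_Quot)

lemma Bhat_decomposition: "graded_module_iso (DP L H) (Bhat_col L H r j) (\<lambda>i. Bhat_part L H r i j)
  (direct_sum {y \<in> carrier P. rk y = j} (OS_DPy L H r j))
  (\<lambda>i. \<Pi>\<^sub>E y\<in>{y \<in> carrier P. rk y = j}. OS_DPy_part L H r i j y)"
proof -
  interpret nested_rel L H r "{}"
    by (rule nested_rel_empty)
  interpret I: ext_ideal r H "polys H" bi
    by (rule ext_ideal_bi)
  have "Y j = {y \<in> carrier P. rk y = j}"
    unfolding Y_def by simp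
  moreover have "graded_module_iso (DP L H) (Bhat_col L H r j) (\<lambda>i. Bhat_part L H r i j)
      (direct_sum (Y j) (OS_DPy L H r j)) (\<lambda>i. \<Pi>\<^sub>E y\<in>Y j. OS_DPy_part L H r i j y)"
  proof (rule iso_of_presentation)
    show "carrier (Bhat_col L H r j) = bc ` Rj j"
      unfolding Bhat_col_eq Rj_def ..
    show "bc f \<oplus>\<^bsub>Bhat_col L H r j\<^esub> bc g = bc (\<lambda>S. f S + g S)" if "f \<in> Rj j" "g \<in> Rj j" for f g
      using that bc_add unfolding Bhat_col_eq Rj_def by simp
    show "(DP_ideal L H {} +>\<^bsub>poly_ring H\<^esub> q) \<odot>\<^bsub>Bhat_col L H r j\<^esub> bc f = bc (\<lambda>S. q * f S)"
      if "q \<in> polys H" "f \<in> Rj j" for q f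
      using that bc_scale DP_to_Bhat_coset unfolding Bhat_col_eq Rj_def by simp
    show "bc f = bc g \<longleftrightarrow> (\<lambda>S. f S - g S) \<in> rel {}" if "f \<in> Rj j" "g \<in> Rj j" for f g
      using I.coset_eq_iff'[of f g] that unfolding Rj_def Bhat_ideal_eq by simp
    show "Bhat_part L H r i j = bc ` {f \<in> Rj j. \<forall>S. poly_homog i (f S)}" for i
      unfolding Bhat_part_def free_gc_eq Rj_def by (rule arg_cong[where f = "\<lambda>A. bc ` A"]) auto
  qed
  ultimately show ?thesis
    by simp
qed

text \<open>Once the two successive quotients are recognized as one quotient by
  \<open>rel {\<top>}\<close>, the general presentation applies. The condition that y is not above
  the vertex of \<top> is disjointness of \<open>E y\<close> from {\<top>}.\<close>

lemma B_decomposition: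
  assumes top: "\<top> \<in> H"
  shows "graded_module_iso (DP L H) (B_col L H r j) (\<lambda>i. B_part L H r i j)
    (direct_sum {y \<in> carrier P. rk y = j \<and> \<not> v \<top> \<sqsubseteq>\<^bsub>P\<^esub> y} (OS_DPy L H r j))
    (\<lambda>i. \<Pi>\<^sub>E y\<in>{y \<in> carrier P. rk y = j \<and> \<not> v \<top> \<sqsubseteq>\<^bsub>P\<^esub> y}. OS_DPy_part L H r i j y)"
proof -
  interpret nested_rel L H r "{\<top>}"
    by (intro nested_rel.intro nested_blowup_axioms nested_rel_axioms.intro) (use top in simp)
  interpret I: ext_ideal r H "polys H" bi
    by (rule ext_ideal_bi)
  interpret RB: ring "R Quot bi"
    by (rule I.quotient_is_ring)
  let ?Q = "R Quot bi"
  let ?BI = "B_ideal L H r"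
  let ?e = "ext_single {\<top>} 1 :: 'a set \<Rightarrow> 'a qpoly"
  have eR: "?e \<in> carrier R"
    by (rule ext_single_in[OF subring_polys _ polys_simps(1)]) (use top in simp)
  have BI: "?BI = Idl\<^bsub>?Q\<^esub> {bc ?e}"
    unfolding B_ideal_def Bhat_def free_gc_eq ..
  have bcQ: "bc f \<in> carrier ?Q" if "f \<in> carrier R" for f
    using that unfolding carrier_Quot by blast
  have BIi: "ideal ?BI ?Q"
    unfolding BI by (rule RB.genideal_ideal) (use bcQ[OF eR] in simp)
  interpret BI: ideal ?BI ?Q
    by (rule BIi)
  have hom: "bc f \<oplus>\<^bsub>?Q\<^esub> bc g = bc (\<lambda>S. f S + g S)" "bc f \<otimes>\<^bsub>?Q\<^esub> bc g = bc (xmul r f g)"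
    if "f \<in> carrier R" "g \<in> carrier R" for f g
    using bc_add[OF that] I.rcoset_mult_add[OF that] unfolding add_Quot mult_Quot ext_alg_simps(2) by auto
  have minus: "bc f \<ominus>\<^bsub>?Q\<^esub> bc g = bc (\<lambda>S. f S - g S)" if fg: "f \<in> carrier R" "g \<in> carrier R" for f g
  proof -
    have d: "(\<lambda>S. f S - g S) \<in> carrier R"
      using B.minus_closed[OF fg] unfolding a_minus_ext_alg[OF finite_H subring_polys fg] .
    have "bc f = bc (\<lambda>S. f S - g S) \<oplus>\<^bsub>?Q\<^esub> bc g"
      unfolding hom[OF d fg(2)] by simp
    then show ?thesis
      using bcQ[OF d] bcQ[OF fg(2)] by (simp add: RB.minus_eq RB.a_assoc RB.r_neg)
  qed
  \<comment> \<open>The preimage in the free algebra of the ideal generated by the class of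
    \<open>?e\<close>. One inclusion holds because the image of \<open>rel {\<top>}\<close> is an
    ideal of the quotient containing that class, and \<open>rel {\<top>}\<close> contains the kernel
    \<open>bi\<close>; the other is an induction over generators.\<close>
  have rel_iff: "bc f \<in> ?BI \<longleftrightarrow> f \<in> rel {\<top>}" if f: "f \<in> carrier R" for f
  proof
    have eI: "ideal ((\<lambda>f. bc f) ` rel {\<top>}) ?Q"
      by (rule B.ring_ideal_imp_quot_ideal[OF I.idl B.idl])
    have "bc ?e \<in> (\<lambda>f. bc f) ` rel {\<top>}"
      using rel_Z[of \<top>] by blast
    then have "?BI \<subseteq> (\<lambda>f. bc f) ` rel {\<top>}"
      unfolding BI by (intro RB.genideal_minimal[OF eI]) simp
    moreover assume "bc f \<in> ?BI"
    ultimately obtain g where g: "g \<in> rel {\<top>}" "bc f = bc g" by blast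
    then have "(\<lambda>S. f S - g S) \<in> bi"
      using I.coset_eq_iff'[OF f B.I_carrier[OF g(1)]] by simp
    then have "(\<lambda>S. f S - g S) \<in> rel {\<top>}"
      using rel_mono unfolding Bhat_ideal_eq by blast
    then have "(\<lambda>S. (f S - g S) + g S) \<in> rel {\<top>}"
      using g(1) by (rule B.I_add)
    then show "f \<in> rel {\<top>}" by simp
  next
    assume fr: "f \<in> rel {\<top>}"
    have "f \<in> carrier R \<and> bc f \<in> ?BI"
    proof (rule ext_Idl_induct[OF finite_H subring_polys gens_carrier[OF ZH] fr[unfolded rel_def],
          where Q = "\<lambda>f. f \<in> carrier R \<and> bc f \<in> ?BI"])
      have "bc (\<lambda>S. 0) = bi"
        by (rule I.a_rcos_const[OF I.I_zero])
      then show "(\<lambda>S. 0) \<in> carrier R \<and> bc (\<lambda>S. 0) \<in> ?BI"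
        using additive_subgroup.zero_closed[OF BI.is_additive_subgroup] I.I_carrier[OF I.I_zero]
        unfolding zero_Quot by simp
      show "(\<lambda>S. f S + g S) \<in> carrier R \<and> bc (\<lambda>S. f S + g S) \<in> ?BI"
        if "f \<in> carrier R \<and> bc f \<in> ?BI" "g \<in> carrier R \<and> bc g \<in> ?BI" for f g
        using that additive_subgroup.a_closed[OF BI.is_additive_subgroup, of "bc f" "bc g"] hom(1)[of f g]
          B.add.m_closed[of f g] by (simp add: ext_alg_simps(5))
      fix g U a W b assume g: "g \<in> gens {\<top>}" and U: "U \<subseteq> H" "W \<subseteq> H" "a \<in> polys H" "b \<in> polys H"
      let ?a = "ext_single U a" and ?b = "ext_single W b"
      have ab: "?a \<in> carrier R" "?b \<in> carrier R"
        using U ext_single_in[OF subring_polys] by blast+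
      have gR: "g \<in> carrier R"
        using g gens_carrier[OF ZH] by blast
      have bg: "bc g \<in> ?BI"
      \<comment> \<open>Every generator other than \<open>?e\<close> is already zero in the hat
        version.\<close>
      proof (cases "g = ?e")
        case True
        then show ?thesis
          unfolding BI using RB.genideal_self'[OF bcQ[OF eR]] by simp
      next
        case False
        then have "g \<in> gens {}"
          using g unfolding gens_def by blast
        then have "g \<in> bi"
          using nested_rel.gens_rel[OF nested_rel_empty] unfolding Bhat_ideal_eq by blast
        then have "bc g = bi"
          by (rule I.a_rcos_const)
        then show ?thesis
          using additive_subgroup.zero_closed[OF BI.is_additive_subgroup] unfolding zero_Quot by simp
      qed
      have ag: "xmul r ?a g \<in> carrier R"
        by (rule xmul_closed[OF subring_polys ab(1) gR])
      have "bc ?a \<otimes>\<^bsub>?Q\<^esub> bc g \<otimes>\<^bsub>?Q\<^esub> bc ?b \<in> ?BI"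
        using bg bcQ[OF ab(1)] bcQ[OF ab(2)] by (intro BI.I_r_closed BI.I_l_closed)
      then have "bc (xmul r (xmul r ?a g) ?b) \<in> ?BI"
        unfolding hom(2)[OF ab(1) gR] hom(2)[OF ag ab(2)] .
      then show "xmul r (xmul r ?a g) ?b \<in> carrier R \<and> bc (xmul r (xmul r ?a g) ?b) \<in> ?BI"
        using xmul_closed[OF subring_polys ag ab(2)] by simp
    qed
    then show "bc f \<in> ?BI" by simp
  qed
  let ?pi = "\<lambda>f. ?BI +>\<^bsub>?Q\<^esub> bc f"
  have Q: "Bhat L H r = ?Q"
    unfolding Bhat_def free_gc_eq ..
  have col: "carrier (B_col L H r j) = ?pi ` Rj j" "add (B_col L H r j) = set_add ?Q"
    "smult (B_col L H r j) = (\<lambda>c x. (?BI +>\<^bsub>?Q\<^esub> DP_to_Bhat L H r c) \<otimes>\<^bsub>?Q Quot ?BI\<^esub> x)"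
    unfolding B_col_def alg_module_def B_alg_def Bhat_col_eq Q Rj_def by (auto simp: add_Quot)
  have RjR: "f \<in> carrier R" if "f \<in> Rj j" for f
    using that unfolding Rj_def by blast
  have "graded_module_iso (DP L H) (B_col L H r j) (\<lambda>i. B_part L H r i j)
      (direct_sum (Y j) (OS_DPy L H r j)) (\<lambda>i. \<Pi>\<^sub>E y\<in>Y j. OS_DPy_part L H r i j y)"
  proof (rule iso_of_presentation[of _ ?pi])
    show "carrier (B_col L H r j) = ?pi ` Rj j"
      by (rule col(1))
    show "?pi f \<oplus>\<^bsub>B_col L H r j\<^esub> ?pi g = ?pi (\<lambda>S. f S + g S)" if "f \<in> Rj j" "g \<in> Rj j" for f g
      unfolding col BI.a_rcos_sum[OF bcQ[OF RjR[OF that(1)]] bcQ[OF RjR[OF that(2)]]]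
        hom(1)[OF RjR[OF that(1)] RjR[OF that(2)]] ..
    show "(DP_ideal L H {} +>\<^bsub>poly_ring H\<^esub> q) \<odot>\<^bsub>B_col L H r j\<^esub> ?pi f = ?pi (\<lambda>S. q * f S)"
      if "q \<in> polys H" "f \<in> Rj j" for q f
      unfolding col DP_to_Bhat_coset[OF that(1)] mult_Quot[of ?Q]
        BI.rcoset_mult_add[OF bcQ[OF ext_single_in[OF subring_polys empty_subsetI that(1)]] bcQ[OF RjR[OF that(2)]]]
        bc_scale[OF that(1) RjR[OF that(2)]] ..
    show "?pi f = ?pi g \<longleftrightarrow> (\<lambda>S. f S - g S) \<in> rel {\<top>}" if "f \<in> Rj j" "g \<in> Rj j" for f g
    proof -
      have fg: "f \<in> carrier R" "g \<in> carrier R"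
        using that RjR by auto
      have d: "(\<lambda>S. f S - g S) \<in> carrier R"
        using B.minus_closed[OF fg] unfolding a_minus_ext_alg[OF finite_H subring_polys fg] .
      show ?thesis
        unfolding BI.coset_eq_iff[OF bcQ[OF fg(1)] bcQ[OF fg(2)]] minus[OF fg] rel_iff[OF d] ..
    qed
    show "B_part L H r i j = ?pi ` {f \<in> Rj j. \<forall>S. poly_homog i (f S)}" for i
    proof -
      have "Bhat_part L H r i j = bc ` {f \<in> Rj j. \<forall>S. poly_homog i (f S)}"
        unfolding Bhat_part_def free_gc_eq Rj_def by (rule arg_cong[where f = "\<lambda>A. bc ` A"]) auto
      then show ?thesis
        unfolding B_part_def Q by (simp add: image_image)
    qed
  qed
  moreover have "Y j = {y \<in> carrier P. rk y = j \<and> \<not> v \<top> \<sqsubseteq>\<^bsub>P\<^esub> y}"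
    unfolding Y_def E_def using top by auto
  ultimately show ?thesis
    by simp
qed

end

theorem proposition5p1p4:
  fixes L :: "'a gorder" and H :: "'a set" and r :: "('a \<times> 'a) set"
  assumes "geometric_lattice L"
    and "partial_building_set L H"
    and "strict_linear_order_on H r"
    and "\<forall>p\<in>H. \<forall>q\<in>H. q \<sqsubset>\<^bsub>L\<^esub> p \<longrightarrow> (p, q) \<in> r"
  shows
    "(\<forall>j. let Y = {y \<in> carrier (iter_blowup L H r). poset_rank (iter_blowup L H r) y = j} in
        graded_module_iso (DP L H)
          (Bhat_col L H r j) (\<lambda>i. Bhat_part L H r i j)
          (direct_sum Y (OS_DPy L H r j)) (\<lambda>i. \<Pi>\<^sub>E y\<in>Y. OS_DPy_part L H r i j y))
     \<and> (\<top>\<^bsub>L\<^esub> \<in> H \<longrightarrow>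
        (\<forall>j. let Y = {y \<in> carrier (iter_blowup L H r). poset_rank (iter_blowup L H r) y = j
                        \<and> \<not> vertex L \<top>\<^bsub>L\<^esub> \<sqsubseteq>\<^bsub>iter_blowup L H r\<^esub> y} in
          graded_module_iso (DP L H)
            (B_col L H r j) (\<lambda>i. B_part L H r i j)
            (direct_sum Y (OS_DPy L H r j)) (\<lambda>i. \<Pi>\<^sub>E y\<in>Y. OS_DPy_part L H r i j y)))"
proof -
  interpret nested_blowup L H r
    using assms by unfold_locales
  show ?thesis
    unfolding Let_def using Bhat_decomposition B_decomposition by blast
qed

end
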